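(* Let $G$ be the Cayley transform of $U(1,1;\mathbb{Z}[i])$. Then $$M^{\mathbb{C}}_{*}(G)\cong\mathbb{C}[\alpha,\beta],$$ a polynomial ring on $\alpha=-2^{7}(\epsilon'-\frac{1}{2}\delta'^{2})$ and $\beta=2^{12}\delta'^{4}$, which are automorphic forms for $G$ of weight four and eight, respectively.
   Context: $U(1,1;\mathbb{Z}[i])$ is the group of matrices $g$ with entries in $\mathbb{Z}[i]$ satisfying $\bar g^{tr}Hg=H$, $H=\mathrm{diag}(1,-1)$. Put $g_0=\frac{1}{\sqrt2}\begin{pmatrix}1&i\\ i&1\end{pmatrix}$; the Cayley transform of $U(1,1;\mathbb{Z}[i])$ is $G=g_0\,U(1,1;\mathbb{Z}[i])\,g_0^{-1}\subset GL_2(\mathbb{C})$, which acts on the upper half plane $\mathbb{H}_1$ by fractional linear transformations. An automorphic form of weight $k$ for $G$ is a holomorphic function $f$ on $\mathbb{H}_1$ with $f(\frac{a\tau+b}{c\tau+d})=(c\tau+d)^kf(\tau)$ for all $\begin{pmatrix}a&b\\c&d\end{pmatrix}\in G$, holomorphic at the unique cusp $i\infty$ (i.e. with a power series expansion in $q^{1/2}$, $q=e^{2\pi i\tau}$). $M^{\mathbb{C}}_*(G)$ is the ring of automorphic forms for $G$, graded by degree, the degree of a form being twice its weight. Let $\theta[\begin{smallmatrix}1\\0\end{smallmatrix}](\tau)=\sum_{n\in\mathbb{Z}}e^{\pi i(n+1/2)^2\tau}$, $\theta[\begin{smallmatrix}0\\1\end{smallmatrix}](\tau)=\sum_{n\in\mathbb{Z}}(-1)^ne^{\pi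 i n^2\tau}$ and $\delta'=\frac18(\theta[\begin{smallmatrix}1\\0\end{smallmatrix}]^4-\theta[\begin{smallmatrix}0\\1\end{smallmatrix}]^4)$, $\epsilon'=-\frac1{16}\theta[\begin{smallmatrix}1\\0\end{smallmatrix}]^4\theta[\begin{smallmatrix}0\\1\end{smallmatrix}]^4$. *)

theory Defs
  imports
    "HOL-Analysis.Analysis"
    "HOL-Computational_Algebra.Polynomial"
    "HOL-Library.Function_Algebras"
    "HOL-Library.Poly_Mapping"
    "HOL-Algebra.Algebraic_Closure_Type"
begin

definition gaussian_ints :: "complex set" where
  "gaussian_ints = {z. Re z \<in> \<int> \<and> Im z \<in> \<int>}"

definition conj_transpose :: "complex^'n^'m \<Rightarrow> complex^'m^'n" where
  "conj_transpose g = (\<chi> i j. cnj (g $ j $ i))"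

definition H_form :: "complex^2^2" where
  "H_form = vector [vector [1, 0], vector [0, -1]]"

definition U11 :: "(complex^2^2) set" where
  "U11 = {g. (\<forall>i j. g $ i $ j \<in> gaussian_ints) \<and> conj_transpose g ** H_form ** g = H_form}"

definition g0 :: "complex^2^2" where
  "g0 = (1 / sqrt 2) *\<^sub>R vector [vector [1, \<i>], vector [\<i>, 1]]"

definition cayley_U11 :: "(complex^2^2) set" where
  "cayley_U11 = (\<lambda>u. g0 ** u ** matrix_inv g0) ` U11"

definition upper_half_plane :: "complex set" where
  "upper_half_plane = {\<tau>. Im \<tau> > 0}"

definition frac_lin :: "complex^2^2 \<Rightarrow> complex \<Rightarrow> complex" where
  "frac_lin g \<tau> = (g$1$1 * \<tau> + g$1$2) / (g$2$1 * \<tau> + g$2$2)"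

text \<open>Functions on the upper half plane are represented by their extension by zero to
  the whole plane, so that equality of forms is equality in the function type.\<close>

definition on_uhp :: "(complex \<Rightarrow> complex) \<Rightarrow> complex \<Rightarrow> complex" where
  "on_uhp f = (\<lambda>\<tau>. if \<tau> \<in> upper_half_plane then f \<tau> else 0)"

text \<open>In the last condition \<open>exp (\<i> \<pi> \<tau>)\<close> is \<open>q\<close> to the power \<open>1/2\<close>, where \<open>q = exp (2 \<pi> \<i> \<tau>)\<close>.\<close>

definition automorphic_form :: "(complex^2^2) set \<Rightarrow> int \<Rightarrow> (complex \<Rightarrow> complex) \<Rightarrow> bool" where
  "automorphic_form \<Gamma> k f \<longleftrightarrow>
     (\<forall>\<tau>. \<tau> \<notin> upper_half_plane \<longrightarrow> f \<tau> = 0) \<and>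
     f holomorphic_on upper_half_plane \<and>
     (\<forall>g\<in>\<Gamma>. \<forall>\<tau>\<in>upper_half_plane.
        f (frac_lin g \<tau>) = (g$2$1 * \<tau> + g$2$2) powi k * f \<tau>) \<and>
     (\<exists>a :: nat \<Rightarrow> complex. \<forall>\<tau>\<in>upper_half_plane.
        (\<lambda>n. a n * exp (\<i> * pi * \<tau>) ^ n) sums f \<tau>)"

text \<open>The homogeneous elements of degree \<open>d\<close>: forms of weight \<open>d/2\<close>, and only \<open>0\<close> if \<open>d\<close> is odd.\<close>

definition forms_of_degree :: "(complex^2^2) set \<Rightarrow> int \<Rightarrow> (complex \<Rightarrow> complex) set" where
  "forms_of_degree \<Gamma> d = {f. f = 0 \<or> (\<exists>k. d = 2 * k \<and> automorphic_form \<Gamma> k f)}"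

text \<open>The graded ring is the direct sum of its homogeneous parts. An element is a finitely
  supported family indexed by the degree; the product on the type of such families is the
  convolution product with pointwise multiplication of functions. The unit is the constant
  form \<open>1\<close> on the upper half plane, not the unit of the ambient type.\<close>

definition automorphic_ring :: "(complex^2^2) set \<Rightarrow> (int \<Rightarrow>\<^sub>0 (complex \<Rightarrow> complex)) ring" where
  "automorphic_ring \<Gamma> =
     \<lparr> carrier = {F. \<forall>d. Poly_Mapping.lookup F d \<in> forms_of_degree \<Gamma> d},
       mult = (\<lambda>F G. F * G),
       one = Poly_Mapping.single 0 (on_uhp (\<lambda>_. 1)),
       zero = 0,
       add = (\<lambda>F G. F + G) \<rparr>"

text \<open>A form of weight \<open>k\<close> as a homogeneous element of degree \<open>2 * k\<close>.\<close>

definition of_weight :: "int \<Rightarrow> (complex \<Rightarrow> complex) \<Rightarrow> (int \<Rightarrow>\<^sub>0 (complex \<Rightarrow> complex))" where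
  "of_weight k f = Poly_Mapping.single (2 * k) f"

definition theta10 :: "complex \<Rightarrow> complex" where
  "theta10 \<tau> = (\<Sum>\<^sub>\<infinity>n::int. exp (pi * \<i> * (of_int n + 1/2)^2 * \<tau>))"

definition theta01 :: "complex \<Rightarrow> complex" where
  "theta01 \<tau> = (\<Sum>\<^sub>\<infinity>n::int. (-1) powi n * exp (pi * \<i> * (of_int n)^2 * \<tau>))"

definition delta' :: "complex \<Rightarrow> complex" where
  "delta' \<tau> = 1/8 * (theta10 \<tau> ^ 4 - theta01 \<tau> ^ 4)"

definition epsilon' :: "complex \<Rightarrow> complex" where
  "epsilon' \<tau> = - (1/16) * theta10 \<tau> ^ 4 * theta01 \<tau> ^ 4"

definition alpha :: "complex \<Rightarrow> complex" where
  "alpha = on_uhp (\<lambda>\<tau>. - (2^7) * (epsilon' \<tau> - 1/2 * delta' \<tau> ^ 2))"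

definition beta :: "complex \<Rightarrow> complex" where
  "beta = on_uhp (\<lambda>\<tau>. 2^12 * delta' \<tau> ^ 4)"

end

theory Submission
  imports
    Defs
    "HOL-Complex_Analysis.Complex_Analysis"
    "HOL-Real_Asymp.Real_Asymp"
begin

text \<open>
  Write \<open>x = exp (\<i> \<pi> \<tau>)\<close>, which maps the upper half plane onto the punctured unit disc, and put
  \<open>A = \<theta>[1,0]^4\<close> and \<open>B = \<theta>[0,1]^4\<close>. Then \<open>\<alpha> = A^2 + 6 A B + B^2\<close> and \<open>\<beta> = (A - B)^4\<close>. Modulo scalars,
  the Cayley transform of \<open>U(1,1;\<int>[\<i>])\<close> is generated by the translation \<open>\<tau> + 2\<close> and by the elliptic
  element \<open>(\<tau> - 1) / (\<tau> + 1)\<close>, which turns the half plane around \<open>\<i>\<close> by a right angle; it is a triangle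
  group with angles belonging to orders 2, 4 and infinity.

  Automorphy of \<open>\<alpha>\<close> and \<open>\<beta>\<close> is invariance under these two maps. The translation is clear from the series
  in \<open>x\<close>. The quarter turn is an inversion composed with a scaling by 2, so its effect on the theta
  constants follows from the inversion formula (\<open>theta00_inversion\<close>) and from the doubling formulas
  (\<open>theta00_square\<close>, \<open>theta01_square\<close>). That the two maps suffice is a Euclidean descent on the bottom row of
  a matrix of the theta group (\<open>theta_group_law\<close>, \<open>transforms_cayley_U11\<close>).

  The structure of the ring rests on the cusp form \<open>\<Delta> = \<alpha>^2 - \<beta> = 16 A B (A + B)^2\<close> of weight 8. By Jacobi's
  identity \<open>A + B = \<theta>[0,0]^4\<close>, and each theta constant is visibly nonzero where \<open>Im \<tau> \<ge> 1/2\<close>. Every orbit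
  meets that region (\<open>upper_half_plane_reduction\<close>), so \<open>\<Delta>\<close> has no zero in the half plane, and it has a
  simple zero at the cusp (\<open>disc_unit_nonzero\<close>). Furthermore an invariant function that is holomorphic at
  the cusp attains its maximum modulus on a compact part of the disc and is constant
  (\<open>invariant_series_constant\<close>). If \<open>f\<close> had weight \<open>-4 j < 0\<close>, then \<open>f^2 \<Delta>^j\<close> would be such a function and
  vanish at the cusp; so there are no nonzero forms of negative weight.

  Scalar matrices force the weight to be a multiple of 4. A form of weight \<open>4 m\<close> minus a suitable
  multiple of \<open>\<alpha>^m\<close> vanishes at the cusp and is thus \<open>\<Delta>\<close> times a form of weight \<open>4 m - 8\<close>
  (\<open>automorphic_form_decomposition\<close>). Induction on \<open>m\<close> shows that \<open>\<alpha>\<close> and \<open>\<beta>\<close> generate the ring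
  (\<open>of_weight_in_range\<close>). They are algebraically independent because \<open>\<beta> / \<alpha>^2\<close> takes infinitely many values
  (\<open>form_eval_kernel\<close>).
\<close>

text \<open>The two symbols freed here otherwise compete with vector components and with infinite series.\<close>

no_notation fps_nth (infixl \<open>$\<close> 75)

no_syntax
  "_Sum_any" :: "pttrn \<Rightarrow> 'a \<Rightarrow> 'a::comm_monoid_add"  (\<open>(\<open>indent=2 notation=\<open>binder \<Sum>\<close>\<close>\<Sum>_. _)\<close> [0, 10] 10)

section \<open>Theta inversion from binomial sums over roots of unity\<close>

lemma sum_int_symmetric:
  fixes f :: "int \<Rightarrow> 'a::comm_semiring_1"
  assumes "\<And>l. f (- l) = f l"
  shows "(\<Sum>l=-int M..int M. f l) = f 0 + 2 * (\<Sum>l=1..M. f (int l))"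
proof (induction M)
  case (Suc M)
  have "{-int (Suc M)..int (Suc M)} = insert (int (Suc M)) (insert (- int (Suc M)) {-int M..int M})"
    by auto
  then have "(\<Sum>l=-int (Suc M)..int (Suc M). f l)
     = f (int (Suc M)) + (f (- int (Suc M)) + (\<Sum>l=-int M..int M. f l))"
    by simp
  then show ?case using Suc assms[of "int (Suc M)"] by (simp add: algebra_simps mult_2)
qed simp

lemma sum_roots_of_unity_symmetric:
  fixes k :: int and M :: nat
  defines "m \<equiv> 2 * M + 1"
  shows "(\<Sum>l=-int M..int M. cis (2 * pi * of_int l * of_int k / real m)) =
    (if int m dvd k then of_nat m else 0)"
proof -
  define z where "z = cis (2 * pi * of_int k / real m)"
  have zn: "z \<noteq> 0" by (simp add: z_def)
  have zl: "cis (2 * pi * of_int l * of_int k / real m) = z powi l" for l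
    unfolding z_def cis_power_int by (simp add: algebra_simps)
  have "(\<Sum>l=-int M..int M. z powi l) = (\<Sum>i<m. z powi (int i - int M))"
    by (rule sum.reindex_bij_witness[of _ "\<lambda>i. int i - int M" "\<lambda>l. nat (l + int M)"])
       (auto simp: m_def)
  also have "\<dots> = z powi (- int M) * (\<Sum>i<m. z ^ i)"
    unfolding sum_distrib_left
    by (rule sum.cong) (auto simp: zn power_int_diff power_int_minus field_simps)
  finally have eq: "(\<Sum>l=-int M..int M. z powi l) = z powi (- int M) * (\<Sum>i<m. z ^ i)" .
  have zm: "z ^ m = 1"
  proof -
    have "z ^ m = cis (2 * pi * of_int k)"
      unfolding z_def Complex.DeMoivre by (simp add: m_def)
    also have "\<dots> = 1" by (simp add: cis_multiple_2pi)
    finally show ?thesis .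
  qed
  have iff: "z = 1 \<longleftrightarrow> int m dvd k"
  proof
    assume "z = 1"
    then obtain n :: int where "2 * pi * of_int k / real m = of_int n * (2 * pi)"
      unfolding z_def cis_conv_exp using exp_eq_1 by (auto simp: mult_ac)
    then have "2 * pi * real_of_int k = 2 * pi * of_int (n * int m)"
      by (simp add: m_def field_simps)
    then have "real_of_int k = of_int (n * int m)" by simp
    then have "k = n * int m" by linarith
    then show "int m dvd k" by simp
  next
    assume "int m dvd k"
    then obtain n where "k = int m * n" by blast
    then have "2 * pi * of_int k / real m = 2 * pi * of_int n"
      by (simp add: m_def field_simps)
    then show "z = 1" by (simp add: z_def cis_multiple_2pi)
  qed
  show ?thesis
  proof (cases "z = 1")
    case True
    have "(\<Sum>l=-int M..int M. z powi l) = of_nat m" by (simp add: True m_def)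
    moreover have "int m dvd k" using iff True by blast
    ultimately show ?thesis by (simp only: zl if_True)
  next
    case False
    then have "(\<Sum>i<m. z ^ i) = 0" using zm by (simp add: sum_gp_strict)
    then show ?thesis using iff False eq by (simp add: zl)
  qed
qed

text \<open>The binomial coefficient at distance \<open>k\<close> from the centre, relative to the central one; for \<open>k\<close> of the
  order of \<open>sqrt N\<close> this is close to the Gaussian \<open>exp (- k^2 / N)\<close>.\<close>

definition rel_binomial :: "nat \<Rightarrow> nat \<Rightarrow> real" where
  "rel_binomial N k = real ((2*N) choose (N + k)) / real ((2*N) choose N)"

text \<open>Polya's finite form of theta inversion. Expand \<open>(2 cos y)^(2N) = (exp (\<i> y) + exp (- \<i> y))^(2N)\<close>
  at \<open>y = \<pi> l / m\<close> and sum over \<open>l\<close> modulo \<open>m\<close>: only those binomial coefficients survive whose distance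
  from the centre is a multiple of \<open>m\<close>. With \<open>N\<close> of the order of \<open>m^2\<close>, both sides tend to theta series.\<close>

lemma polya_identity:
  fixes M N :: nat
  defines "m \<equiv> 2 * M + 1"
  shows "1 + 2 * (\<Sum>l=1..M. cos (pi * real l / real m) ^ (2*N)) =
    real m * real ((2*N) choose N) / 4 ^ N * (1 + 2 * (\<Sum>i=1..N. rel_binomial N (i * m)))"
proof -
  have m0: "m > 0" by (simp add: m_def)
  define c where "c = (\<lambda>l::int. complex_of_real (cos (pi * of_int l / real m) ^ (2*N)))"
  have pw: "4 ^ N * c l = (\<Sum>j\<le>2*N. of_nat ((2*N) choose j) * cis (2 * pi * of_int l * of_int (int j - int N) / real m))" for l
  proof -
    define x where "x = pi * of_int l / real m"
    have "2 * complex_of_real (cos x) = cis x + cis (- x)"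
      by (simp add: complex_eq_iff)
    moreover have "4 ^ N * c l = (2 * complex_of_real (cos x)) ^ (2*N)"
      by (simp add: c_def x_def power_mult_distrib power_mult)
    ultimately have "4 ^ N * c l = (cis x + cis (- x)) ^ (2*N)" by simp
    also have "\<dots> = (\<Sum>j\<le>2*N. of_nat ((2*N) choose j) * cis x ^ j * cis (- x) ^ (2*N - j))"
      by (rule binomial_ring)
    also have "\<dots> = (\<Sum>j\<le>2*N. of_nat ((2*N) choose j) * cis (2 * pi * of_int l * of_int (int j - int N) / real m))"
    proof (rule sum.cong, goal_cases)
      case (2 j)
      have "cis x ^ j * cis (- x) ^ (2*N - j) = cis (real j * x + real (2*N - j) * (-x))"
        by (simp only: Complex.DeMoivre cis_mult)
      also have "real j * x + real (2*N - j) * (-x) = 2 * x * (real j - real N)"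
        using 2 by (simp add: of_nat_diff algebra_simps)
      also have "\<dots> = 2 * pi * of_int l * of_int (int j - int N) / real m"
        by (simp add: x_def)
      finally show ?case by (simp add: mult.assoc)
    qed simp
    finally show ?thesis .
  qed
  have "4 ^ N * (\<Sum>l=-int M..int M. c l) =
      (\<Sum>l=-int M..int M. \<Sum>j\<le>2*N. of_nat ((2*N) choose j) * cis (2 * pi * of_int l * of_int (int j - int N) / real m))"
    by (simp only: sum_distrib_left pw)
  also have "\<dots> = (\<Sum>j\<le>2*N. of_nat ((2*N) choose j) * (\<Sum>l=-int M..int M. cis (2 * pi * of_int l * of_int (int j - int N) / real m)))"
    by (subst sum.swap) (simp only: sum_distrib_left)
  also have "\<dots> = (\<Sum>j\<le>2*N. of_nat ((2*N) choose j) * (if int m dvd int j - int N then of_nat m else 0))"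
    using sum_roots_of_unity_symmetric[where M = M] by (simp only: m_def)
  also have "\<dots> = (\<Sum>k=-int N..int N. of_nat ((2*N) choose (N + nat \<bar>k\<bar>)) * (if int m dvd k then of_nat m else 0))"
  proof (rule sum.reindex_bij_witness[of _ "\<lambda>k. nat (int N + k)" "\<lambda>j. int j - int N"], goal_cases)
    case (5 j)
    have "(2*N) choose (N + nat \<bar>int j - int N\<bar>) = (2*N) choose j"
    proof (cases "j \<le> N")
      case True
      then have "N + nat \<bar>int j - int N\<bar> = 2 * N - j" by auto
      then show ?thesis using 5 binomial_symmetric[of j "2*N"] by (simp only: atMost_iff)
    next
      case False
      then have "N + nat \<bar>int j - int N\<bar> = j" by auto
      then show ?thesis by (simp only:)
    qed
    then show ?case by simp
  qed auto
  also have "\<dots> = of_nat ((2*N) choose N) * of_nat m +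
      2 * (\<Sum>k=1..N. of_nat ((2*N) choose (N + k)) * (if int m dvd int k then of_nat m else 0))"
    by (subst sum_int_symmetric) simp_all
  also have "(\<Sum>k=1..N. of_nat ((2*N) choose (N + k)) * (if int m dvd int k then of_nat m else 0)) =
     (\<Sum>i=1..N. of_nat ((2*N) choose (N + i * m)) * (of_nat m :: complex))"
  \<comment> \<open>Indices that are no multiple of \<open>m\<close> are sent to \<open>N + 1\<close>, where the right-hand side is zero.\<close>
  proof (rule sum.reindex_bij_witness_not_neutral[of "{k\<in>{1..N}. \<not> m dvd k}" "{i\<in>{1..N}. i * m > N}"
      _ "\<lambda>i. i * m" "\<lambda>k. if m dvd k then k div m else N + 1"], goal_cases)
    case (3 k)
    then show ?case by auto
  next
    case (4 k)
    then have "m dvd k" "k > 0" "k \<le> N" by auto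
    then obtain i where k: "k = m * i" by blast
    then have "i > 0" "i \<le> N" "k div m = i"
      using m0 \<open>k > 0\<close> \<open>k \<le> N\<close> by (auto intro: order.trans[of i "m * i"])
    then show ?case using k \<open>k \<le> N\<close> by (auto simp: mult.commute)
  next
    case (5 i)
    then show ?case using m0 by simp
  next
    case (6 i)
    then show ?case using m0 by auto
  next
    case (7 k)
    then show ?case by (simp add: int_dvd_int_iff)
  next
    case (8 i)
    then have "(2*N) choose (N + i * m) = 0" by (intro binomial_eq_0) auto
    then show ?case by simp
  next
    case (9 k)
    show ?case
    proof (cases "m dvd k")
      case True
      then show ?thesis by (simp add: int_dvd_int_iff)
    next
      case False
      have "N < (N + 1) * m" using m0 by (cases m) auto
      then have "(2*N) choose (N + (N + 1) * m) = 0" by (intro binomial_eq_0) linarith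
      then show ?thesis using False by (simp only: if_False int_dvd_int_iff) simp
    qed
  qed simp_all
  finally have main: "4 ^ N * (\<Sum>l=-int M..int M. c l) = of_nat ((2*N) choose N) * of_nat m +
      2 * (\<Sum>i=1..N. of_nat ((2*N) choose (N + i * m)) * of_nat m)" .
  have "(\<Sum>l=-int M..int M. c l) = c 0 + 2 * (\<Sum>l=1..M. c (int l))"
    by (rule sum_int_symmetric) (simp add: c_def)
  also have "\<dots> = of_real (1 + 2 * (\<Sum>l=1..M. cos (pi * real l / real m) ^ (2*N)))"
    by (simp add: c_def)
  finally have cs: "(\<Sum>l=-int M..int M. c l) = of_real (1 + 2 * (\<Sum>l=1..M. cos (pi * real l / real m) ^ (2*N)))" .
  have "complex_of_real (4 ^ N * (1 + 2 * (\<Sum>l=1..M. cos (pi * real l / real m) ^ (2*N)))) =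
      of_real (real ((2*N) choose N) * real m + 2 * (\<Sum>i=1..N. real ((2*N) choose (N + i * m)) * real m))"
    using main unfolding cs by simp
  then have "4 ^ N * (1 + 2 * (\<Sum>l=1..M. cos (pi * real l / real m) ^ (2*N))) =
      real ((2*N) choose N) * real m + 2 * (\<Sum>i=1..N. real ((2*N) choose (N + i * m)) * real m)"
    by (simp only: of_real_eq_iff)
  also have "\<dots> = real m * real ((2*N) choose N) * (1 + 2 * (\<Sum>i=1..N. rel_binomial N (i * m)))"
  proof -
    have "(\<Sum>i=1..N. real ((2*N) choose (N + i * m)) * real m) =
       real m * real ((2*N) choose N) * (\<Sum>i=1..N. rel_binomial N (i * m))"
      unfolding sum_distrib_left
      by (rule sum.cong) (auto simp: rel_binomial_def)
    then show ?thesis by (simp only:) (simp add: algebra_simps)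
  qed
  finally show ?thesis by (simp add: field_simps)
qed

lemma rel_binomial_Suc:
  "real (N + k + 1) * rel_binomial N (Suc k) = (real N - real k) * rel_binomial N k"
proof (cases "k \<le> N")
  case True
  have "(N + k + 1) * ((2*N) choose (N + k + 1)) = (N - k) * ((2*N) choose (N + k))"
    using binomial_absorb_comp[of "2*N" "N+k"] binomial_absorption[of "N+k" "2*N"] True
    by (simp add: mult_2)
  then have "real ((N + k + 1) * ((2*N) choose (N + k + 1))) = real ((N - k) * ((2*N) choose (N + k)))"
    by simp
  then have "real (N + k + 1) * real ((2*N) choose (N + k + 1)) = (real N - real k) * real ((2*N) choose (N + k))"
    using True by (simp only: of_nat_mult of_nat_diff)
  then show ?thesis
    by (simp add: rel_binomial_def divide_simps)
qed (auto simp: rel_binomial_def binomial_eq_0)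

lemma rel_binomial_0 [simp]: "rel_binomial N 0 = 1"
  by (simp add: rel_binomial_def)

lemma rel_binomial_nonneg: "rel_binomial N k \<ge> 0"
  by (simp add: rel_binomial_def)

lemma rel_binomial_eq_0: "k > N \<Longrightarrow> rel_binomial N k = 0"
  by (simp add: rel_binomial_def)

text \<open>The quotient of consecutive terms is \<open>1 - (2 k + 1) / (N + k + 1)\<close>, and \<open>1 - y \<le> exp (- y)\<close>. The bound
  \<open>K\<close> is kept apart from \<open>k\<close> because two choices are of use: \<open>K = k\<close> gives the limit, \<open>K = N\<close> a uniform
  majorant.\<close>

lemma rel_binomial_le:
  assumes "k \<le> K" "K \<le> N" "N > 0"
  shows "rel_binomial N k \<le> exp (- (real k)\<^sup>2 / (real N + real K))"
  using assms(1)
proof (induction k)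
  case (Suc k)
  have "rel_binomial N (Suc k) = (real N - real k) / (real N + real k + 1) * rel_binomial N k"
    using rel_binomial_Suc[of N k] by (simp add: field_simps)
  also have "(real N - real k) / (real N + real k + 1) = 1 + (- (2 * real k + 1) / (real N + real k + 1))"
    by (simp add: field_simps)
  also have "\<dots> \<le> 1 + (- (2 * real k + 1) / (real N + real K))"
  proof -
    have "(2 * real k + 1) / (real N + real K) \<le> (2 * real k + 1) / (real N + real k + 1)"
      using Suc.prems assms by (intro divide_left_mono mult_pos_pos) auto
    then show ?thesis by (metis add_left_mono neg_le_iff_le minus_divide_left)
  qed
  also have "\<dots> \<le> exp (- (2 * real k + 1) / (real N + real K))"
    by (rule exp_ge_add_one_self)
  also have "exp (- (2 * real k + 1) / (real N + real K)) * rel_binomial N k \<le>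
     exp (- (2 * real k + 1) / (real N + real K)) * exp (- (real k)\<^sup>2 / (real N + real K))"
    using Suc by (intro mult_left_mono) auto
  also have "\<dots> = exp (- (real (Suc k))\<^sup>2 / (real N + real K))"
    unfolding exp_add[symmetric]
    by (rule arg_cong[of _ _ exp]) (simp add: power2_eq_square add_divide_distrib[symmetric] algebra_simps diff_divide_distrib[symmetric])
  finally show ?case using rel_binomial_nonneg[of N k] by (simp add: mult_right_mono)
qed simp

text \<open>Same estimate for the reciprocal quotients.\<close>

lemma rel_binomial_ge:
  assumes "k \<le> K" "K \<le> N"
  shows "rel_binomial N k \<ge> exp (- (real k)\<^sup>2 / (real N + 1 - real K))"
  using assms(1)
proof (induction k)
  case (Suc k)
  define a where "a = (2 * real k + 1) / (real N - real k)"
  have kN: "real k < real N" using Suc.prems assms by simp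
  have "rel_binomial N (Suc k) = (real N - real k) / (real N + real k + 1) * rel_binomial N k"
    using rel_binomial_Suc[of N k] by (simp add: field_simps)
  also have "(real N - real k) / (real N + real k + 1) = inverse (1 + a)"
    using kN by (simp add: field_simps a_def)
  finally have eq: "rel_binomial N (Suc k) = inverse (1 + a) * rel_binomial N k" .
  have a0: "a \<ge> 0" using kN by (simp add: a_def)
  have "1 + a \<le> exp a" by (rule exp_ge_add_one_self)
  also have "a \<le> (2 * real k + 1) / (real N + 1 - real K)"
    unfolding a_def using Suc.prems assms kN by (intro divide_left_mono mult_pos_pos) auto
  finally have "1 + a \<le> exp ((2 * real k + 1) / (real N + 1 - real K))" by simp
  then have ge: "inverse (1 + a) \<ge> exp (- ((2 * real k + 1) / (real N + 1 - real K)))"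
    unfolding exp_minus using a0 by (intro le_imp_inverse_le) auto
  have "exp (- (real (Suc k))\<^sup>2 / (real N + 1 - real K)) =
     exp (- ((2 * real k + 1) / (real N + 1 - real K))) * exp (- (real k)\<^sup>2 / (real N + 1 - real K))"
    unfolding exp_add[symmetric]
    by (rule arg_cong[of _ _ exp]) (simp add: power2_eq_square add_divide_distrib[symmetric] algebra_simps diff_divide_distrib[symmetric])
  also have "\<dots> \<le> inverse (1 + a) * rel_binomial N k"
    using Suc ge a0 by (intro mult_mono) auto
  finally show ?case using eq by simp
qed simp

text \<open>The square of the central term is, up to the factor \<open>2 N + 1\<close>, a partial product of Wallis's product.\<close>

lemma central_binomial_limit:
  "(\<lambda>N. real N * (real ((2*N) choose N) / 4 ^ N)\<^sup>2) \<longlonglongrightarrow> 1 / pi"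
proof -
  define c where "c = (\<lambda>N. real ((2*N) choose N) / 4 ^ N)"
  have eq: "(c N)\<^sup>2 * (2 * real N + 1) = inverse (\<Prod>k=1..N. (4*real k^2) / (4*real k^2 - 1))" for N
  proof (induction N)
    case (Suc N)
    have "Suc N * ((2 * Suc N) choose Suc N) = 2 * (2 * N + 1) * ((2*N) choose N)"
    proof -
      have "Suc N * ((2 * Suc N) choose Suc N) = (2 * Suc N) * ((2 * N + 1) choose N)"
        using Suc_times_binomial[of N "2*N+1"] by simp
      also have "Suc N * ((2 * N + 1) choose N) = (2 * N + 1) * ((2 * N) choose N)"
        using binomial_absorb_comp[of "2*N+1" N] by simp
      then have "(2 * Suc N) * ((2 * N + 1) choose N) = 2 * (2 * N + 1) * ((2*N) choose N)" by simp
      finally show ?thesis .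
    qed
    then have "real (Suc N * ((2 * Suc N) choose Suc N)) = real (2 * (2 * N + 1) * ((2*N) choose N))"
      by presburger
    then have "(real N + 1) * real ((2 * Suc N) choose Suc N) = 2 * (2 * real N + 1) * real ((2*N) choose N)"
      by (simp only: of_nat_mult of_nat_add) (simp add: algebra_simps)
    then have r: "c (Suc N) = c N * ((2 * real N + 1) / (2 * real N + 2))"
      by (simp add: c_def divide_simps) (simp add: algebra_simps)
    have "(c (Suc N))\<^sup>2 * (2 * real (Suc N) + 1) =
       ((c N)\<^sup>2 * (2 * real N + 1)) * ((2 * real N + 1) * (2 * real N + 3) / (2 * real N + 2)\<^sup>2)"
      by (simp add: r power2_eq_square algebra_simps)
    also have "(2 * real N + 1) * (2 * real N + 3) / (2 * real N + 2)\<^sup>2 = inverse ((4*real (Suc N)^2) / (4*real (Suc N)^2 - 1))"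
      by (simp add: power2_eq_square algebra_simps)
    also have "((c N)\<^sup>2 * (2 * real N + 1)) * \<dots> = inverse (\<Prod>k=1..Suc N. (4*real k^2) / (4*real k^2 - 1))"
    proof -
      have "(\<Prod>k=1..Suc N. (4*real k^2) / (4*real k^2 - 1)) =
        (\<Prod>k=1..N. (4*real k^2) / (4*real k^2 - 1)) * ((4*real (Suc N)^2) / (4*real (Suc N)^2 - 1))"
        by simp
      then show ?thesis by (simp only: Suc.IH inverse_mult_distrib)
    qed
    finally show ?case .
  qed (simp add: c_def)
  have "(\<lambda>N. (c N)\<^sup>2 * (2 * real N + 1)) \<longlonglongrightarrow> inverse (pi / 2)"
    unfolding eq by (intro tendsto_inverse wallis) auto
  moreover have "(\<lambda>N. real N / (2 * real N + 1)) \<longlonglongrightarrow> 1 / 2" by real_asymp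
  ultimately have "(\<lambda>N. (c N)\<^sup>2 * (2 * real N + 1) * (real N / (2 * real N + 1))) \<longlonglongrightarrow> inverse (pi / 2) * (1/2)"
    by (rule tendsto_mult)
  moreover have eq2: "(c N)\<^sup>2 * (2 * real N + 1) * (real N / (2 * real N + 1)) = real N * (c N)\<^sup>2" for N
  proof -
    have "2 * real N + 1 \<noteq> 0" by linarith
    then show ?thesis by simp
  qed
  ultimately have "(\<lambda>N. real N * (c N)\<^sup>2) \<longlonglongrightarrow> inverse (pi / 2) * (1/2)" by (simp only: eq2)
  then show ?thesis by (simp add: c_def)
qed

text \<open>The special case of Tannery's theorem that passes to the limit on both sides of Polya's identity.\<close>

lemma tannery_sequence:
  fixes a :: "nat \<Rightarrow> nat \<Rightarrow> real"
  assumes "\<And>k. (\<lambda>n. a k n) \<longlonglongrightarrow> b k"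
    and "eventually (\<lambda>n. \<forall>k. \<bar>a k n\<bar> \<le> h k) sequentially" and "summable h"
  shows "summable b" "(\<lambda>n. \<Sum>k. a k n) \<longlonglongrightarrow> (\<Sum>k. b k)"
proof -
  have "eventually (\<lambda>(k,n). norm (a k n) \<le> h k) (at_top \<times>\<^sub>F sequentially)"
    unfolding eventually_prod_filter
    using assms(2) by (intro exI[of _ "\<lambda>_. True"] exI[of _ "\<lambda>n. \<forall>k. \<bar>a k n\<bar> \<le> h k"]) auto
  from tannerys_theorem[OF assms(1) this assms(3)]
  show "summable b" "(\<lambda>n. \<Sum>k. a k n) \<longlonglongrightarrow> (\<Sum>k. b k)"
    by (auto intro: summable_norm_cancel)
qed

lemma summable_gaussian_tail:
  assumes "c > 0"
  shows "summable (\<lambda>k. exp (- (c * (real (Suc k))\<^sup>2)))"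
proof (rule summable_comparison_test)
  show "summable (\<lambda>k. exp (- c) ^ k)" using assms by (intro summable_geometric) auto
  have "real k \<le> (real (Suc k))\<^sup>2" for k by (simp add: power2_eq_square algebra_simps)
  then have "exp (- (c * (real (Suc k))\<^sup>2)) \<le> exp (- c) ^ k" for k
    using assms by (simp add: exp_of_nat_mult[symmetric] mult.commute mult_left_mono)
  then show "\<exists>N. \<forall>n\<ge>N. norm (exp (- (c * (real (Suc n))\<^sup>2))) \<le> exp (- c) ^ n" by auto
qed

text \<open>Since \<open>cos y = 1 - 2 sin^2 (y / 2)\<close>, it suffices that \<open>sin (y / 2) \<ge> y / \<pi>\<close>, which holds because the
  slope of the sine stays above \<open>2 / \<pi>\<close> up to \<open>\<pi> / 4\<close>.\<close>

lemma cos_le_exp_quadratic: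
  assumes "0 \<le> x" "x \<le> pi / 2"
  shows "cos x \<le> exp (- (2 / pi\<^sup>2) * x\<^sup>2)"
proof -
  have "x / pi \<le> sin (x / 2)"
  proof (cases "x = 0")
    case False
    have "\<exists>z>0. z < x / 2 \<and> sin (x / 2) - sin 0 = (x / 2 - 0) * cos z"
      using assms False by (intro MVT2) (auto intro!: derivative_eq_intros)
    then obtain z where z: "0 < z" "z < x / 2" "sin (x / 2) = x / 2 * cos z" by auto
    have "2 \<le> sqrt 2 * pi / 2 * 1"
    proof -
      have "sqrt 2 * pi \<ge> 4 / 3 * 3"
        using pi_gt3 by (intro mult_mono real_le_rsqrt) (auto simp: power2_eq_square)
      then show ?thesis by simp
    qed
    then have "2 / pi \<le> cos (pi / 4)" by (simp add: cos_45 field_simps)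
    also have "\<dots> \<le> cos z" using z assms by (intro cos_monotone_0_pi_le) auto
    finally have "x / 2 * (2 / pi) \<le> x / 2 * cos z" using assms by (intro mult_left_mono) auto
    moreover have "x / 2 * (2 / pi) = x / pi" by simp
    ultimately show ?thesis by (simp only: z(3))
  qed simp
  then have "(x / pi)\<^sup>2 \<le> (sin (x / 2))\<^sup>2"
    using assms by (intro power_mono) auto
  then have "cos x \<le> 1 + (- (2 / pi\<^sup>2) * x\<^sup>2)"
    using cos_double_sin[of "x/2"] by (simp add: power_divide)
  also have "\<dots> \<le> exp (- (2 / pi\<^sup>2) * x\<^sup>2)" by (rule exp_ge_add_one_self)
  finally show ?thesis .
qed

text \<open>Each term tends to a Gaussian because \<open>ln (cos y)\<close> behaves like \<open>- y^2 / 2\<close>; the quadratic bound on the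
  cosine dominates the terms uniformly.\<close>

lemma polya_cos_side:
  fixes s :: real and N :: "nat \<Rightarrow> nat"
  assumes s: "s > 0" and N: "(\<lambda>M. real (N M) / (real (2 * M + 1))\<^sup>2) \<longlonglongrightarrow> s"
  shows "(\<lambda>M. \<Sum>l=1..M. cos (pi * real l / real (2 * M + 1)) ^ (2 * N M)) \<longlonglongrightarrow>
     (\<Sum>k. exp (- (pi\<^sup>2 * s * (real (Suc k))\<^sup>2)))"
proof -
  define a where "a = (\<lambda>k M. if k < M then cos (pi * real (Suc k) / real (2 * M + 1)) ^ (2 * N M) else 0)"
  have sum_a: "(\<Sum>k. a k M) = (\<Sum>l=1..M. cos (pi * real l / real (2 * M + 1)) ^ (2 * N M))" for M
  proof -
    have "(\<Sum>k. a k M) = (\<Sum>k<M. a k M)"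
      by (rule suminf_finite) (auto simp: a_def)
    also have "\<dots> = (\<Sum>k<M. cos (pi * real (Suc k) / real (2 * M + 1)) ^ (2 * N M))"
      by (simp add: a_def)
    also have "\<dots> = (\<Sum>l=1..M. cos (pi * real l / real (2 * M + 1)) ^ (2 * N M))"
      by (rule sum.reindex_bij_witness[of _ "\<lambda>l. l - 1" Suc]) auto
    finally show ?thesis .
  qed
  have "(\<lambda>M. a k M) \<longlonglongrightarrow> exp (- (pi\<^sup>2 * s * (real (Suc k))\<^sup>2))" for k
  proof -
    define u where "u = real (Suc k)"
    have "(\<lambda>M. (real (2 * M + 1))\<^sup>2 * ln (cos (pi * u / real (2 * M + 1)))) \<longlonglongrightarrow> - (pi * (pi * (u * u)) / 2)"
      by real_asymp
    then have "(\<lambda>M. (real (2 * M + 1))\<^sup>2 * ln (cos (pi * u / real (2 * M + 1)))) \<longlonglongrightarrow> - (pi\<^sup>2 * u\<^sup>2 / 2)"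
      by (simp only: power2_eq_square mult.assoc mult.left_commute)
    from tendsto_mult[OF N this]
    have "(\<lambda>M. exp (2 * (real (N M) / (real (2 * M + 1))\<^sup>2 * ((real (2 * M + 1))\<^sup>2 * ln (cos (pi * u / real (2 * M + 1)))))))
       \<longlonglongrightarrow> exp (2 * (s * - (pi\<^sup>2 * u\<^sup>2 / 2)))"
      by (intro tendsto_exp tendsto_mult_left)
    then have lim: "(\<lambda>M. exp (2 * (real (N M) / (real (2 * M + 1))\<^sup>2 * ((real (2 * M + 1))\<^sup>2 * ln (cos (pi * u / real (2 * M + 1)))))))
       \<longlonglongrightarrow> exp (- (pi\<^sup>2 * s * u\<^sup>2))"
      by (simp add: mult_ac)
    have "eventually (\<lambda>M. exp (2 * (real (N M) / (real (2 * M + 1))\<^sup>2 * ((real (2 * M + 1))\<^sup>2 * ln (cos (pi * u / real (2 * M + 1)))))) = a k M) sequentially"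
      using eventually_gt_at_top[of k]
    proof eventually_elim
      case (elim M)
      have "2 * u < real (2 * M + 1)" using elim by (simp add: u_def)
      then have "pi * u / real (2 * M + 1) < pi / 2"
        using mult_strict_left_mono[of "2 * u" "real (2 * M + 1)" pi] by (simp add: field_simps)
      moreover have "pi * u / real (2 * M + 1) \<ge> 0" by (simp add: u_def)
      ultimately have "cos (pi * u / real (2 * M + 1)) > 0"
        by (intro cos_gt_zero_pi) (auto intro: less_le_trans[of _ 0])
      then have "cos (pi * u / real (2 * M + 1)) ^ (2 * N M) = exp (real (2 * N M) * ln (cos (pi * u / real (2 * M + 1))))"
        by (simp only: exp_of_nat_mult exp_ln)
      moreover have "real (2 * M + 1) \<noteq> 0" by linarith
      ultimately show ?case using elim by (simp only: a_def u_def if_True) (simp add: mult_ac)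
    qed
    from Lim_transform_eventually[OF lim this] show ?thesis by (simp add: u_def)
  qed
  moreover have "eventually (\<lambda>M. \<forall>k. \<bar>a k M\<bar> \<le> exp (- (2 * s * (real (Suc k))\<^sup>2))) sequentially"
  proof -
    have "eventually (\<lambda>M. real (N M) / (real (2 * M + 1))\<^sup>2 > s / 2) sequentially"
      using order_tendstoD(1)[OF N, of "s/2"] s by simp
    then show ?thesis
    proof eventually_elim
      case (elim M)
      show ?case
      proof (intro allI)
        fix k
        show "\<bar>a k M\<bar> \<le> exp (- (2 * s * (real (Suc k))\<^sup>2))"
        proof (cases "k < M")
          case True
          define x where "x = pi * real (Suc k) / real (2 * M + 1)"
          have "2 * real (Suc k) \<le> real (2 * M + 1)" using True by simp
          then have x: "0 \<le> x" "x \<le> pi / 2"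
            using mult_left_mono[of "2 * real (Suc k)" "real (2 * M + 1)" pi]
            by (simp_all add: x_def field_simps)
          have "cos x ^ (2 * N M) \<le> exp (- (2 / pi\<^sup>2) * x\<^sup>2) ^ (2 * N M)"
            using x by (intro power_mono cos_le_exp_quadratic cos_ge_zero) auto
          also have "\<dots> = exp (- (4 * (real (N M) / (real (2 * M + 1))\<^sup>2) * (real (Suc k))\<^sup>2))"
            unfolding exp_of_nat_mult[symmetric] x_def
            by (rule arg_cong[of _ _ exp]) (simp add: power_mult_distrib power_divide del: of_nat_Suc)
          also have "\<dots> \<le> exp (- (2 * s * (real (Suc k))\<^sup>2))"
          proof -
            have "2 * s \<le> 4 * (real (N M) / (real (2 * M + 1))\<^sup>2)" using elim by linarith
            then have "2 * s * (real (Suc k))\<^sup>2 \<le> 4 * (real (N M) / (real (2 * M + 1))\<^sup>2) * (real (Suc k))\<^sup>2"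
              by (rule mult_right_mono) simp
            then show ?thesis by (simp only: exp_le_cancel_iff neg_le_iff_le)
          qed
          finally have "cos x ^ (2 * N M) \<le> exp (- (2 * s * (real (Suc k))\<^sup>2))" .
          then show ?thesis using True by (simp add: a_def x_def)
        qed (simp add: a_def)
      qed
    qed
  qed
  ultimately have "(\<lambda>M. \<Sum>k. a k M) \<longlonglongrightarrow> (\<Sum>k. exp (- (pi\<^sup>2 * s * (real (Suc k))\<^sup>2)))"
    using summable_gaussian_tail[of "2 * s"] s by (intro tannery_sequence(2)) auto
  then show ?thesis by (simp only: sum_a)
qed

text \<open>Each term is squeezed between two exponentials with the same limit; relative binomial coefficients
  are dominated by a Gaussian of half the rate.\<close>

lemma polya_binomial_side:
  fixes s :: real and N :: "nat \<Rightarrow> nat"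
  assumes s: "s > 0" and N: "(\<lambda>M. real (N M) / (real (2 * M + 1))\<^sup>2) \<longlonglongrightarrow> s"
  shows "(\<lambda>M. \<Sum>i=1..N M. rel_binomial (N M) (i * (2 * M + 1))) \<longlonglongrightarrow>
     (\<Sum>k. exp (- ((real (Suc k))\<^sup>2 / s)))"
proof -
  define m where "m = (\<lambda>M::nat. 2 * M + 1)"
  define a where "a = (\<lambda>k M. rel_binomial (N M) (Suc k * m M))"
  have m0: "m M > 0" for M by (simp add: m_def)
  have Nm: "(\<lambda>M. real (N M) / (real (m M))\<^sup>2) \<longlonglongrightarrow> s" using N by (simp add: m_def)
  have sum_a: "(\<Sum>k. a k M) = (\<Sum>i=1..N M. rel_binomial (N M) (i * (2 * M + 1)))" for M
  proof -
    have "(\<Sum>k. a k M) = (\<Sum>k<N M. a k M)"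
    proof (rule suminf_finite)
      fix k assume "k \<notin> {..<N M}"
      then have "N M < Suc k" by simp
      also have "Suc k \<le> Suc k * m M" using mult_le_mono2[of 1 "m M" "Suc k"] m0[of M] by simp
      finally show "a k M = 0" by (simp only: a_def rel_binomial_eq_0)
    qed simp
    also have "\<dots> = (\<Sum>i=1..N M. rel_binomial (N M) (i * (2 * M + 1)))"
      by (rule sum.reindex_bij_witness[of _ "\<lambda>l. l - 1" Suc]) (auto simp: a_def m_def)
    finally show ?thesis .
  qed
  have "(\<lambda>M. a k M) \<longlonglongrightarrow> exp (- ((real (Suc k))\<^sup>2 / s))" for k
  proof -
    define K where "K = (\<lambda>M. real (Suc k * m M))"
    have minv: "(\<lambda>M. 1 / real (m M)) \<longlonglongrightarrow> 0" unfolding m_def by real_asymp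
    have K0: "K M > 0" for M using m0[of M] unfolding K_def of_nat_0_less_iff by simp
    have lim: "(\<lambda>M. exp (- (real (Suc k))\<^sup>2 / (real (N M) / (real (m M))\<^sup>2 + real (Suc k) * (1 / real (m M)))))
       \<longlonglongrightarrow> exp (- (real (Suc k))\<^sup>2 / (s + real (Suc k) * 0))"
      using s by (intro tendsto_exp tendsto_divide tendsto_add Nm tendsto_mult tendsto_const minv) auto
    have lim': "(\<lambda>M. exp (- (real (Suc k))\<^sup>2 / (real (N M) / (real (m M))\<^sup>2 + (1 / real (m M)) * (1 / real (m M)) - real (Suc k) * (1 / real (m M)))))
       \<longlonglongrightarrow> exp (- (real (Suc k))\<^sup>2 / (s + 0 * 0 - real (Suc k) * 0))"
      using s by (intro tendsto_exp tendsto_divide tendsto_add tendsto_diff Nm tendsto_mult tendsto_const minv) auto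
    have ev: "eventually (\<lambda>M. Suc k * m M \<le> N M \<and> N M > 0) sequentially"
    proof -
      have "(\<lambda>M. real (N M) / (real (m M))\<^sup>2 - real (Suc k) * (1 / real (m M))) \<longlonglongrightarrow> s - real (Suc k) * 0"
        by (intro tendsto_intros Nm minv)
      then have "eventually (\<lambda>M. real (N M) / (real (m M))\<^sup>2 - real (Suc k) * (1 / real (m M)) > 0) sequentially"
        using s by (intro order_tendstoD(1)) auto
      then show ?thesis
      proof eventually_elim
        case (elim M)
        have "real (Suc k) / real (m M) < real (N M) / (real (m M))\<^sup>2" using elim by simp
        then have "real (Suc k) * real (m M) < real (N M)"
          using m0[of M] by (simp add: field_simps power2_eq_square)
        then have "Suc k * m M < N M" unfolding of_nat_mult[symmetric] of_nat_less_iff .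
        then show ?case by linarith
      qed
    qed
    show ?thesis
    proof (rule tendsto_sandwich)
      show "eventually (\<lambda>M. exp (- (real (Suc k))\<^sup>2 / (real (N M) / (real (m M))\<^sup>2 + (1 / real (m M)) * (1 / real (m M)) - real (Suc k) * (1 / real (m M)))) \<le> a k M) sequentially"
        using ev
      proof eventually_elim
        case (elim M)
        have "exp (- (K M)\<^sup>2 / (real (N M) + 1 - K M)) \<le> a k M"
          using rel_binomial_ge[of "Suc k * m M" "Suc k * m M" "N M"] elim by (simp only: a_def K_def order.refl)
        moreover have "- (K M)\<^sup>2 / (real (N M) + 1 - K M) =
           - (real (Suc k))\<^sup>2 / ((real (N M) + 1 - K M) / (real (m M))\<^sup>2)"
          by (simp only: K_def of_nat_mult power_mult_distrib) simp
        moreover have "(real (N M) + 1 - K M) / (real (m M))\<^sup>2 =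
           real (N M) / (real (m M))\<^sup>2 + (1 / real (m M)) * (1 / real (m M)) - real (Suc k) * (1 / real (m M))"
          using m0[of M] by (simp add: K_def field_simps power2_eq_square)
        ultimately show ?case by simp
      qed
      show "eventually (\<lambda>M. a k M \<le> exp (- (real (Suc k))\<^sup>2 / (real (N M) / (real (m M))\<^sup>2 + real (Suc k) * (1 / real (m M))))) sequentially"
        using ev
      proof eventually_elim
        case (elim M)
        have "a k M \<le> exp (- (K M)\<^sup>2 / (real (N M) + K M))"
          using rel_binomial_le[of "Suc k * m M" "Suc k * m M" "N M"] elim by (simp only: a_def K_def order.refl)
        moreover have "- (K M)\<^sup>2 / (real (N M) + K M) =
           - (real (Suc k))\<^sup>2 / ((real (N M) + K M) / (real (m M))\<^sup>2)"
          by (simp only: K_def of_nat_mult power_mult_distrib) simp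
        moreover have "(real (N M) + K M) / (real (m M))\<^sup>2 =
           real (N M) / (real (m M))\<^sup>2 + real (Suc k) * (1 / real (m M))"
          using m0[of M] by (simp add: K_def field_simps power2_eq_square)
        ultimately show ?case by simp
      qed
    qed (use lim lim' in simp_all)
  qed
  moreover have "eventually (\<lambda>M. \<forall>k. \<bar>a k M\<bar> \<le> exp (- (1 / (4 * s) * (real (Suc k))\<^sup>2))) sequentially"
  proof -
    have "eventually (\<lambda>M. real (N M) / (real (m M))\<^sup>2 < 2 * s \<and> real (N M) / (real (m M))\<^sup>2 > 0) sequentially"
      using order_tendstoD(2)[OF Nm, of "2 * s"] order_tendstoD(1)[OF Nm, of 0] s
      by (auto intro: eventually_conj)
    then show ?thesis
    proof eventually_elim
      case (elim M)
      have NM: "N M > 0" using elim by (cases "N M") auto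
      show ?case
      proof (intro allI)
        fix k
        show "\<bar>a k M\<bar> \<le> exp (- (1 / (4 * s) * (real (Suc k))\<^sup>2))"
        proof (cases "Suc k * m M \<le> N M")
          case True
          have "a k M \<le> exp (- (real (Suc k * m M))\<^sup>2 / (real (N M) + real (N M)))"
            unfolding a_def using True NM by (intro rel_binomial_le) auto
          also have "- (real (Suc k * m M))\<^sup>2 / (real (N M) + real (N M)) =
             - ((real (Suc k))\<^sup>2 * (1 / (2 * (real (N M) / (real (m M))\<^sup>2))))"
            by (simp only: of_nat_mult power_mult_distrib) simp
          also have "1 / (2 * (real (N M) / (real (m M))\<^sup>2)) \<ge> 1 / (4 * s)"
            using elim s by (intro divide_left_mono mult_pos_pos) auto
          then have "exp (- ((real (Suc k))\<^sup>2 * (1 / (2 * (real (N M) / (real (m M))\<^sup>2))))) \<le>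
              exp (- (1 / (4 * s) * (real (Suc k))\<^sup>2))"
            by (subst (3) mult.commute) (simp only: exp_le_cancel_iff neg_le_iff_le mult_left_mono zero_le_power2)
          finally show ?thesis using rel_binomial_nonneg by (simp add: a_def)
        qed (simp add: a_def rel_binomial_eq_0 del: mult_Suc)
      qed
    qed
  qed
  ultimately have "(\<lambda>M. \<Sum>k. a k M) \<longlonglongrightarrow> (\<Sum>k. exp (- ((real (Suc k))\<^sup>2 / s)))"
    using summable_gaussian_tail[of "1 / (4 * s)"] s by (intro tannery_sequence(2)) auto
  then show ?thesis by (simp only: sum_a)
qed

text \<open>Polya's identity in the limit \<open>N / m^2 \<rightarrow> t / \<pi>\<close>; Wallis's product supplies the factor \<open>1 / sqrt t\<close>.\<close>

theorem theta_inversion_real: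
  assumes t: "t > 0"
  shows "1 + 2 * (\<Sum>k. exp (- (pi * t * (real (Suc k))\<^sup>2))) =
     1 / sqrt t * (1 + 2 * (\<Sum>k. exp (- (pi / t * (real (Suc k))\<^sup>2))))"
proof -
  \<comment> \<open>The limit of \<open>N / m^2\<close> for which the cosine side becomes \<open>\<Sum> exp (- \<pi> t k^2)\<close>.\<close>
  define s where "s = t / pi"
  have s: "s > 0" using t by (simp add: s_def)
  define N where "N = (\<lambda>M. nat \<lfloor>s * (real (2 * M + 1))\<^sup>2\<rfloor>)"
  have N: "(\<lambda>M. real (N M) / (real (2 * M + 1))\<^sup>2) \<longlonglongrightarrow> s"
    unfolding N_def using s by real_asymp
  have Ninf: "filterlim N at_top sequentially"
    unfolding N_def using s by real_asymp
  define c where "c = (\<lambda>M. real (2 * M + 1) * real ((2 * N M) choose N M) / 4 ^ N M)"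
  have "(\<lambda>M. real (N M) * (real ((2*N M) choose N M) / 4 ^ N M)\<^sup>2) \<longlonglongrightarrow> 1 / pi"
    by (rule filterlim_compose[OF central_binomial_limit Ninf])
  then have "(\<lambda>M. real (N M) * (real ((2*N M) choose N M) / 4 ^ N M)\<^sup>2 / (real (N M) / (real (2 * M + 1))\<^sup>2)) \<longlonglongrightarrow> 1 / pi / s"
    using s by (intro tendsto_divide N) auto
  moreover have "eventually (\<lambda>M. real (N M) * (real ((2*N M) choose N M) / 4 ^ N M)\<^sup>2 / (real (N M) / (real (2 * M + 1))\<^sup>2) = (c M)\<^sup>2) sequentially"
    using eventually_compose_filterlim[OF eventually_gt_at_top[of 0] Ninf]
    by eventually_elim (simp add: c_def power_mult_distrib power_divide)
  ultimately have "(\<lambda>M. (c M)\<^sup>2) \<longlonglongrightarrow> 1 / pi / s"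
    by (rule Lim_transform_eventually)
  then have "(\<lambda>M. sqrt ((c M)\<^sup>2)) \<longlonglongrightarrow> sqrt (1 / pi / s)" by (rule tendsto_real_sqrt)
  then have c: "c \<longlonglongrightarrow> 1 / sqrt t"
    by (simp add: c_def s_def real_sqrt_divide)
  have "(\<lambda>M. c M * (1 + 2 * (\<Sum>i=1..N M. rel_binomial (N M) (i * (2 * M + 1))))) \<longlonglongrightarrow>
     1 / sqrt t * (1 + 2 * (\<Sum>k. exp (- ((real (Suc k))\<^sup>2 / s))))"
    by (intro tendsto_intros c polya_binomial_side s N)
  moreover have "(\<lambda>M. 1 + 2 * (\<Sum>l=1..M. cos (pi * real l / real (2 * M + 1)) ^ (2 * N M))) \<longlonglongrightarrow>
     1 + 2 * (\<Sum>k. exp (- (pi\<^sup>2 * s * (real (Suc k))\<^sup>2)))"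
    by (intro tendsto_intros polya_cos_side s N)
  moreover have "1 + 2 * (\<Sum>l=1..M. cos (pi * real l / real (2 * M + 1)) ^ (2 * N M)) =
     c M * (1 + 2 * (\<Sum>i=1..N M. rel_binomial (N M) (i * (2 * M + 1))))" for M
    unfolding c_def by (rule polya_identity)
  ultimately have "1 + 2 * (\<Sum>k. exp (- (pi\<^sup>2 * s * (real (Suc k))\<^sup>2))) =
     1 / sqrt t * (1 + 2 * (\<Sum>k. exp (- ((real (Suc k))\<^sup>2 / s))))"
    by (simp only:) (rule LIMSEQ_unique)
  then show ?thesis by (simp add: s_def power2_eq_square mult_ac)
qed

section \<open>Theta constants as power series in the nome\<close>

definition nome :: "complex \<Rightarrow> complex" where
  "nome \<tau> = exp (\<i> * pi * \<tau>)"

definition theta00 :: "complex \<Rightarrow> complex" where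
  "theta00 \<tau> = (\<Sum>\<^sub>\<infinity>n::int. exp (pi * \<i> * (of_int n)^2 * \<tau>))"

lemma norm_nome: "norm (nome \<tau>) = exp (- pi * Im \<tau>)"
  by (simp add: nome_def)

lemma nome_nonzero [simp]: "nome \<tau> \<noteq> 0"
  by (simp add: nome_def)

lemma norm_nome_less_1: "\<tau> \<in> upper_half_plane \<Longrightarrow> norm (nome \<tau>) < 1"
  by (simp add: norm_nome upper_half_plane_def)

lemma nome_image: "nome ` upper_half_plane = ball 0 1 - {0}"
proof
  show "nome ` upper_half_plane \<subseteq> ball 0 1 - {0}"
    using norm_nome_less_1 by auto
  show "ball 0 1 - {0} \<subseteq> nome ` upper_half_plane"
  proof
    fix x :: complex assume x: "x \<in> ball 0 1 - {0}"
    define \<tau> where "\<tau> = Ln x / (\<i> * pi)"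
    have "nome \<tau> = x" using x by (simp add: nome_def \<tau>_def)
    moreover have "\<tau> \<in> upper_half_plane"
    proof -
      have "norm (nome \<tau>) < 1" using \<open>nome \<tau> = x\<close> x by simp
      then show ?thesis by (simp add: norm_nome upper_half_plane_def zero_less_mult_iff)
    qed
    ultimately show "x \<in> nome ` upper_half_plane" by blast
  qed
qed

lemma nome_preimage:
  assumes "norm x < 1" "x \<noteq> 0"
  obtains \<tau> where "\<tau> \<in> upper_half_plane" "nome \<tau> = x"
proof -
  have "x \<in> nome ` upper_half_plane" using assms by (simp add: nome_image)
  then show ?thesis using that by blast
qed

text \<open>Negative integers are listed as \<open>- (n + 1)\<close>, so that \<open>0\<close> is counted once.\<close>

lemma has_sum_int_from_nat:
  fixes f :: "int \<Rightarrow> 'a::topological_comm_monoid_add"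
  assumes "((\<lambda>n. f (int n)) has_sum a) UNIV" "((\<lambda>n. f (- int (Suc n))) has_sum b) UNIV"
  shows "(f has_sum (a + b)) UNIV"
proof -
  have "(f has_sum a) (range int)"
    using assms(1) by (subst has_sum_reindex) (auto simp: o_def inj_on_def)
  moreover have "(f has_sum b) (range (\<lambda>n. - int (Suc n)))"
    using assms(2) by (subst has_sum_reindex) (auto simp: o_def inj_on_def)
  moreover have "range int \<inter> range (\<lambda>n. - int (Suc n)) = {}" by auto
  ultimately have "(f has_sum (a + b)) (range int \<union> range (\<lambda>n. - int (Suc n)))"
    by (rule has_sum_Un_disjoint)
  moreover have "range int \<union> range (\<lambda>n. - int (Suc n)) = UNIV"
  proof -
    have "k \<in> range int \<union> range (\<lambda>n. - int (Suc n))" for k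
      by (cases k) auto
    then show ?thesis by blast
  qed
  ultimately show ?thesis by simp
qed

definition gap_series :: "(nat \<Rightarrow> nat) \<Rightarrow> complex \<Rightarrow> complex" where
  "gap_series e x = (\<Sum>k. x ^ e k)"

context
  fixes e :: "nat \<Rightarrow> nat"
  assumes e: "\<And>k. k \<le> e k"
begin

lemma norm_gap_term_le:
  fixes x :: complex
  assumes "norm x \<le> r" "r < 1"
  shows "norm (x ^ e k) \<le> r ^ k"
proof -
  have "norm (x ^ e k) \<le> r ^ e k" using assms by (simp add: norm_power power_mono)
  also have "\<dots> \<le> r ^ k" using assms e by (intro power_decreasing) (auto intro: order.trans[OF norm_ge_zero])
  finally show ?thesis .
qed

lemma summable_gap_series:
  fixes x :: complex
  assumes "norm x < 1"
  shows "summable (\<lambda>k. norm (x ^ e k))"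
  by (rule summable_comparison_test[OF _ summable_geometric[of "norm x"]])
     (use assms norm_gap_term_le[of x "norm x"] in auto)

lemma gap_series_has_sum:
  assumes "norm x < 1"
  shows "((\<lambda>k. x ^ e k) has_sum gap_series e x) UNIV"
  unfolding gap_series_def
  by (intro norm_summable_imp_has_sum summable_gap_series assms
        summable_sums[OF summable_norm_cancel])

lemma holomorphic_gap_series: "gap_series e holomorphic_on ball 0 1"
proof (rule holomorphic_uniform_sequence)
  show "(\<lambda>x. \<Sum>k<n. x ^ e k) holomorphic_on ball 0 1" for n
    by (intro holomorphic_intros)
  fix x :: complex assume "x \<in> ball 0 1"
  then have x: "norm x < 1" by simp
  define d where "d = (1 - norm x) / 2"
  define r where "r = norm x + d"
  have d: "d > 0" "r < 1" using x by (auto simp: d_def r_def field_simps)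
  have sub: "norm y \<le> r" if "y \<in> cball x d" for y
    using norm_triangle_sub[of y x] that by (simp add: r_def dist_norm norm_minus_commute)
  have "uniform_limit (cball x d) (\<lambda>n x. \<Sum>k<n. x ^ e k) (\<lambda>x. \<Sum>k. x ^ e k) sequentially"
    using sub d norm_ge_zero[of x]
    by (intro Weierstrass_m_test[where M = "\<lambda>k. r ^ k"] norm_gap_term_le summable_geometric)
       (auto simp: r_def)
  moreover have "cball x d \<subseteq> ball 0 1" using sub d by force
  ultimately show "\<exists>d. 0 < d \<and> cball x d \<subseteq> ball 0 1 \<and>
      uniform_limit (cball x d) (\<lambda>n x. \<Sum>k<n. x ^ e k) (gap_series e) sequentially"
    using d unfolding gap_series_def by blast
qed simp

end

text \<open>Comparison with the geometric series: \<open>r + r^2 + ... = r / (1 - r)\<close>, which is below \<open>1/2\<close> exactly when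
  \<open>r < 1/3\<close>. This is the source of the radius \<open>1/3\<close> below.\<close>

lemma norm_gap_series_less_half:
  assumes e: "\<And>k. k < e k" and x: "norm x < 1 / 3"
  shows "norm (gap_series e x) < 1 / 2"
proof -
  define r where "r = norm x"
  have r: "0 \<le> r" "r < 1 / 3" using x by (auto simp: r_def)
  have le: "norm (x ^ e k) \<le> r * r ^ k" for k
  proof -
    have "norm (x ^ e k) = r ^ e k" by (simp add: r_def norm_power)
    also have "\<dots> \<le> r ^ Suc k" using r e[of k] by (intro power_decreasing) auto
    finally show ?thesis by simp
  qed
  have sm: "summable (\<lambda>k. r * r ^ k)" using r by (intro summable_mult summable_geometric) auto
  have "norm (gap_series e x) \<le> (\<Sum>k. r * r ^ k)"
    unfolding gap_series_def by (rule norm_suminf_le[OF le sm]) 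
  also have "\<dots> = r / (1 - r)" using r by (simp add: suminf_mult suminf_geometric summable_geometric)
  also have "\<dots> < 1 / 2" using r by (simp add: field_simps)
  finally show ?thesis .
qed

text \<open>The series \<open>\<Sum> x^(n^2)\<close> over all integers \<open>n\<close>, folded about \<open>n = 0\<close>.\<close>

definition theta_series :: "complex \<Rightarrow> complex" where
  "theta_series x = 1 + 2 * gap_series (\<lambda>k. (k + 1)^2) x"

text \<open>The series \<open>\<Sum> x^(n (n + 1))\<close> over \<open>n \<ge> 0\<close>, with the constant term split off.\<close>

definition psi_series :: "complex \<Rightarrow> complex" where
  "psi_series x = 1 + gap_series (\<lambda>k. (k + 1) * (k + 2)) x"

lemma square_gap: "k < (k + 1)\<^sup>2" for k :: nat
  by (simp add: power2_eq_square)

lemma pronic_gap: "k < (k + 1) * (k + 2)" for k :: nat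
  by simp

lemma holomorphic_theta_series: "theta_series holomorphic_on ball 0 1"
  unfolding theta_series_def
  by (intro holomorphic_intros holomorphic_gap_series less_imp_le square_gap)

lemma holomorphic_psi_series: "psi_series holomorphic_on ball 0 1"
  unfolding psi_series_def
  by (intro holomorphic_intros holomorphic_gap_series less_imp_le pronic_gap)

lemma theta_series_nonzero:
  assumes "norm x < 1 / 3" shows "theta_series x \<noteq> 0"
proof
  assume "theta_series x = 0"
  then have "2 * gap_series (\<lambda>k. (k + 1)^2) x = -1"
    by (simp add: theta_series_def add_eq_0_iff)
  then have "norm (2 * gap_series (\<lambda>k. (k + 1)^2) x) = 1" by simp
  then show False using norm_gap_series_less_half[OF square_gap assms] by (simp add: norm_mult)
qed

lemma psi_series_nonzero:
  assumes "norm x < 1 / 3" shows "psi_series x \<noteq> 0"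
proof
  assume "psi_series x = 0"
  then have "gap_series (\<lambda>k. (k + 1) * (k + 2)) x = -1"
    by (simp add: psi_series_def add_eq_0_iff)
  then have "norm (gap_series (\<lambda>k. (k + 1) * (k + 2)) x) = 1" by simp
  then show False using norm_gap_series_less_half[OF pronic_gap assms] by simp
qed

lemma gap_series_0:
  assumes "\<And>k. k < e k"
  shows "gap_series e 0 = 0"
proof -
  have z: "(0::complex) ^ e k = 0" for k
    using assms[of k] by (cases "e k") auto
  show ?thesis unfolding gap_series_def z by simp
qed

lemma theta_series_0 [simp]: "theta_series 0 = 1"
  unfolding theta_series_def by (subst gap_series_0[OF square_gap]) simp

lemma psi_series_0 [simp]: "psi_series 0 = 1"
  unfolding psi_series_def by (subst gap_series_0[OF pronic_gap]) simp

lemma exp_square_nome: "exp (pi * \<i> * (of_nat n)^2 * \<tau>) = nome \<tau> ^ (n^2)"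
  unfolding nome_def exp_of_nat_mult[symmetric]
  by (rule arg_cong[of _ _ exp]) simp

lemma has_sum_Suc:
  fixes f :: "nat \<Rightarrow> 'a::{topological_comm_monoid_add}"
  assumes "((\<lambda>n. f (Suc n)) has_sum a) UNIV"
  shows "(f has_sum (f 0 + a)) UNIV"
proof -
  have "(f has_sum a) (range Suc)"
    using assms by (subst has_sum_reindex) (auto simp: o_def)
  moreover have "(f has_sum f 0) {0}" by (simp add: has_sum_finiteI)
  ultimately have "(f has_sum (f 0 + a)) ({0} \<union> range Suc)"
    by (intro has_sum_Un_disjoint) auto
  moreover have "{0} \<union> range Suc = (UNIV :: nat set)" using UNIV_nat_eq by auto
  ultimately show ?thesis by simp
qed

lemma theta00_has_sum:
  assumes "\<tau> \<in> upper_half_plane"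
  shows "((\<lambda>n::int. exp (pi * \<i> * (of_int n)^2 * \<tau>)) has_sum theta_series (nome \<tau>)) UNIV"
proof -
  define g where "g = gap_series (\<lambda>k. (k + 1)^2) (nome \<tau>)"
  have g: "((\<lambda>k. nome \<tau> ^ (Suc k)\<^sup>2) has_sum g) UNIV"
    using gap_series_has_sum[of "\<lambda>k. (k + 1)^2" "nome \<tau>"] square_gap norm_nome_less_1[OF assms]
    by (simp add: g_def less_imp_le)
  have "((\<lambda>n::int. exp (pi * \<i> * (of_int n)^2 * \<tau>)) has_sum ((nome \<tau> ^ 0\<^sup>2 + g) + g)) UNIV"
  proof (rule has_sum_int_from_nat)
    show "((\<lambda>n. exp (pi * \<i> * (of_int (int n))^2 * \<tau>)) has_sum (nome \<tau> ^ 0\<^sup>2 + g)) UNIV"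
      using has_sum_Suc[of "\<lambda>n. nome \<tau> ^ n\<^sup>2", OF g] by (simp only: of_int_of_nat_eq exp_square_nome)
    show "((\<lambda>n. exp (pi * \<i> * (of_int (- int (Suc n)))^2 * \<tau>)) has_sum g) UNIV"
      using g by (simp only: of_int_minus of_int_of_nat_eq power2_minus exp_square_nome)
  qed
  then show ?thesis by (simp add: theta_series_def g_def add_ac)
qed

lemma theta00_eq: "\<tau> \<in> upper_half_plane \<Longrightarrow> theta00 \<tau> = theta_series (nome \<tau>)"
  unfolding theta00_def by (rule infsumI[OF theta00_has_sum])

lemma uhp_add_of_real [simp]: "\<tau> + of_real r \<in> upper_half_plane \<longleftrightarrow> \<tau> \<in> upper_half_plane"
  by (simp add: upper_half_plane_def)

text \<open>The sign \<open>(-1)^n = (-1)^(n^2)\<close> is the effect of a translation by 1 on \<open>x^(n^2)\<close>.\<close>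

lemma theta01_term: "(-1) powi n * exp (pi * \<i> * (of_int n)^2 * \<tau>) = exp (pi * \<i> * (of_int n)^2 * (\<tau> + 1))"
proof -
  have "exp (pi * \<i> * (of_int n)^2 * (\<tau> + 1)) = exp (pi * \<i> * (of_int n)^2) * exp (pi * \<i> * (of_int n)^2 * \<tau>)"
    by (simp add: exp_add[symmetric] algebra_simps)
  also have "exp (pi * \<i> * (of_int n)^2) = exp (pi * \<i>) powi (n^2)"
    unfolding exp_power_int by (simp add: mult_ac)
  also have "\<dots> = (-1) powi n" by (cases "even n") (simp_all add: power_int_minus_one_minus)
  finally show ?thesis by simp
qed

lemma theta01_eq_theta00_shift: "theta01 \<tau> = theta00 (\<tau> + 1)"
  unfolding theta01_def theta00_def theta01_term ..

lemma nome_add_1: "nome (\<tau> + 1) = - nome \<tau>"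
  by (simp add: nome_def distrib_left exp_add)

lemma theta01_eq: "\<tau> \<in> upper_half_plane \<Longrightarrow> theta01 \<tau> = theta_series (- nome \<tau>)"
  using theta00_eq[of "\<tau> + 1"] uhp_add_of_real[of \<tau> 1]
  by (simp add: theta01_eq_theta00_shift nome_add_1)

lemma exp_half_square_nome:
  "exp (pi * \<i> * (of_nat n + 1/2)^2 * \<tau>) = exp (pi * \<i> * \<tau> / 4) * nome \<tau> ^ (n * (n + 1))"
proof -
  define c :: complex where "c = of_nat (n * (n + 1))"
  have sq: "(of_nat n + 1/2)^2 = c + 1/4"
    by (simp add: c_def power2_eq_square algebra_simps)
  have "pi * \<i> * (c + 1/4) * \<tau> = pi * \<i> * \<tau> / 4 + c * (\<i> * pi * \<tau>)"
    by (simp add: algebra_simps)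
  then show ?thesis
    unfolding nome_def exp_of_nat_mult[symmetric] exp_add[symmetric] sq c_def by (rule arg_cong)
qed

lemma theta10_has_sum:
  assumes "\<tau> \<in> upper_half_plane"
  shows "((\<lambda>n::int. exp (pi * \<i> * (of_int n + 1/2)^2 * \<tau>)) has_sum
           (2 * exp (pi * \<i> * \<tau> / 4) * psi_series (nome \<tau>))) UNIV"
proof -
  define g where "g = gap_series (\<lambda>k. (k + 1) * (k + 2)) (nome \<tau>)"
  define h where "h = exp (pi * \<i> * \<tau> / 4) * (nome \<tau> ^ (0 * (0 + 1)) + g)"
  have g: "((\<lambda>k. nome \<tau> ^ (Suc k * (Suc k + 1))) has_sum g) UNIV"
    using gap_series_has_sum[of "\<lambda>k. (k + 1) * (k + 2)" "nome \<tau>", OF less_imp_le[OF pronic_gap] norm_nome_less_1[OF assms]]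
    by (simp add: g_def)
  have h: "((\<lambda>n. exp (pi * \<i> * (of_nat n + 1/2)^2 * \<tau>)) has_sum h) UNIV"
    unfolding exp_half_square_nome h_def
    using has_sum_Suc[of "\<lambda>n. nome \<tau> ^ (n * (n + 1))", OF g] by (rule has_sum_cmult_right)
  have sq: "(of_int (- int (Suc n)) + 1/2)^2 = (of_nat n + 1/2 :: complex)^2" for n
  proof -
    have "of_int (- int (Suc n)) + 1/2 = - (of_nat n + 1/2 :: complex)" by simp
    then show ?thesis by (simp only: power2_minus)
  qed
  have "((\<lambda>n::int. exp (pi * \<i> * (of_int n + 1/2)^2 * \<tau>)) has_sum (h + h)) UNIV"
    by (rule has_sum_int_from_nat) (use h in \<open>simp_all only: sq of_int_of_nat_eq\<close>)
  then show ?thesis by (simp add: h_def psi_series_def g_def algebra_simps)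
qed

lemma theta10_eq:
  "\<tau> \<in> upper_half_plane \<Longrightarrow> theta10 \<tau> = 2 * exp (pi * \<i> * \<tau> / 4) * psi_series (nome \<tau>)"
  unfolding theta10_def by (rule infsumI[OF theta10_has_sum])

section \<open>Inversion formulas for complex arguments\<close>

lemma theta_series_sums:
  assumes "norm x < 1"
  shows "theta_series x = 1 + 2 * (\<Sum>k. x ^ (Suc k)\<^sup>2)"
  by (simp add: theta_series_def gap_series_def)

lemma open_uhp: "open upper_half_plane"
  unfolding upper_half_plane_def by (rule open_halfspace_Im_gt)

lemma connected_uhp: "connected upper_half_plane"
  unfolding upper_half_plane_def by (intro convex_connected convex_halfspace_Im_gt)

lemma holomorphic_nome: "nome holomorphic_on A"
  unfolding nome_def by (intro holomorphic_intros)

lemma holomorphic_theta00: "theta00 holomorphic_on upper_half_plane"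
proof (rule holomorphic_transform)
  show "(theta_series \<circ> nome) holomorphic_on upper_half_plane"
    using norm_nome_less_1
    by (intro holomorphic_on_compose_gen[OF holomorphic_nome holomorphic_theta_series]) auto
qed (simp add: theta00_eq)

lemma uhp_inversion: "-1 / \<tau> \<in> upper_half_plane \<longleftrightarrow> \<tau> \<in> upper_half_plane"
proof (cases "\<tau> = 0")
  case False
  have "Im (- 1 / \<tau>) = Im \<tau> / (cmod \<tau>)\<^sup>2"
    by (simp add: Im_divide cmod_power2)
  then show ?thesis using False by (simp add: upper_half_plane_def zero_less_divide_iff)
qed (simp add: upper_half_plane_def)

lemma uhp_nonzero: "\<tau> \<in> upper_half_plane \<Longrightarrow> \<tau> \<noteq> 0"
  by (auto simp: upper_half_plane_def)

lemma uhp_scale: "r > 0 \<Longrightarrow> of_real r * \<tau> \<in> upper_half_plane \<longleftrightarrow> \<tau> \<in> upper_half_plane"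
  by (simp add: upper_half_plane_def zero_less_mult_iff)

lemma theta00_imaginary:
  assumes "t > 0"
  shows "theta00 (\<i> * of_real t) = of_real (1 + 2 * (\<Sum>k. exp (- (pi * t * (real (Suc k))\<^sup>2))))"
proof -
  have uhp: "\<i> * of_real t \<in> upper_half_plane" using assms by (simp add: upper_half_plane_def)
  have nome: "nome (\<i> * of_real t) = of_real (exp (- (pi * t)))"
    by (simp add: nome_def exp_of_real[symmetric] mult.assoc[symmetric]) (simp add: mult_ac)
  have term_eq: "nome (\<i> * of_real t) ^ (Suc k)\<^sup>2 = of_real (exp (- (pi * t * (real (Suc k))\<^sup>2)))" for k
    unfolding nome of_real_power[symmetric] of_real_eq_iff exp_of_nat_mult[symmetric]
    by (rule arg_cong[of _ _ exp]) simp
  have "summable (\<lambda>k. exp (- (pi * t * (real (Suc k))\<^sup>2)))"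
    using assms by (intro summable_gaussian_tail) auto
  then have "(\<lambda>k. complex_of_real (exp (- (pi * t * (real (Suc k))\<^sup>2)))) sums
      of_real (\<Sum>k. exp (- (pi * t * (real (Suc k))\<^sup>2)))"
    by (intro sums_of_real summable_sums)
  then have "(\<Sum>k. nome (\<i> * of_real t) ^ (Suc k)\<^sup>2) = of_real (\<Sum>k. exp (- (pi * t * (real (Suc k))\<^sup>2)))"
    unfolding term_eq by (rule sums_unique[symmetric])
  then show ?thesis
    using theta_series_sums[OF norm_nome_less_1[OF uhp]] by (simp only: theta00_eq[OF uhp]) simp
qed

text \<open>Both sides are holomorphic on the half plane, and on the imaginary axis the identity is the real one.\<close>

theorem theta00_inversion:
  assumes "\<tau> \<in> upper_half_plane"
  shows "theta00 (- 1 / \<tau>) = csqrt (- \<i> * \<tau>) * theta00 \<tau>"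
proof -
  define F where "F = (\<lambda>\<tau>. theta00 (- 1 / \<tau>) - csqrt (- \<i> * \<tau>) * theta00 \<tau>)"
  have "F \<tau> = 0"
  proof (rule analytic_continuation[of F upper_half_plane "(\<lambda>t. \<i> * of_real t) ` {0<..}" \<i>])
    have "(theta00 \<circ> (\<lambda>\<tau>. -1 / \<tau>)) holomorphic_on upper_half_plane"
      by (rule holomorphic_on_compose_gen[OF _ holomorphic_theta00])
         (auto intro!: holomorphic_intros dest: uhp_nonzero simp only: uhp_inversion image_subset_iff)
    moreover have "(\<lambda>\<tau>. csqrt (- \<i> * \<tau>)) holomorphic_on upper_half_plane"
      by (intro holomorphic_intros) (auto simp: upper_half_plane_def complex_nonpos_Reals_iff)
    ultimately show "F holomorphic_on upper_half_plane"
      unfolding F_def o_def by (intro holomorphic_on_diff holomorphic_on_mult holomorphic_theta00)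
    show "(\<lambda>t. \<i> * of_real t) ` {0<..} \<subseteq> upper_half_plane"
      by (auto simp: upper_half_plane_def)
    show "\<i> \<in> upper_half_plane" by (simp add: upper_half_plane_def)
    show "\<i> islimpt (\<lambda>t. \<i> * of_real t) ` {0<..}"
    proof (rule islimptI)
      fix T assume "\<i> \<in> T" "open T"
      then obtain d where d: "d > 0" "ball \<i> d \<subseteq> T" by (meson openE)
      have "\<i> * of_real (1 + d / 2) \<in> ball \<i> d"
        using d by (simp add: dist_norm algebra_simps norm_mult)
      then have "\<i> * of_real (1 + d / 2) \<in> T" using d by blast
      moreover have "\<i> * of_real (1 + d / 2) \<noteq> \<i>" using d by (simp add: complex_eq_iff)
      moreover have "\<i> * of_real (1 + d / 2) \<in> (\<lambda>t. \<i> * of_real t) ` {0<..}"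
        using d by (intro imageI) simp
      ultimately show "\<exists>y\<in>(\<lambda>t. \<i> * of_real t) ` {0<..}. y \<in> T \<and> y \<noteq> \<i>" by blast
    qed
    fix z assume "z \<in> (\<lambda>t. \<i> * complex_of_real t) ` {0<..}"
    then obtain t where t: "t > 0" "z = \<i> * of_real t" by auto
    have inv: "- 1 / z = \<i> * of_real (1 / t)" using t by (simp add: field_simps)
    have "theta00 z = of_real (1 / sqrt t) * theta00 (- 1 / z)"
      unfolding inv unfolding t(2) using t(1) theta_inversion_real[OF t(1)]
      by (subst (1 2) theta00_imaginary) (simp_all only: of_real_mult[symmetric] zero_less_divide_1_iff times_divide_eq_right mult_1_right)
    moreover have "csqrt (- \<i> * z) = of_real (sqrt t)"
    proof -
      have "- \<i> * z = of_real t" by (simp add: t(2) mult.assoc[symmetric])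
      then show ?thesis using csqrt_of_real_nonneg[of "of_real t"] t(1) by simp
    qed
    ultimately show "F z = 0" using t by (simp add: F_def)
  qed (use assms open_uhp connected_uhp in auto)
  then show ?thesis by (simp add: F_def)
qed

text \<open>Split the sum over \<open>n\<close> into even \<open>n\<close> and odd \<open>n\<close>.\<close>

lemma theta00_quadruple:
  assumes "\<tau> \<in> upper_half_plane"
  shows "theta00 \<tau> = theta00 (4 * \<tau>) + theta10 (4 * \<tau>)"
    and "theta01 \<tau> = theta00 (4 * \<tau>) - theta10 (4 * \<tau>)"
proof -
  define f where "f = (\<lambda>n::int. exp (pi * \<i> * (of_int n)^2 * \<tau>))"
  have \<tau>4: "4 * \<tau> \<in> upper_half_plane" using uhp_scale[of 4 \<tau>] assms by simp
  have ev: "(f has_sum theta00 (4 * \<tau>)) (range (\<lambda>n. 2 * n))"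
    using theta00_has_sum[OF \<tau>4] theta00_eq[OF \<tau>4]
    by (subst has_sum_reindex) (auto simp: o_def f_def inj_on_def power_mult_distrib mult_ac)
  have "exp (pi * \<i> * (of_int (2 * n + 1))^2 * \<tau>) = exp (pi * \<i> * (of_int n + 1/2)^2 * (4 * \<tau>))" for n
    by (rule arg_cong[of _ _ exp]) (simp add: power2_eq_square algebra_simps)
  then have od: "(f has_sum theta10 (4 * \<tau>)) (range (\<lambda>n. 2 * n + 1))"
    using theta10_has_sum[OF \<tau>4] theta10_eq[OF \<tau>4]
    by (subst has_sum_reindex) (auto simp: o_def f_def inj_on_def)
  have disj: "range (\<lambda>n::int. 2 * n) \<inter> range (\<lambda>n. 2 * n + 1) = {}" by (auto; presburger)
  have univ: "range (\<lambda>n::int. 2 * n) \<union> range (\<lambda>n. 2 * n + 1) = UNIV"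
    by (auto simp: image_iff) presburger
  show "theta00 \<tau> = theta00 (4 * \<tau>) + theta10 (4 * \<tau>)"
    using has_sum_Un_disjoint[OF ev od disj] unfolding univ theta00_def[of \<tau>] f_def by (rule infsumI)
  have ev': "((\<lambda>n. (-1) powi n * f n) has_sum theta00 (4 * \<tau>)) (range (\<lambda>n. 2 * n))"
    using ev by (rule has_sum_cong[THEN iffD1, rotated]) auto
  have "((\<lambda>n. - f n) has_sum - theta10 (4 * \<tau>)) (range (\<lambda>n. 2 * n + 1))"
    using od by (simp add: has_sum_uminus)
  then have od': "((\<lambda>n. (-1) powi n * f n) has_sum - theta10 (4 * \<tau>)) (range (\<lambda>n. 2 * n + 1))"
    by (rule has_sum_cong[THEN iffD1, rotated]) auto
  show "theta01 \<tau> = theta00 (4 * \<tau>) - theta10 (4 * \<tau>)"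
    using has_sum_Un_disjoint[OF ev' od' disj] unfolding univ theta01_def[of \<tau>] f_def
    by (simp add: infsumI)
qed

text \<open>By the splitting into even and odd indices, \<open>\<theta>[1,0]\<close> and \<open>\<theta>[0,1]\<close> are combinations of \<open>\<theta>[0,0]\<close> at
  \<open>\<tau>\<close> and \<open>4 \<tau>\<close>, so they inherit its inversion formula.\<close>

lemma theta10_inversion:
  assumes "\<tau> \<in> upper_half_plane"
  shows "theta10 (- 1 / \<tau>) = csqrt (- \<i> * \<tau>) * theta01 \<tau>"
proof -
  define \<sigma> where "\<sigma> = - 1 / (4 * \<tau>)"
  have \<tau>4: "4 * \<tau> \<in> upper_half_plane" using uhp_scale[of 4 \<tau>] assms by simp
  have \<sigma>: "\<sigma> \<in> upper_half_plane" using \<tau>4 unfolding \<sigma>_def by (simp only: uhp_inversion)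
  have "4 * \<sigma> = - 1 / \<tau>" by (simp add: \<sigma>_def)
  then have "theta10 (- 1 / \<tau>) = theta00 \<sigma> - theta00 (- 1 / \<tau>)"
    using theta00_quadruple(1)[OF \<sigma>] by simp
  also have "\<dots> = csqrt (- \<i> * (4 * \<tau>)) * theta00 (4 * \<tau>) - csqrt (- \<i> * \<tau>) * theta00 \<tau>"
    unfolding \<sigma>_def theta00_inversion[OF \<tau>4] theta00_inversion[OF assms] ..
  also have "csqrt (- \<i> * (4 * \<tau>)) = 2 * csqrt (- \<i> * \<tau>)"
  proof (rule csqrt_unique)
    show "(2 * csqrt (- \<i> * \<tau>))\<^sup>2 = - \<i> * (4 * \<tau>)" by (simp add: power_mult_distrib)
    show "0 < Re (2 * csqrt (- \<i> * \<tau>)) \<or> Re (2 * csqrt (- \<i> * \<tau>)) = 0 \<and> 0 \<le> Im (2 * csqrt (- \<i> * \<tau>))"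
      using csqrt_principal[of "- \<i> * \<tau>"] by simp
  qed
  also have "2 * csqrt (- \<i> * \<tau>) * theta00 (4 * \<tau>) - csqrt (- \<i> * \<tau>) * theta00 \<tau> =
      csqrt (- \<i> * \<tau>) * theta01 \<tau>"
    unfolding theta00_quadruple[OF assms] right_diff_distrib distrib_left by simp
  finally show ?thesis .
qed

section \<open>Doubling formulas and Jacobi's identity\<close>

lemma has_sum_product_complex:
  fixes f :: "'a \<Rightarrow> complex" and g :: "'b \<Rightarrow> complex"
  assumes "(f has_sum a) A" "(g has_sum b) B"
  shows "((\<lambda>(m, n). f m * g n) has_sum (a * b)) (A \<times> B)"
proof (rule has_sum_SigmaI)
  show "((\<lambda>y. case (x, y) of (m, n) \<Rightarrow> f m * g n) has_sum f x * b) B" for x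
    using has_sum_cmult_right[OF assms(2)] by simp
  show "((\<lambda>x. f x * b) has_sum a * b) A" by (rule has_sum_cmult_left[OF assms(1)])
  have fg: "(\<lambda>x. norm (f x)) summable_on A" "(\<lambda>x. norm (g x)) summable_on B"
    using assms by (auto simp: summable_on_iff_abs_summable_on_complex[symmetric] has_sum_imp_summable)
  have "(\<lambda>x. norm (case x of (m, n) \<Rightarrow> f m * g n)) summable_on A \<times> B"
    unfolding Infinite_Sum.abs_summable_on_Sigma_iff
    using fg by (auto simp: norm_mult infsum_cmult_right' infsum_nonneg
        intro!: summable_on_cmult_right summable_on_cmult_left)
  then show "(\<lambda>(m, n). f m * g n) summable_on A \<times> B"
    by (rule abs_summable_summable)
qed

text \<open>The summand of \<open>\<theta>[0,0]^2\<close>, indexed by the points of the square lattice.\<close>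

definition lattice_term :: "complex \<Rightarrow> int \<times> int \<Rightarrow> complex" where
  "lattice_term \<tau> = (\<lambda>(m, n). exp (pi * \<i> * ((of_int m)^2 + (of_int n)^2) * \<tau>))"

context
  fixes \<tau> :: complex
  assumes \<tau>: "\<tau> \<in> upper_half_plane"
begin

lemma theta00_has_sum': "((\<lambda>n::int. exp (pi * \<i> * (of_int n)^2 * \<tau>)) has_sum theta00 \<tau>) UNIV"
  using theta00_has_sum[OF \<tau>] theta00_eq[OF \<tau>] by simp

lemma theta01_has_sum': "((\<lambda>n::int. (-1) powi n * exp (pi * \<i> * (of_int n)^2 * \<tau>)) has_sum theta01 \<tau>) UNIV"
  unfolding theta01_term theta01_eq_theta00_shift
  using theta00_has_sum[of "\<tau> + 1"] theta00_eq[of "\<tau> + 1"] uhp_add_of_real[of \<tau> 1] \<tau> by simp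

lemma theta10_has_sum': "((\<lambda>n::int. exp (pi * \<i> * (of_int n + 1/2)^2 * \<tau>)) has_sum theta10 \<tau>) UNIV"
  using theta10_has_sum[OF \<tau>] theta10_eq[OF \<tau>] by simp

lemma theta00_theta00_has_sum: "(lattice_term \<tau> has_sum (theta00 \<tau>)\<^sup>2) UNIV"
  using has_sum_product_complex[OF theta00_has_sum' theta00_has_sum']
  by (simp add: lattice_term_def case_prod_unfold exp_add[symmetric] distrib_left distrib_right power2_eq_square[of "theta00 \<tau>"])

lemma theta01_theta01_has_sum:
  "((\<lambda>(m, n). (-1) powi (m + n) * lattice_term \<tau> (m, n)) has_sum (theta01 \<tau>)\<^sup>2) UNIV"
  using has_sum_product_complex[OF theta01_has_sum' theta01_has_sum']
  by (simp add: lattice_term_def case_prod_unfold exp_add distrib_left distrib_right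
     power_int_add mult_ac power2_eq_square[of "theta01 \<tau>"])

lemma theta00_theta01_has_sum:
  "((\<lambda>(m, n). (-1) powi n * lattice_term \<tau> (m, n)) has_sum (theta00 \<tau> * theta01 \<tau>)) UNIV"
  using has_sum_product_complex[OF theta00_has_sum' theta01_has_sum']
  by (simp add: lattice_term_def case_prod_unfold exp_add distrib_left distrib_right mult_ac)

end

text \<open>The sublattice of index 2 that is the image of \<open>(a, b) \<mapsto> (a + b, a - b)\<close>; this map doubles the quadratic
  form \<open>m^2 + n^2\<close> and so relates \<open>\<tau>\<close> to \<open>2 \<tau>\<close>.\<close>

definition even_pairs :: "(int \<times> int) set" where
  "even_pairs = {(m, n). even (m + n)}"

lemma has_sum_even_pairs:
  "((\<lambda>(a, b). f (a + b, a - b)) has_sum S) UNIV \<longleftrightarrow> (f has_sum S) even_pairs"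
proof -
  have "bij_betw (\<lambda>(a, b). (a + b, a - b)) UNIV even_pairs"
    by (rule bij_betw_byWitness[of _ "\<lambda>(m, n). ((m + n) div 2, (m - n) div 2)"])
       (auto simp: even_pairs_def elim!: evenE; presburger)+
  from has_sum_reindex_bij_betw[OF this, of f S] show ?thesis by (simp add: case_prod_unfold)
qed

lemma has_sum_odd_pairs:
  "((\<lambda>(a, b). f (a + b + 1, a - b)) has_sum S) UNIV \<longleftrightarrow> (f has_sum S) (- even_pairs)"
proof -
  have "bij_betw (\<lambda>(a, b). (a + b + 1, a - b)) UNIV (- even_pairs)"
    by (rule bij_betw_byWitness[of _ "\<lambda>(m, n). ((m + n - 1) div 2, (m - n - 1) div 2)"])
       (auto simp: even_pairs_def elim!: oddE; presburger)+
  from has_sum_reindex_bij_betw[OF this, of f S] show ?thesis by (simp add: case_prod_unfold)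
qed

lemma lattice_term_rotate: "lattice_term \<tau> (a + b, a - b) = lattice_term (2 * \<tau>) (a, b)"
  unfolding lattice_term_def
  by (simp add: power2_eq_square algebra_simps)

text \<open>On the other coset the rotated coordinates are half-integers, which turns \<open>\<theta>[0,0]\<close> into \<open>\<theta>[1,0]\<close>.\<close>

lemma lattice_term_rotate_shift:
  "lattice_term \<tau> (a + b + 1, a - b) =
     exp (pi * \<i> * (of_int a + 1/2)^2 * (2 * \<tau>)) * exp (pi * \<i> * (of_int b + 1/2)^2 * (2 * \<tau>))"
proof -
  have "(of_int (a + b + 1))^2 + (of_int (a - b))^2 = 2 * ((of_int a + 1/2)^2 + (of_int b + 1/2)^2 :: complex)"
    by (simp add: power2_eq_square algebra_simps)
  then have "pi * \<i> * ((of_int (a + b + 1))^2 + (of_int (a - b))^2) * \<tau>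
     = pi * \<i> * (of_int a + 1/2)^2 * (2 * \<tau>) + pi * \<i> * (of_int b + 1/2)^2 * (2 * \<tau>)"
    by (simp only:) (simp only: distrib_left distrib_right mult_ac)
  then show ?thesis by (simp only: lattice_term_def prod.case exp_add)
qed

context
  fixes \<tau> :: complex
  assumes \<tau>: "\<tau> \<in> upper_half_plane"
begin

lemma uhp_double: "2 * \<tau> \<in> upper_half_plane"
  using uhp_scale[of 2 \<tau>] \<tau> by simp

lemma lattice_sum_even: "(lattice_term \<tau> has_sum (theta00 (2 * \<tau>))\<^sup>2) even_pairs"
  using theta00_theta00_has_sum[OF uhp_double]
  by (subst has_sum_even_pairs[symmetric]) (simp only: lattice_term_rotate case_prod_eta)

lemma lattice_sum_odd: "(lattice_term \<tau> has_sum (theta10 (2 * \<tau>))\<^sup>2) (- even_pairs)"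
  using has_sum_product_complex[OF theta10_has_sum'[OF uhp_double] theta10_has_sum'[OF uhp_double]]
  by (subst has_sum_odd_pairs[symmetric]) (simp only: lattice_term_rotate_shift UNIV_Times_UNIV power2_eq_square[of "theta10 (2 * \<tau>)"])

text \<open>The sum over the lattice is the sum over its two cosets; with the sign \<open>(-1)^(m + n)\<close>, constant on
  each coset, the same splitting gives the formula for \<open>\<theta>[0,1]\<close>.\<close>

lemma theta00_square: "(theta00 \<tau>)\<^sup>2 = (theta00 (2 * \<tau>))\<^sup>2 + (theta10 (2 * \<tau>))\<^sup>2"
  using has_sum_Un_disjoint[OF lattice_sum_even lattice_sum_odd]
  by (simp add: has_sum_unique[OF theta00_theta00_has_sum[OF \<tau>]])

lemma theta01_square: "(theta01 \<tau>)\<^sup>2 = (theta00 (2 * \<tau>))\<^sup>2 - (theta10 (2 * \<tau>))\<^sup>2"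
proof -
  let ?f = "\<lambda>(m, n). (-1) powi (m + n) * lattice_term \<tau> (m, n)"
  have "(?f has_sum (theta00 (2 * \<tau>))\<^sup>2) even_pairs"
    using lattice_sum_even by (rule has_sum_cong[THEN iffD1, rotated]) (auto simp: even_pairs_def)
  moreover have "((\<lambda>x. - lattice_term \<tau> x) has_sum - (theta10 (2 * \<tau>))\<^sup>2) (- even_pairs)"
    using lattice_sum_odd by (simp add: has_sum_uminus)
  then have "(?f has_sum - (theta10 (2 * \<tau>))\<^sup>2) (- even_pairs)"
  proof (rule has_sum_cong[THEN iffD1, rotated])
    show "- lattice_term \<tau> x = ?f x" if "x \<in> - even_pairs" for x
      using that by (cases x) (simp add: even_pairs_def power_int_minus_left)
  qed
  ultimately have "(?f has_sum ((theta00 (2 * \<tau>))\<^sup>2 + - (theta10 (2 * \<tau>))\<^sup>2)) (even_pairs \<union> - even_pairs)"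
    by (rule has_sum_Un_disjoint) auto
  then show ?thesis
    using has_sum_unique[OF theta01_theta01_has_sum[OF \<tau>]] by simp
qed

text \<open>On the even coset the sign \<open>(-1)^n\<close> becomes \<open>(-1)^(a + b)\<close>; on the odd coset the sum vanishes, because
  exchanging \<open>m\<close> and \<open>n\<close> reverses the sign.\<close>

lemma theta01_double: "(theta01 (2 * \<tau>))\<^sup>2 = theta00 \<tau> * theta01 \<tau>"
proof -
  let ?f = "\<lambda>(m, n). (-1) powi n * lattice_term \<tau> (m, n)"
  have "((\<lambda>(a, b). ?f (a + b, a - b)) has_sum (theta01 (2 * \<tau>))\<^sup>2) UNIV"
  proof -
    have "(-1) powi (a - b) = ((-1) powi (a + b) :: complex)" for a b :: int
      by (cases "even a"; cases "even b") (auto simp: power_int_minus_one_minus)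
    then show ?thesis
      using theta01_theta01_has_sum[OF uhp_double] by (simp only: lattice_term_rotate prod.case)
  qed
  then have ev: "(?f has_sum (theta01 (2 * \<tau>))\<^sup>2) even_pairs"
    by (subst (asm) has_sum_even_pairs)
  have "?f summable_on UNIV" using theta00_theta01_has_sum[OF \<tau>] by (rule has_sum_imp_summable)
  then obtain S where S: "(?f has_sum S) (- even_pairs)"
    using summable_on_subset_banach[of ?f UNIV "- even_pairs"] by (auto simp: summable_on_def)
  have "bij_betw prod.swap (- even_pairs) (- even_pairs)"
    by (rule bij_betw_byWitness[of _ prod.swap]) (auto simp: even_pairs_def add.commute)
  from has_sum_reindex_bij_betw[OF this, of ?f S] S
  have "((\<lambda>x. ?f (prod.swap x)) has_sum S) (- even_pairs)" by simp
  then have "((\<lambda>x. - ?f x) has_sum S) (- even_pairs)"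
  proof (rule has_sum_cong[THEN iffD1, rotated])
    show "?f (prod.swap x) = - ?f x" if "x \<in> - even_pairs" for x
      using that by (cases x) (simp add: even_pairs_def lattice_term_def add.commute power_int_minus_left)
  qed
  moreover have "((\<lambda>x. - ?f x) has_sum - S) (- even_pairs)" using S by (simp add: has_sum_uminus)
  ultimately have "S = - S" by (rule has_sum_unique)
  then have "S = 0" by simp
  have "(?f has_sum ((theta01 (2 * \<tau>))\<^sup>2 + S)) (even_pairs \<union> - even_pairs)"
    using ev S by (rule has_sum_Un_disjoint) auto
  then show ?thesis
    using has_sum_unique[OF theta00_theta01_has_sum[OF \<tau>]] \<open>S = 0\<close> by simp
qed

end

text \<open>With \<open>\<sigma> = \<tau> / 2\<close>, the three doubling formulas express \<open>\<theta>[0,1](\<tau>)^4\<close> as a difference of squares.\<close>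

theorem jacobi_identity:
  assumes "\<tau> \<in> upper_half_plane"
  shows "theta00 \<tau> ^ 4 = theta01 \<tau> ^ 4 + theta10 \<tau> ^ 4"
proof -
  define \<sigma> where "\<sigma> = \<tau> / 2"
  have \<sigma>: "\<sigma> \<in> upper_half_plane" and eq: "\<tau> = 2 * \<sigma>"
    using assms uhp_scale[of "1/2" \<tau>] by (auto simp: \<sigma>_def)
  have "theta01 \<tau> ^ 4 = ((theta01 \<tau>)\<^sup>2)\<^sup>2" by simp
  also have "\<dots> = (theta00 \<sigma>)\<^sup>2 * (theta01 \<sigma>)\<^sup>2"
    unfolding eq theta01_double[OF \<sigma>] by (simp add: power_mult_distrib)
  also have "\<dots> = ((theta00 \<tau>)\<^sup>2 + (theta10 \<tau>)\<^sup>2) * ((theta00 \<tau>)\<^sup>2 - (theta10 \<tau>)\<^sup>2)"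
    unfolding theta00_square[OF \<sigma>] theta01_square[OF \<sigma>] eq ..
  also have "\<dots> = theta00 \<tau> ^ 4 - theta10 \<tau> ^ 4"
    by (simp add: algebra_simps power2_eq_square power4_eq_xxxx)
  finally show ?thesis by simp
qed

section \<open>The quarter turn and the two forms\<close>

text \<open>The rotation by a right angle about \<open>\<i>\<close>.\<close>

definition quarter_turn :: "complex \<Rightarrow> complex" where
  "quarter_turn \<tau> = (\<tau> - 1) / (\<tau> + 1)"

lemma uhp_add_1_nonzero: "\<tau> \<in> upper_half_plane \<Longrightarrow> \<tau> + 1 \<noteq> 0"
  by (auto simp: upper_half_plane_def complex_eq_iff)

text \<open>The decomposition into a translation, a scaling by \<open>1/2\<close>, an inversion and another translation.\<close>

lemma quarter_turn_eq: "\<tau> \<in> upper_half_plane \<Longrightarrow> quarter_turn \<tau> = -1 / ((\<tau> + 1) / 2) + 1"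
  using uhp_add_1_nonzero[of \<tau>] by (simp add: quarter_turn_def divide_simps)

lemma Im_quarter_turn: "Im (quarter_turn \<tau>) = 2 * Im \<tau> / (cmod (\<tau> + 1))\<^sup>2"
  by (simp add: quarter_turn_def Im_divide cmod_power2 algebra_simps)

lemma quarter_turn_uhp: "\<tau> \<in> upper_half_plane \<Longrightarrow> quarter_turn \<tau> \<in> upper_half_plane"
  using uhp_add_1_nonzero[of \<tau>] by (simp add: upper_half_plane_def Im_quarter_turn)

lemma nome_add_2: "nome (\<tau> + 2) = nome \<tau>"
  using nome_add_1[of "\<tau> + 1"] nome_add_1[of \<tau>] by (simp add: add.assoc)

lemma psi_series_minus: "psi_series (- x) = psi_series x"
proof -
  have "(- x) ^ ((k + 1) * (k + 2)) = x ^ ((k + 1) * (k + 2))" for k :: nat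
    by (rule power_minus_even) simp
  then show ?thesis by (simp only: psi_series_def gap_series_def)
qed

lemma theta10_add_1_square:
  assumes "\<tau> \<in> upper_half_plane"
  shows "(theta10 (\<tau> + 1))\<^sup>2 = \<i> * (theta10 \<tau>)\<^sup>2"
proof -
  have "exp (pi * \<i> * (\<tau> + 1) / 4) = exp (pi * \<i> / 4) * exp (pi * \<i> * \<tau> / 4)"
    by (simp add: exp_add[symmetric] distrib_left add_divide_distrib add.commute)
  moreover have "theta10 (\<tau> + 1) = 2 * exp (pi * \<i> * (\<tau> + 1) / 4) * psi_series (nome (\<tau> + 1))"
    using uhp_add_of_real[of \<tau> 1] assms by (intro theta10_eq) simp
  ultimately have "theta10 (\<tau> + 1) = exp (pi * \<i> / 4) * theta10 \<tau>"
    unfolding theta10_eq[OF assms] nome_add_1 psi_series_minus by simp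
  moreover have "(exp (pi * \<i> / 4))\<^sup>2 = \<i>"
  proof -
    have "(exp (pi * \<i> / 4))\<^sup>2 = exp (\<i> * of_real (pi / 2))"
      by (simp add: exp_double[symmetric] mult.commute)
    also have "\<dots> = cis (pi / 2)" by (simp only: cis_conv_exp)
    finally show ?thesis by simp
  qed
  ultimately show ?thesis by (simp add: power_mult_distrib)
qed

lemma theta01_add_1:
  assumes "\<tau> \<in> upper_half_plane"
  shows "theta01 (\<tau> + 1) = theta00 \<tau>"
  using theta00_eq[OF assms] theta00_eq[of "\<tau> + 2"] uhp_add_of_real[of \<tau> 2] assms
  by (simp add: theta01_eq_theta00_shift nome_add_2 add.assoc)

text \<open>The four steps of the decomposition in turn: translation exchanges \<open>\<theta>[0,0]\<close> and \<open>\<theta>[0,1]\<close>, inversion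
  applies at \<open>\<rho>\<close>, and the doubling formulas lead from \<open>\<rho>\<close> back to \<open>2 \<rho> = \<tau> + 1\<close>.\<close>

lemma quarter_turn_theta:
  fixes \<tau> :: complex
  defines "\<rho> \<equiv> (\<tau> + 1) / 2"
  assumes \<tau>: "\<tau> \<in> upper_half_plane"
  shows "theta10 (quarter_turn \<tau>) ^ 4 = \<rho>\<^sup>2 * ((theta01 \<tau>)\<^sup>2 - \<i> * (theta10 \<tau>)\<^sup>2)\<^sup>2"
    and "theta01 (quarter_turn \<tau>) ^ 4 = - (\<rho>\<^sup>2 * ((theta01 \<tau>)\<^sup>2 + \<i> * (theta10 \<tau>)\<^sup>2)\<^sup>2)"
proof -
  have "\<tau> + 1 \<in> upper_half_plane" using uhp_add_of_real[of \<tau> 1] \<tau> by simp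
  then have \<rho>: "\<rho> \<in> upper_half_plane" using uhp_scale[of "1/2" "\<tau> + 1"] by (simp add: \<rho>_def)
  then have inv: "- 1 / \<rho> \<in> upper_half_plane" by (simp only: uhp_inversion)
  have \<rho>2: "2 * \<rho> = \<tau> + 1" by (simp add: \<rho>_def)
  have c4: "csqrt (- \<i> * \<rho>) ^ 4 = - \<rho>\<^sup>2"
  proof -
    have "z ^ 4 = (z\<^sup>2)\<^sup>2" for z :: complex by simp
    then have "csqrt (- \<i> * \<rho>) ^ 4 = ((csqrt (- \<i> * \<rho>))\<^sup>2)\<^sup>2" .
    also have "\<dots> = (- \<i> * \<rho>)\<^sup>2" by (simp only: power2_csqrt)
    finally show ?thesis by (simp add: power_mult_distrib)
  qed
  have th00: "(theta00 \<rho>)\<^sup>2 = (theta01 \<tau>)\<^sup>2 + \<i> * (theta10 \<tau>)\<^sup>2"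
    using theta00_square[OF \<rho>] by (simp only: \<rho>2 theta10_add_1_square[OF \<tau>] theta01_eq_theta00_shift)
  have th01: "(theta01 \<rho>)\<^sup>2 = (theta01 \<tau>)\<^sup>2 - \<i> * (theta10 \<tau>)\<^sup>2"
    using theta01_square[OF \<rho>] by (simp only: \<rho>2 theta10_add_1_square[OF \<tau>] theta01_eq_theta00_shift)
  have "theta10 (quarter_turn \<tau>) ^ 4 = ((theta10 (- 1 / \<rho> + 1))\<^sup>2)\<^sup>2"
    by (simp add: quarter_turn_eq[OF \<tau>] \<rho>_def)
  also have "\<dots> = - (theta10 (- 1 / \<rho>) ^ 4)"
    unfolding theta10_add_1_square[OF inv] by (simp add: power_mult_distrib)
  also have "\<dots> = \<rho>\<^sup>2 * theta01 \<rho> ^ 4"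
    unfolding theta10_inversion[OF \<rho>] power_mult_distrib c4 by simp
  also have "theta01 \<rho> ^ 4 = ((theta01 \<tau>)\<^sup>2 - \<i> * (theta10 \<tau>)\<^sup>2)\<^sup>2"
    unfolding th01[symmetric] by simp
  finally show "theta10 (quarter_turn \<tau>) ^ 4 = \<rho>\<^sup>2 * ((theta01 \<tau>)\<^sup>2 - \<i> * (theta10 \<tau>)\<^sup>2)\<^sup>2" .
  have "theta01 (quarter_turn \<tau>) ^ 4 = theta01 (- 1 / \<rho> + 1) ^ 4"
    by (simp add: quarter_turn_eq[OF \<tau>] \<rho>_def)
  also have "\<dots> = theta00 (- 1 / \<rho>) ^ 4" by (simp only: theta01_add_1[OF inv])
  also have "\<dots> = - (\<rho>\<^sup>2 * theta00 \<rho> ^ 4)"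
    unfolding theta00_inversion[OF \<rho>] power_mult_distrib c4 by simp
  also have "theta00 \<rho> ^ 4 = ((theta01 \<tau>)\<^sup>2 + \<i> * (theta10 \<tau>)\<^sup>2)\<^sup>2"
    unfolding th00[symmetric] by simp
  finally show "theta01 (quarter_turn \<tau>) ^ 4 = - (\<rho>\<^sup>2 * ((theta01 \<tau>)\<^sup>2 + \<i> * (theta10 \<tau>)\<^sup>2)\<^sup>2)" .
qed

lemma alpha_eq:
  assumes "\<tau> \<in> upper_half_plane"
  shows "alpha \<tau> = (theta10 \<tau> ^ 4)\<^sup>2 + 6 * theta10 \<tau> ^ 4 * theta01 \<tau> ^ 4 + (theta01 \<tau> ^ 4)\<^sup>2"
  using assms by (simp add: alpha_def on_uhp_def epsilon'_def delta'_def power2_eq_square algebra_simps)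

lemma beta_eq:
  assumes "\<tau> \<in> upper_half_plane"
  shows "beta \<tau> = (theta10 \<tau> ^ 4 - theta01 \<tau> ^ 4) ^ 4"
  using assms by (simp add: beta_def on_uhp_def delta'_def power_mult_distrib power_divide)

lemma alpha_quarter_turn:
  assumes "\<tau> \<in> upper_half_plane"
  shows "alpha (quarter_turn \<tau>) = - ((\<tau> + 1) ^ 4) / 4 * alpha \<tau>"
proof -
  define A B where "A = (theta01 \<tau>)\<^sup>2" and "B = (theta10 \<tau>)\<^sup>2"
  define \<rho> where "\<rho> = (\<tau> + 1) / 2"
  have X: "theta10 (quarter_turn \<tau>) ^ 4 = \<rho>\<^sup>2 * (A - \<i> * B)\<^sup>2"
    and Y: "theta01 (quarter_turn \<tau>) ^ 4 = - (\<rho>\<^sup>2 * (A + \<i> * B)\<^sup>2)"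
    using quarter_turn_theta[OF assms] by (simp_all only: A_def B_def \<rho>_def)
  have XY: "theta10 \<tau> ^ 4 = B\<^sup>2" "theta01 \<tau> ^ 4 = A\<^sup>2" by (simp_all add: A_def B_def)
  have "(A - \<i> * B)\<^sup>2 = A\<^sup>2 - B\<^sup>2 - 2 * \<i> * (A * B)" "(A + \<i> * B)\<^sup>2 = A\<^sup>2 - B\<^sup>2 + 2 * \<i> * (A * B)"
    by (simp_all add: power2_eq_square algebra_simps)
  then have "alpha (quarter_turn \<tau>) = - (4 * \<rho> ^ 4) * ((B\<^sup>2)\<^sup>2 + 6 * B\<^sup>2 * A\<^sup>2 + (A\<^sup>2)\<^sup>2)"
    unfolding alpha_eq[OF quarter_turn_uhp[OF assms]] X Y
    by (simp add: power2_eq_square power4_eq_xxxx algebra_simps)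
  also have "4 * \<rho> ^ 4 = (\<tau> + 1) ^ 4 / 4" by (simp add: \<rho>_def power_divide)
  finally show ?thesis by (simp add: alpha_eq[OF assms] XY)
qed

lemma beta_quarter_turn:
  assumes "\<tau> \<in> upper_half_plane"
  shows "beta (quarter_turn \<tau>) = (\<tau> + 1) ^ 8 / 16 * beta \<tau>"
proof -
  define A B where "A = (theta01 \<tau>)\<^sup>2" and "B = (theta10 \<tau>)\<^sup>2"
  define \<rho> where "\<rho> = (\<tau> + 1) / 2"
  have X: "theta10 (quarter_turn \<tau>) ^ 4 = \<rho>\<^sup>2 * (A - \<i> * B)\<^sup>2"
    and Y: "theta01 (quarter_turn \<tau>) ^ 4 = - (\<rho>\<^sup>2 * (A + \<i> * B)\<^sup>2)"
    using quarter_turn_theta[OF assms] by (simp_all only: A_def B_def \<rho>_def)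
  have XY: "theta10 \<tau> ^ 4 = B\<^sup>2" "theta01 \<tau> ^ 4 = A\<^sup>2" by (simp_all add: A_def B_def)
  have "\<rho>\<^sup>2 * (A - \<i> * B)\<^sup>2 - - (\<rho>\<^sup>2 * (A + \<i> * B)\<^sup>2) = - 2 * \<rho>\<^sup>2 * (B\<^sup>2 - A\<^sup>2)"
    by (simp add: power2_eq_square algebra_simps)
  then have "beta (quarter_turn \<tau>) = (- 2 * \<rho>\<^sup>2 * (B\<^sup>2 - A\<^sup>2)) ^ 4"
    unfolding beta_eq[OF quarter_turn_uhp[OF assms]] X Y by (simp only:)
  also have "\<dots> = 16 * \<rho> ^ 8 * (B\<^sup>2 - A\<^sup>2) ^ 4"
    by (simp add: power_mult_distrib)
  also have "16 * \<rho> ^ 8 = (\<tau> + 1) ^ 8 / 16" by (simp add: \<rho>_def power_divide)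
  finally show ?thesis by (simp add: beta_eq[OF assms] XY)
qed

definition theta10_fourth_series :: "complex \<Rightarrow> complex" where
  "theta10_fourth_series x = 16 * x * psi_series x ^ 4"

definition theta01_fourth_series :: "complex \<Rightarrow> complex" where
  "theta01_fourth_series x = theta_series (- x) ^ 4"

definition alpha_series :: "complex \<Rightarrow> complex" where
  "alpha_series x = (theta10_fourth_series x)\<^sup>2 + 6 * theta10_fourth_series x * theta01_fourth_series x
      + (theta01_fourth_series x)\<^sup>2"

definition beta_series :: "complex \<Rightarrow> complex" where
  "beta_series x = (theta10_fourth_series x - theta01_fourth_series x) ^ 4"

text \<open>The cofactor of \<open>x\<close> in the expansion of \<open>\<alpha>^2 - \<beta>\<close> at the cusp.\<close>

definition disc_unit :: "complex \<Rightarrow> complex" where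
  "disc_unit x = 256 * psi_series x ^ 4 * theta_series (- x) ^ 4 * theta_series x ^ 8"

lemma holomorphic_theta_series_minus: "(\<lambda>x. theta_series (- x)) holomorphic_on ball 0 1"
proof -
  have "(theta_series \<circ> uminus) holomorphic_on ball 0 1"
    by (intro holomorphic_on_compose_gen[OF _ holomorphic_theta_series] holomorphic_intros) auto
  then show ?thesis by (simp add: o_def)
qed

lemma holomorphic_fourth_series:
  "theta10_fourth_series holomorphic_on ball 0 1" "theta01_fourth_series holomorphic_on ball 0 1"
  unfolding theta10_fourth_series_def theta01_fourth_series_def
  by (intro holomorphic_intros holomorphic_psi_series holomorphic_theta_series_minus)+

lemma holomorphic_alpha_series: "alpha_series holomorphic_on ball 0 1"
  unfolding alpha_series_def by (intro holomorphic_intros holomorphic_fourth_series)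

lemma holomorphic_beta_series: "beta_series holomorphic_on ball 0 1"
  unfolding beta_series_def by (intro holomorphic_intros holomorphic_fourth_series)

lemma holomorphic_disc_unit: "disc_unit holomorphic_on ball 0 1"
  unfolding disc_unit_def
  by (intro holomorphic_intros holomorphic_psi_series holomorphic_theta_series holomorphic_theta_series_minus)

context
  fixes \<tau> :: complex
  assumes \<tau>: "\<tau> \<in> upper_half_plane"
begin

lemma theta10_fourth_eq: "theta10 \<tau> ^ 4 = theta10_fourth_series (nome \<tau>)"
proof -
  have "exp (pi * \<i> * \<tau> / 4) ^ 4 = nome \<tau>"
    unfolding nome_def exp_of_nat_mult[symmetric] by (rule arg_cong[of _ _ exp]) simp
  then show ?thesis
    by (simp add: theta10_eq[OF \<tau>] theta10_fourth_series_def power_mult_distrib)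
qed

lemma theta01_fourth_eq: "theta01 \<tau> ^ 4 = theta01_fourth_series (nome \<tau>)"
  by (simp add: theta01_eq[OF \<tau>] theta01_fourth_series_def)

lemma alpha_eq_series: "alpha \<tau> = alpha_series (nome \<tau>)"
  by (simp only: alpha_eq[OF \<tau>] theta10_fourth_eq theta01_fourth_eq alpha_series_def)

lemma beta_eq_series: "beta \<tau> = beta_series (nome \<tau>)"
  by (simp only: beta_eq[OF \<tau>] theta10_fourth_eq theta01_fourth_eq beta_series_def)

lemma discriminant_eq: "(alpha \<tau>)\<^sup>2 - beta \<tau> = nome \<tau> * disc_unit (nome \<tau>)"
proof -
  define A B where "A = theta10 \<tau> ^ 4" and "B = theta01 \<tau> ^ 4"
  have "theta_series (nome \<tau>) ^ 8 = (theta00 \<tau> ^ 4)\<^sup>2"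
    by (simp add: theta00_eq[OF \<tau>])
  also have "\<dots> = (A + B)\<^sup>2" by (simp add: jacobi_identity[OF \<tau>] A_def B_def add.commute)
  finally have Z: "theta_series (nome \<tau>) ^ 8 = (A + B)\<^sup>2" .
  have "(alpha \<tau>)\<^sup>2 - beta \<tau> = 16 * A * B * (A + B)\<^sup>2"
    unfolding alpha_eq[OF \<tau>] beta_eq[OF \<tau>] A_def[symmetric] B_def[symmetric]
    by (simp add: power2_eq_square power4_eq_xxxx algebra_simps)
  also have "\<dots> = nome \<tau> * disc_unit (nome \<tau>)"
    unfolding disc_unit_def Z unfolding A_def B_def theta10_fourth_eq theta01_fourth_eq
    by (simp add: theta10_fourth_series_def theta01_fourth_series_def mult_ac)
  finally show ?thesis .
qed

end

section \<open>A fundamental region and the zeros of the discriminant\<close>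

lemma even_translation:
  assumes "\<And>\<tau>. \<tau> \<in> upper_half_plane \<Longrightarrow> R (\<tau> + 2) = R \<tau>" and "\<tau> \<in> upper_half_plane"
  shows "R (\<tau> + of_int (2 * n)) = R \<tau>"
proof -
  have nat: "R (\<tau> + of_nat (2 * m)) = R \<tau>" if "\<tau> \<in> upper_half_plane" for m \<tau>
  proof (induction m)
    case (Suc m)
    have "\<tau> + of_nat (2 * m) \<in> upper_half_plane" using that uhp_add_of_real[of \<tau> "of_nat (2 * m)"] by simp
    from assms(1)[OF this] Suc show ?case by (simp add: algebra_simps)
  qed simp
  show ?thesis
  proof (cases "n \<ge> 0")
    case True
    then show ?thesis using nat[OF assms(2), of "nat n"] by simp
  next
    case False
    have "\<tau> + of_int (2 * n) \<in> upper_half_plane" using assms(2) uhp_add_of_real[of \<tau> "of_int (2 * n)"] by simp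
    from nat[OF this, of "nat (- n)"] show ?thesis using False by simp
  qed
qed

text \<open>A property that is invariant under the two generating maps holds everywhere if it holds where
  \<open>Im \<tau> \<ge> 1/2\<close>. Indeed, a translation makes \<open>\<bar>Re \<tau>\<bar> \<le> 1\<close>. If then \<open>Im \<tau> < 1/2\<close>, the turn or its inverse,
  according to the sign of \<open>Re \<tau>\<close>, multiplies \<open>Im \<tau>\<close> by \<open>2 / \<bar>\<tau> \<plusminus> 1\<bar>^2 \<ge> 8/5\<close>, so finitely many steps suffice.\<close>

lemma upper_half_plane_reduction:
  assumes \<tau>: "\<tau> \<in> upper_half_plane"
    and trans: "\<And>\<tau>. \<tau> \<in> upper_half_plane \<Longrightarrow> R (\<tau> + 2) \<longleftrightarrow> R \<tau>"
    and turn: "\<And>\<tau>. \<tau> \<in> upper_half_plane \<Longrightarrow> R (quarter_turn \<tau>) \<longleftrightarrow> R \<tau>"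
    and base: "\<And>\<tau>. Im \<tau> \<ge> 1 / 2 \<Longrightarrow> R \<tau>"
  shows "R \<tau>"
proof -
  have "R \<tau>" if "Im \<tau> \<ge> 1 / 2 * (5 / 8) ^ n" for n \<tau>
    using that
  proof (induction n arbitrary: \<tau>)
    case 0
    then show ?case using base by simp
  next
    case (Suc n)
    have Im0: "Im \<tau> > 0" using Suc.prems by (rule less_le_trans[rotated]) simp
    then have \<tau>: "\<tau> \<in> upper_half_plane" by (simp add: upper_half_plane_def)
    define \<sigma> where "\<sigma> = \<tau> + of_int (2 * (- round (Re \<tau> / 2)))"
    have \<sigma>: "\<sigma> \<in> upper_half_plane"
      unfolding \<sigma>_def using \<tau> uhp_add_of_real[of \<tau> "of_int (2 * (- round (Re \<tau> / 2)))"] by simp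
    have Im\<sigma>: "Im \<sigma> = Im \<tau>" by (simp add: \<sigma>_def)
    have "Re \<sigma> = Re \<tau> - 2 * of_int (round (Re \<tau> / 2))" by (simp add: \<sigma>_def)
    then have Re\<sigma>: "\<bar>Re \<sigma>\<bar> \<le> 1"
      using of_int_round_abs_le[of "Re \<tau> / 2"] unfolding abs_le_iff by linarith
    have "R \<sigma>"
    proof (cases "Im \<sigma> \<ge> 1 / 2")
      case True
      then show ?thesis by (rule base)
    next
      case False
      \<comment> \<open>Applied with \<open>z = \<sigma> + 1\<close> or \<open>z = 1 - \<sigma>\<close>, whose squared modulus is at most \<open>1 + 1/4\<close>.\<close>
      have grow: "1 / 2 * (5 / 8) ^ n \<le> 2 * Im \<sigma> / (cmod z)\<^sup>2" if "\<bar>Re z\<bar> \<le> 1" "Im z = Im \<sigma> \<or> Im z = - Im \<sigma>" for z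
      proof -
        have z0: "(cmod z)\<^sup>2 > 0" using that Im0 Im\<sigma> by (auto simp: complex_eq_iff)
        have "(Re z)\<^sup>2 \<le> 1" using that by (simp add: abs_square_le_1)
        moreover have "(Im z)\<^sup>2 \<le> (1 / 2)\<^sup>2"
          using that False Im0 Im\<sigma> by (intro power2_le_iff_abs_le[THEN iffD2]) auto
        moreover have "(1 / 2)\<^sup>2 = (1 / 4 :: real)" by (simp add: power2_eq_square)
        ultimately have "(cmod z)\<^sup>2 \<le> 5 / 4" unfolding cmod_power2 by linarith
        have "1 / 2 * (5 / 8) ^ n \<le> 2 * Im \<sigma> / (5 / 4)" using Suc.prems by (simp add: Im\<sigma>)
        also have "\<dots> \<le> 2 * Im \<sigma> / (cmod z)\<^sup>2"
          using \<open>(cmod z)\<^sup>2 \<le> 5 / 4\<close> z0 Im0 Im\<sigma> by (intro divide_left_mono) auto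
        finally show ?thesis .
      qed
      show ?thesis
      proof (cases "Re \<sigma> \<le> 0")
        case True
        then have "R (quarter_turn \<sigma>)"
          using Re\<sigma> grow[of "\<sigma> + 1"] by (intro Suc.IH) (simp add: Im_quarter_turn)
        then show ?thesis using turn[OF \<sigma>] by simp
      next
        case False
        define \<omega> where "\<omega> = (1 + \<sigma>) / (1 - \<sigma>)"
        have "1 - \<sigma> \<noteq> 0" using \<sigma> by (auto simp: upper_half_plane_def complex_eq_iff)
        then have turn_\<omega>: "quarter_turn \<omega> = \<sigma>"
          by (simp add: quarter_turn_def \<omega>_def divide_simps)
        have Im\<omega>: "Im \<omega> = 2 * Im \<sigma> / (cmod (1 - \<sigma>))\<^sup>2"
          by (simp add: \<omega>_def Im_divide cmod_power2 algebra_simps)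
        have "R \<omega>" using False Re\<sigma> grow[of "1 - \<sigma>"] by (intro Suc.IH) (simp add: Im\<omega>)
        moreover have "\<omega> \<in> upper_half_plane"
          using \<open>1 - \<sigma> \<noteq> 0\<close> Im0 Im\<sigma> by (simp add: upper_half_plane_def Im\<omega>)
        ultimately show ?thesis using turn[of \<omega>] turn_\<omega> by simp
      qed
    qed
    then show ?case using even_translation[of R, OF trans \<tau>] unfolding \<sigma>_def by blast
  qed
  moreover obtain n where "(5 / 8) ^ n < 2 * Im \<tau>"
    using \<tau> real_arch_pow_inv[of "2 * Im \<tau>" "5/8"] by (auto simp: upper_half_plane_def)
  then have "Im \<tau> \<ge> 1 / 2 * (5 / 8) ^ n" by simp
  ultimately show ?thesis by blast
qed

text \<open>The numerical input is \<open>exp (\<pi> / 2) > 3\<close>.\<close>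

lemma norm_nome_less_third:
  assumes "Im \<tau> \<ge> 1 / 2"
  shows "norm (nome \<tau>) < 1 / 3"
proof -
  have "(3::real) < 1 + 3 / 2 + (3 / 2)\<^sup>2 / 2" by (simp add: power2_eq_square)
  also have "\<dots> \<le> exp (3 / 2)" by (rule exp_lower_Taylor_quadratic) simp
  also have "\<dots> \<le> exp (pi * Im \<tau>)"
  proof -
    have "3 * (1 / 2) \<le> pi * Im \<tau>" using assms pi_gt3 by (intro mult_mono) auto
    then show ?thesis by simp
  qed
  finally have "exp (- (pi * Im \<tau>)) < inverse 3"
    unfolding exp_minus by (intro less_imp_inverse_less) auto
  then show ?thesis by (simp add: norm_nome)
qed

text \<open>At the cusp the value is explicit. Elsewhere \<open>\<alpha>^2 - \<beta>\<close> may be moved into the region \<open>Im \<tau> \<ge> 1/2\<close>, where all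
  three theta series differ from their constant terms by less than these.\<close>

lemma disc_unit_nonzero:
  assumes "norm x < 1"
  shows "disc_unit x \<noteq> 0"
proof (cases "x = 0")
  case False
  from nome_preimage[OF assms this] obtain \<tau> where \<tau>: "\<tau> \<in> upper_half_plane" "nome \<tau> = x" .
  define \<Delta> where "\<Delta> = (\<lambda>\<tau>. (alpha \<tau>)\<^sup>2 - beta \<tau>)"
  have \<Delta>: "\<Delta> \<tau> = nome \<tau> * disc_unit (nome \<tau>)" if "\<tau> \<in> upper_half_plane" for \<tau>
    unfolding \<Delta>_def by (rule discriminant_eq[OF that])
  have "\<Delta> \<tau> \<noteq> 0"
  proof (rule upper_half_plane_reduction[OF \<tau>(1)])
    fix \<tau> assume "\<tau> \<in> upper_half_plane"
    then show "\<Delta> (\<tau> + 2) \<noteq> 0 \<longleftrightarrow> \<Delta> \<tau> \<noteq> 0"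
      using uhp_add_of_real[of \<tau> 2] by (simp add: \<Delta> nome_add_2)
  next
    fix \<tau> assume \<tau>: "\<tau> \<in> upper_half_plane"
    have "\<Delta> (quarter_turn \<tau>) = (\<tau> + 1) ^ 8 / 16 * \<Delta> \<tau>"
      unfolding \<Delta>_def alpha_quarter_turn[OF \<tau>] beta_quarter_turn[OF \<tau>]
      by (simp add: power_mult_distrib power_divide right_diff_distrib)
    moreover have "(\<tau> + 1) ^ 8 / 16 \<noteq> 0" using uhp_add_1_nonzero[OF \<tau>] by simp
    ultimately show "\<Delta> (quarter_turn \<tau>) \<noteq> 0 \<longleftrightarrow> \<Delta> \<tau> \<noteq> 0" by (metis mult_eq_0_iff)
  next
    fix \<tau> :: complex assume Im: "Im \<tau> \<ge> 1 / 2"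
    then have "\<tau> \<in> upper_half_plane" by (simp add: upper_half_plane_def)
    then show "\<Delta> \<tau> \<noteq> 0"
      using norm_nome_less_third[OF Im] theta_series_nonzero[of "nome \<tau>"]
        theta_series_nonzero[of "- nome \<tau>"] psi_series_nonzero[of "nome \<tau>"]
      by (simp add: \<Delta> disc_unit_def)
  qed
  then show ?thesis using \<tau> by (simp add: \<Delta>)
qed (simp add: disc_unit_def)

section \<open>The Cayley transform of the unitary group\<close>

definition mat2 :: "complex \<Rightarrow> complex \<Rightarrow> complex \<Rightarrow> complex \<Rightarrow> complex^2^2" where
  "mat2 a b c d = vector [vector [a, b], vector [c, d]]"

lemma mat2_nth [simp]:
  "mat2 a b c d $ 1 $ 1 = a" "mat2 a b c d $ 1 $ 2 = b"
  "mat2 a b c d $ 2 $ 1 = c" "mat2 a b c d $ 2 $ 2 = d"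
  by (simp_all add: mat2_def)

lemma mat2_eqI:
  "g $ 1 $ 1 = a \<Longrightarrow> g $ 1 $ 2 = b \<Longrightarrow> g $ 2 $ 1 = c \<Longrightarrow> g $ 2 $ 2 = d \<Longrightarrow> g = mat2 a b c d"
  by (simp add: vec_eq_iff forall_2)

lemma matrix_mult_nth_2: "(A ** B) $ i $ j = A $ i $ 1 * B $ 1 $ j + A $ i $ 2 * B $ 2 $ j"
  for A B :: "complex^2^2"
  by (simp add: matrix_matrix_mult_def sum_2)

lemma mat2_mult:
  "mat2 a b c d ** mat2 a' b' c' d' =
     mat2 (a * a' + b * c') (a * b' + b * d') (c * a' + d * c') (c * b' + d * d')"
  by (rule mat2_eqI) (simp_all add: matrix_mult_nth_2)

lemma mat_1_eq_mat2: "mat 1 = mat2 1 0 0 1"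
  by (rule mat2_eqI) (simp_all add: mat_def)

definition g0_inv :: "complex^2^2" where
  "g0_inv = mat2 (1 / sqrt 2) (- \<i> / sqrt 2) (- \<i> / sqrt 2) (1 / sqrt 2)"

lemma g0_eq_mat2: "g0 = mat2 (1 / sqrt 2) (\<i> / sqrt 2) (\<i> / sqrt 2) (1 / sqrt 2)"
  by (rule mat2_eqI) (simp_all add: g0_def scaleR_conv_of_real[where x = "_ :: complex"])

lemma half_from_sqrt2: "1 / complex_of_real (sqrt 2) * (1 / complex_of_real (sqrt 2)) = 1 / 2"
  by (simp add: of_real_mult[symmetric])

lemma g0_inverse: "g0 ** g0_inv = mat 1" "g0_inv ** g0 = mat 1"
  using half_from_sqrt2
  by (auto simp: g0_eq_mat2 g0_inv_def mat2_mult mat_1_eq_mat2 intro!: mat2_eqI)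

lemma matrix_inv_g0: "matrix_inv g0 = g0_inv"
proof -
  have "matrix_inv g0 ** g0 = mat 1"
    unfolding matrix_inv_def using someI_ex[of "\<lambda>A. g0 ** A = mat 1 \<and> A ** g0 = mat 1"] g0_inverse by blast
  have "matrix_inv g0 = matrix_inv g0 ** (g0 ** g0_inv)" by (simp add: g0_inverse)
  also have "\<dots> = g0_inv" by (simp add: matrix_mul_assoc \<open>matrix_inv g0 ** g0 = mat 1\<close>)
  finally show ?thesis .
qed

definition cayley :: "complex^2^2 \<Rightarrow> complex^2^2" where
  "cayley u = g0 ** u ** g0_inv"

lemma cayley_U11_eq: "cayley_U11 = cayley ` U11"
  by (simp add: cayley_U11_def cayley_def[abs_def] matrix_inv_g0)

lemma cayley_mult: "cayley (u ** v) = cayley u ** cayley v"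
proof -
  have "cayley u ** cayley v = g0 ** u ** (g0_inv ** g0) ** v ** g0_inv"
    by (simp only: cayley_def matrix_mul_assoc)
  then show ?thesis by (simp add: g0_inverse cayley_def matrix_mul_assoc)
qed

lemma cayley_mat2:
  "cayley (mat2 a b c d) = mat2 ((a + d + \<i> * (c - b)) / 2) ((b + c + \<i> * (d - a)) / 2)
     ((b + c + \<i> * (a - d)) / 2) ((a + d + \<i> * (b - c)) / 2)"
proof -
  define s where "s = 1 / complex_of_real (sqrt 2)"
  have s: "s * (s * z) = z / 2" for z
    using half_from_sqrt2 by (simp add: s_def mult.assoc[symmetric])
  have g: "g0 = mat2 s (s * \<i>) (s * \<i>) s" "g0_inv = mat2 s (s * - \<i>) (s * - \<i>) s"
    by (simp_all add: g0_eq_mat2 g0_inv_def s_def)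
  have "cayley (mat2 a b c d) = mat2 (s * (s * (a + d + \<i> * (c - b)))) (s * (s * (b + c + \<i> * (d - a))))
     (s * (s * (b + c + \<i> * (a - d)))) (s * (s * (a + d + \<i> * (b - c))))"
    unfolding cayley_def g mat2_mult by (intro mat2_eqI) (simp_all add: algebra_simps)
  then show ?thesis by (simp only: s)
qed

lemma gaussian_unit_cases:
  assumes "e \<in> gaussian_ints" "cnj e * e = 1"
  obtains j :: nat where "e = \<i> ^ j"
proof -
  obtain x y :: int where xy: "Re e = of_int x" "Im e = of_int y"
    using assms(1) by (auto simp: gaussian_ints_def elim!: Ints_cases)
  have "(Re e)\<^sup>2 + (Im e)\<^sup>2 = 1"
    using assms(2) by (simp add: complex_eq_iff power2_eq_square)
  then have "real_of_int (x\<^sup>2 + y\<^sup>2) = of_int 1" using xy by simp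
  then have sq: "x\<^sup>2 + y\<^sup>2 = 1" by (simp only: of_int_eq_iff)
  then have "x\<^sup>2 \<le> 1" "y\<^sup>2 \<le> 1" using zero_le_power2[of x] zero_le_power2[of y] by linarith+
  then have "\<bar>x\<bar> \<le> 1" "\<bar>y\<bar> \<le> 1" by (simp_all add: abs_square_le_1)
  then have "x = -1 \<or> x = 0 \<or> x = 1" "y = -1 \<or> y = 0 \<or> y = 1" by linarith+
  with sq xy have "e = 1 \<or> e = \<i> \<or> e = -1 \<or> e = -\<i>"
    by (auto simp: complex_eq_iff)
  then have "e = \<i> ^ 0 \<or> e = \<i> ^ 1 \<or> e = \<i> ^ 2 \<or> e = \<i> ^ 3" by (simp add: power3_eq_cube)
  then show ?thesis using that by blast
qed

lemma gaussian_ints_closed: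
  "x \<in> gaussian_ints \<Longrightarrow> y \<in> gaussian_ints \<Longrightarrow> x * y \<in> gaussian_ints"
  "x \<in> gaussian_ints \<Longrightarrow> y \<in> gaussian_ints \<Longrightarrow> x - y \<in> gaussian_ints"
  by (auto simp: gaussian_ints_def)

text \<open>The hermitian relations say that \<open>cnj a * e = d\<close> and \<open>cnj b * e = c\<close> for the determinant \<open>e\<close>, and that \<open>e\<close>
  has absolute value 1; being a Gaussian integer, it is a power of \<open>\<i>\<close>.\<close>

lemma U11_shape:
  assumes "u \<in> U11"
  obtains a b j where "a \<in> gaussian_ints" "b \<in> gaussian_ints" "a * cnj a - b * cnj b = 1"
    "u = mat2 a b (\<i> ^ j * cnj b) (\<i> ^ j * cnj a)"
proof -
  define a b c d where "a = u $ 1 $ 1" and "b = u $ 1 $ 2" and "c = u $ 2 $ 1" and "d = u $ 2 $ 2"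
  have u: "u = mat2 a b c d" by (rule mat2_eqI) (simp_all add: a_def b_def c_def d_def)
  have int: "a \<in> gaussian_ints" "b \<in> gaussian_ints" "c \<in> gaussian_ints" "d \<in> gaussian_ints"
    using assms by (auto simp: U11_def a_def b_def c_def d_def)
  have U: "conj_transpose u ** H_form ** u = H_form" using assms by (simp add: U11_def)
  have ct: "conj_transpose u = mat2 (cnj a) (cnj c) (cnj b) (cnj d)"
    by (rule mat2_eqI) (simp_all add: conj_transpose_def a_def b_def c_def d_def)
  have hf: "H_form = mat2 1 0 0 (-1)"
    by (simp add: H_form_def mat2_def)
  have "mat2 (cnj a * a - cnj c * c) (cnj a * b - cnj c * d) (cnj b * a - cnj d * c) (cnj b * b - cnj d * d)
      = mat2 1 0 0 (-1)"
    using U unfolding ct unfolding hf unfolding u mat2_mult by simp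
  then have P: "cnj a * a - cnj c * c = 1" and R: "cnj a * b = cnj c * d"
    and R': "cnj b * a = cnj d * c" and Q: "cnj d * d - cnj b * b = 1"
    by (simp_all add: vec_eq_iff forall_2 algebra_simps)
  define e where "e = a * d - b * c"
  have "e * cnj a = d * (cnj a * a) - c * (cnj a * b)" by (simp add: e_def algebra_simps)
  also have "\<dots> = d * (cnj a * a - cnj c * c)" unfolding R by (simp add: algebra_simps)
  finally have d: "d = e * cnj a" by (simp add: P)
  have "e * cnj b = d * (cnj b * a) - c * (cnj b * b)" by (simp add: e_def algebra_simps)
  also have "\<dots> = c * (cnj d * d - cnj b * b)" unfolding R' by (simp add: algebra_simps)
  finally have c: "c = e * cnj b" by (simp add: Q)
  \<comment> \<open>Minus the Gram determinant of the two columns for the hermitian form.\<close>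
  have "cnj e * e = (cnj a * a - cnj c * c) * (cnj d * d - cnj b * b) +
      (cnj a * b - cnj c * d) * (cnj b * a - cnj d * c)"
    by (simp add: e_def algebra_simps)
  then have unit: "cnj e * e = 1" by (simp add: P Q R R')
  moreover have "e \<in> gaussian_ints" unfolding e_def by (intro gaussian_ints_closed int)
  ultimately obtain j where j: "e = \<i> ^ j" using gaussian_unit_cases by blast
  have "a * cnj a - b * cnj b = cnj a * a - (cnj e * e) * (cnj b * b)"
    unfolding unit by (simp add: mult.commute)
  also have "\<dots> = cnj a * a - cnj c * c" by (simp add: c)
  finally have "a * cnj a - b * cnj b = 1" by (simp add: P)
  with int j u c d that show ?thesis by metis
qed

definition transforms :: "int \<Rightarrow> (complex \<Rightarrow> complex) \<Rightarrow> complex^2^2 \<Rightarrow> bool" where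
  "transforms k f g \<longleftrightarrow> (\<forall>\<tau>\<in>upper_half_plane.
     f (frac_lin g \<tau>) = (g$2$1 * \<tau> + g$2$2) powi k * f \<tau>)"

definition acts_on_uhp :: "complex^2^2 \<Rightarrow> bool" where
  "acts_on_uhp g \<longleftrightarrow> (\<forall>\<tau>\<in>upper_half_plane.
     g$2$1 * \<tau> + g$2$2 \<noteq> 0 \<and> frac_lin g \<tau> \<in> upper_half_plane)"

lemma frac_lin_mult:
  assumes "h$2$1 * \<tau> + h$2$2 \<noteq> 0"
  shows "frac_lin (g ** h) \<tau> = frac_lin g (frac_lin h \<tau>)"
    and "(g ** h)$2$1 * \<tau> + (g ** h)$2$2 = (g$2$1 * frac_lin h \<tau> + g$2$2) * (h$2$1 * \<tau> + h$2$2)"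
proof -
  define z where "z = h$2$1 * \<tau> + h$2$2"
  define n where "n = h$1$1 * \<tau> + h$1$2"
  have z: "z \<noteq> 0" using assms by (simp add: z_def)
  have fl: "frac_lin h \<tau> = n / z" by (simp add: frac_lin_def n_def z_def)
  have row: "(g ** h)$i$1 * \<tau> + (g ** h)$i$2 = g$i$1 * n + g$i$2 * z" for i
    by (simp add: matrix_mult_nth_2 n_def z_def algebra_simps)
  have row': "g$i$1 * n + g$i$2 * z = (g$i$1 * (n / z) + g$i$2) * z" for i
    using z by (simp add: distrib_right)
  show "(g ** h)$2$1 * \<tau> + (g ** h)$2$2 = (g$2$1 * frac_lin h \<tau> + g$2$2) * (h$2$1 * \<tau> + h$2$2)"
    unfolding row row' fl z_def[symmetric] ..
  show "frac_lin (g ** h) \<tau> = frac_lin g (frac_lin h \<tau>)"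
    unfolding frac_lin_def[of "g ** h"] row row' fl using z by (simp add: frac_lin_def[of g])
qed

lemma transforms_mult:
  assumes "transforms k f g" "transforms k f h" "acts_on_uhp h"
  shows "transforms k f (g ** h)"
  unfolding transforms_def
proof
  fix \<tau> assume \<tau>: "\<tau> \<in> upper_half_plane"
  have h: "h$2$1 * \<tau> + h$2$2 \<noteq> 0" "frac_lin h \<tau> \<in> upper_half_plane"
    using assms(3) \<tau> by (auto simp: acts_on_uhp_def)
  show "f (frac_lin (g ** h) \<tau>) = ((g ** h)$2$1 * \<tau> + (g ** h)$2$2) powi k * f \<tau>"
    unfolding frac_lin_mult[OF h(1)]
    using assms(1,2) \<tau> h by (simp add: transforms_def power_int_mult_distrib)
qed

lemma acts_on_uhp_mult:
  assumes "acts_on_uhp g" "acts_on_uhp h"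
  shows "acts_on_uhp (g ** h)"
  using assms by (auto simp: acts_on_uhp_def frac_lin_mult)

lemma nonzero_denominator:
  assumes "\<tau> \<in> upper_half_plane" "c \<noteq> 0 \<or> d \<noteq> 0"
  shows "of_int c * \<tau> + of_int d \<noteq> 0"
  using assms by (auto simp: upper_half_plane_def complex_eq_iff)

lemma acts_on_uhp_unimodular:
  fixes a b c d :: int
  assumes "a * d - b * c = 1"
  shows "acts_on_uhp (mat2 (of_int a) (of_int b) (of_int c) (of_int d))"
  unfolding acts_on_uhp_def
proof (intro ballI conjI)
  fix \<tau> assume \<tau>: "\<tau> \<in> upper_half_plane"
  have nz: "of_int c * \<tau> + of_int d \<noteq> 0" using assms \<tau> by (intro nonzero_denominator) auto
  then show "mat2 (of_int a) (of_int b) (of_int c) (of_int d) $ 2 $ 1 * \<tau>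
     + mat2 (of_int a) (of_int b) (of_int c) (of_int d) $ 2 $ 2 \<noteq> 0" by simp
  have "Im ((of_int a * \<tau> + of_int b) / (of_int c * \<tau> + of_int d)) =
     of_int (a * d - b * c) * Im \<tau> / (cmod (of_int c * \<tau> + of_int d))\<^sup>2"
    by (simp add: Im_divide cmod_power2 algebra_simps)
  then show "frac_lin (mat2 (of_int a) (of_int b) (of_int c) (of_int d)) \<tau> \<in> upper_half_plane"
    using \<tau> nz by (simp add: frac_lin_def assms upper_half_plane_def)
qed

lemma cayley_quarter_turn:
  "frac_lin (cayley (mat2 1 0 0 \<i>)) \<tau> = quarter_turn \<tau>"
  "cayley (mat2 1 0 0 \<i>) $ 2 $ 1 * \<tau> + cayley (mat2 1 0 0 \<i>) $ 2 $ 2 = (1 + \<i>) / 2 * (\<tau> + 1)"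
proof -
  define s where "s = (1 + \<i>) / 2"
  have "1 + \<i> \<noteq> 0" by (simp add: complex_eq_iff)
  then have s: "s \<noteq> 0" by (simp add: s_def)
  have cay: "cayley (mat2 1 0 0 \<i>) = mat2 s (- s) s s"
    unfolding cayley_mat2 by (rule mat2_eqI) (simp_all add: s_def complex_eq_iff)
  have "frac_lin (cayley (mat2 1 0 0 \<i>)) \<tau> = (s * (\<tau> - 1)) / (s * (\<tau> + 1))"
    unfolding cay frac_lin_def by (simp add: algebra_simps)
  also have "\<dots> = quarter_turn \<tau>" using s by (simp add: quarter_turn_def)
  finally show "frac_lin (cayley (mat2 1 0 0 \<i>)) \<tau> = quarter_turn \<tau>" .
  show "cayley (mat2 1 0 0 \<i>) $ 2 $ 1 * \<tau> + cayley (mat2 1 0 0 \<i>) $ 2 $ 2 = (1 + \<i>) / 2 * (\<tau> + 1)"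
    by (simp add: cay s_def distrib_left)
qed

lemma acts_on_uhp_quarter_turn: "acts_on_uhp (cayley (mat2 1 0 0 \<i>))"
proof -
  have "1 + \<i> \<noteq> 0" by (simp add: complex_eq_iff)
  then show ?thesis
    unfolding acts_on_uhp_def cayley_quarter_turn
    using quarter_turn_uhp uhp_add_1_nonzero by simp
qed

text \<open>A power of \<open>diag (1, \<i>)\<close> reduces an element of \<open>U(1,1;\<int>[\<i>])\<close> to determinant 1. The Cayley transform
  takes \<open>diag (1, \<i>)\<close> to the quarter turn and the matrices of determinant 1 to integral matrices of
  determinant 1 with \<open>a \<equiv> d\<close> and \<open>b \<equiv> c\<close> modulo 2, which form the theta group.\<close>

lemma cayley_U11_induct [consumes 1, case_names theta_group turn]:
  assumes "g \<in> cayley_U11"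
    and theta_group: "\<And>a b c d :: int. a * d - b * c = 1 \<Longrightarrow> even (a - d) \<Longrightarrow> even (b - c) \<Longrightarrow>
           P (mat2 (of_int a) (of_int b) (of_int c) (of_int d))"
    and turn: "\<And>h. P h \<Longrightarrow> P (cayley (mat2 1 0 0 \<i>) ** h)"
  shows "P g"
proof -
  obtain u where u: "u \<in> U11" "g = cayley u" using assms by (auto simp: cayley_U11_eq)
  from U11_shape[OF u(1)] obtain a b j where
    ab: "a \<in> gaussian_ints" "b \<in> gaussian_ints" "a * cnj a - b * cnj b = 1"
      "u = mat2 a b (\<i> ^ j * cnj b) (\<i> ^ j * cnj a)" .
  obtain x y where a: "Re a = of_int x" "Im a = of_int y"
    using ab(1) by (auto simp: gaussian_ints_def elim!: Ints_cases)
  obtain s t where b: "Re b = of_int s" "Im b = of_int t"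
    using ab(2) by (auto simp: gaussian_ints_def elim!: Ints_cases)
  have cay: "cayley (mat2 a b (cnj b) (cnj a)) =
      mat2 (of_int (x + t)) (of_int (s + y)) (of_int (s - y)) (of_int (x - t))"
    unfolding cayley_mat2 by (rule mat2_eqI) (simp_all add: complex_eq_iff a b)
  have "real_of_int ((x + t) * (x - t) - (s + y) * (s - y)) = Re (a * cnj a - b * cnj b)"
    by (simp add: a b algebra_simps)
  then have det: "(x + t) * (x - t) - (s + y) * (s - y) = 1"
    unfolding ab(3) one_complex.sel by (metis of_int_1 of_int_eq_iff)
  have base: "P (cayley (mat2 a b (cnj b) (cnj a)))"
    unfolding cay by (rule theta_group[OF det]) auto
  have "P (cayley (mat2 a b (\<i> ^ j * cnj b) (\<i> ^ j * cnj a)))" for j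
  proof (induction j)
    case (Suc j)
    have "mat2 a b (\<i> ^ Suc j * cnj b) (\<i> ^ Suc j * cnj a) = mat2 1 0 0 \<i> ** mat2 a b (\<i> ^ j * cnj b) (\<i> ^ j * cnj a)"
      unfolding mat2_mult by (simp add: mult.assoc)
    then show ?case using turn[OF Suc] by (simp add: cayley_mult)
  qed (use base in simp)
  then show ?thesis using u ab by blast
qed

lemma acts_on_uhp_cayley_U11: "g \<in> cayley_U11 \<Longrightarrow> acts_on_uhp g"
  by (induction rule: cayley_U11_induct)
     (auto intro: acts_on_uhp_unimodular acts_on_uhp_mult acts_on_uhp_quarter_turn)

context
  fixes f :: "complex \<Rightarrow> complex" and k :: nat
  assumes period: "\<And>\<tau>. \<tau> \<in> upper_half_plane \<Longrightarrow> f (\<tau> + 2) = f \<tau>"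
    and turn: "\<And>\<tau>. \<tau> \<in> upper_half_plane \<Longrightarrow> f (quarter_turn \<tau>) = ((1 + \<i>) / 2 * (\<tau> + 1)) ^ k * f \<tau>"
    and k: "4 dvd k"
begin

lemma even_integer_period:
  "\<tau> \<in> upper_half_plane \<Longrightarrow> f (\<tau> + of_int (2 * n)) = f \<tau>"
  by (rule even_translation[of f, OF period])

text \<open>Two quarter turns make a half turn; the constants multiply to \<open>\<i>^k = 1\<close>.\<close>

lemma inversion_law:
  assumes \<tau>: "\<tau> \<in> upper_half_plane"
  shows "f (- 1 / \<tau>) = \<tau> ^ k * f \<tau>"
proof -
  have nz: "\<tau> + 1 \<noteq> 0" "\<tau> \<noteq> 0" using uhp_add_1_nonzero[OF \<tau>] uhp_nonzero[OF \<tau>] by auto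
  have q1: "quarter_turn \<tau> + 1 = 2 * \<tau> / (\<tau> + 1)" using nz by (simp add: quarter_turn_def divide_simps)
  have q2: "quarter_turn \<tau> - 1 = - 2 / (\<tau> + 1)" using nz by (simp add: quarter_turn_def divide_simps)
  have "quarter_turn (quarter_turn \<tau>) = - 1 / \<tau>"
  proof -
    have "- 2 / x / (2 * \<tau> / x) = - 1 / \<tau>" if "x \<noteq> 0" for x using that by simp
    from this[OF nz(1)] show ?thesis unfolding quarter_turn_def[of "quarter_turn \<tau>"] q1 q2 .
  qed
  then have "f (- 1 / \<tau>) = ((1 + \<i>) / 2 * (2 * \<tau> / (\<tau> + 1))) ^ k * (((1 + \<i>) / 2 * (\<tau> + 1)) ^ k * f \<tau>)"
    using turn[OF quarter_turn_uhp[OF \<tau>]] turn[OF \<tau>] q1 by simp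
  also have "\<dots> = ((1 + \<i>) / 2 * (2 * \<tau> / (\<tau> + 1)) * ((1 + \<i>) / 2 * (\<tau> + 1))) ^ k * f \<tau>"
    by (simp only: power_mult_distrib mult.assoc)
  also have "(1 + \<i>) / 2 * (2 * \<tau> / (\<tau> + 1)) * ((1 + \<i>) / 2 * (\<tau> + 1)) = \<i> * \<tau>"
  proof -
    have "(1 + \<i>) / 2 * (2 * \<tau> / (\<tau> + 1)) * ((1 + \<i>) / 2 * (\<tau> + 1)) = (1 + \<i>)\<^sup>2 / 2 * \<tau>"
      using nz by (simp add: power2_eq_square)
    also have "(1 + \<i>)\<^sup>2 = 2 * \<i>" by (simp add: power2_eq_square algebra_simps)
    finally show ?thesis by simp
  qed
  also have "(\<i> * \<tau>) ^ k = \<tau> ^ k"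
  proof -
    obtain m where "k = 4 * m" using k by blast
    then have "\<i> ^ k = 1" by (simp add: power_mult)
    then show ?thesis by (simp add: power_mult_distrib)
  qed
  finally show ?thesis .
qed

lemma even_weight: "even k"
  using k by (metis dvd_trans even_numeral)

text \<open>Euclidean descent on the bottom row \<open>(c, d)\<close>. If \<open>\<bar>c\<bar> < \<bar>d\<bar>\<close>, a translation by \<open>\<plusminus>2\<close> replaces \<open>d\<close> by
  \<open>d \<plusminus> 2 c\<close> of smaller absolute value; if \<open>\<bar>d\<bar> < \<bar>c\<bar>\<close>, the inversion exchanges the two. Equality is
  excluded since \<open>c + d\<close> is odd, and for \<open>c = 0\<close> the matrix is an even translation up to sign. In the
  measure, the summand 1 accounts for the exchange, which leaves \<open>\<bar>c\<bar> + \<bar>d\<bar>\<close> unchanged.\<close>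

lemma theta_group_law:
  fixes a b c d :: int
  assumes "a * d - b * c = 1" "even (a - d)" "even (b - c)" "\<tau> \<in> upper_half_plane"
  shows "f ((of_int a * \<tau> + of_int b) / (of_int c * \<tau> + of_int d)) = (of_int c * \<tau> + of_int d) ^ k * f \<tau>"
  using assms
proof (induction "2 * (nat \<bar>c\<bar> + nat \<bar>d\<bar>) + (if \<bar>c\<bar> > \<bar>d\<bar> then 1 else 0)"
    arbitrary: a b c d \<tau> rule: less_induct)
  case less
  note det = less.prems(1) and par = less.prems(2,3) and \<tau> = less.prems(4)
  consider "c = 0" | "c \<noteq> 0" "\<bar>c\<bar> < \<bar>d\<bar>" | "\<bar>d\<bar> < \<bar>c\<bar>" | "\<bar>c\<bar> = \<bar>d\<bar>" by linarith
  then show ?case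
  proof cases
    case 1
    then have ad: "a = 1 \<and> d = 1 \<or> a = -1 \<and> d = -1"
      using det zmult_eq_1_iff[of a d] by simp
    obtain m where b: "b = 2 * m" using par 1 by (auto elim: evenE)
    show ?thesis
    proof (cases "d = 1")
      case True
      then show ?thesis using ad 1 b even_integer_period[OF \<tau>, of m] by auto
    next
      case False
      then have "(of_int a * \<tau> + of_int b) / (of_int c * \<tau> + of_int d) = \<tau> + of_int (2 * (- m))"
        using ad 1 b by auto
      moreover have "(of_int c * \<tau> + of_int d) ^ k = 1" using False ad 1 even_weight by auto
      ultimately show ?thesis using even_integer_period[OF \<tau>, of "- m"] by simp
    qed
  next
    case 2
    obtain e :: int where e: "\<bar>d + 2 * e * c\<bar> < \<bar>d\<bar>"
    proof (cases "(c > 0) = (d > 0)")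
      case True
      then have "\<bar>d + 2 * (-1) * c\<bar> < \<bar>d\<bar>" using 2 by linarith
      then show ?thesis by (rule that)
    next
      case False
      then have "\<bar>d + 2 * 1 * c\<bar> < \<bar>d\<bar>" using 2 by linarith
      then show ?thesis by (rule that)
    qed
    define \<sigma> where "\<sigma> = \<tau> + of_int (2 * (- e))"
    have \<sigma>: "\<sigma> \<in> upper_half_plane"
      unfolding \<sigma>_def using \<tau> uhp_add_of_real[of \<tau> "of_int (2 * (- e))"] by simp
    have "f ((of_int a * \<sigma> + of_int (b + 2 * e * a)) / (of_int c * \<sigma> + of_int (d + 2 * e * c))) =
        (of_int c * \<sigma> + of_int (d + 2 * e * c)) ^ k * f \<sigma>"
    proof (rule less.hyps[OF _ _ _ _ \<sigma>])
      show "2 * (nat \<bar>c\<bar> + nat \<bar>d + 2 * e * c\<bar>) + (if \<bar>d + 2 * e * c\<bar> < \<bar>c\<bar> then 1 else 0)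
          < 2 * (nat \<bar>c\<bar> + nat \<bar>d\<bar>) + (if \<bar>d\<bar> < \<bar>c\<bar> then 1 else 0)"
        using e by auto
      show "a * (d + 2 * e * c) - (b + 2 * e * a) * c = 1" using det by (simp add: algebra_simps)
      show "even (a - (d + 2 * e * c))" "even (b + 2 * e * a - c)" using par by auto
    qed
    moreover have "of_int a * \<sigma> + of_int (b + 2 * e * a) = of_int a * \<tau> + of_int b"
      "of_int c * \<sigma> + of_int (d + 2 * e * c) = of_int c * \<tau> + of_int d"
      by (simp_all add: \<sigma>_def algebra_simps)
    moreover have "f \<sigma> = f \<tau>" unfolding \<sigma>_def by (rule even_integer_period[OF \<tau>])
    ultimately show ?thesis by (simp only:)
  next
    case 3
    have \<sigma>: "- 1 / \<tau> \<in> upper_half_plane" using \<tau> by (simp only: uhp_inversion)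
    have nz: "\<tau> \<noteq> 0" using uhp_nonzero[OF \<tau>] .
    have "f ((of_int b * (- 1 / \<tau>) + of_int (- a)) / (of_int d * (- 1 / \<tau>) + of_int (- c))) =
        (of_int d * (- 1 / \<tau>) + of_int (- c)) ^ k * f (- 1 / \<tau>)"
    proof (rule less.hyps[OF _ _ _ _ \<sigma>])
      show "2 * (nat \<bar>d\<bar> + nat \<bar>- c\<bar>) + (if \<bar>- c\<bar> < \<bar>d\<bar> then 1 else 0)
          < 2 * (nat \<bar>c\<bar> + nat \<bar>d\<bar>) + (if \<bar>d\<bar> < \<bar>c\<bar> then 1 else 0)"
        using 3 by auto
      show "b * - c - - a * d = 1" using det by (simp add: algebra_simps)
      show "even (b - - c)" "even (- a - d)" using par by auto
    qed
    moreover have num: "of_int b * (- 1 / \<tau>) + of_int (- a) = - (of_int a * \<tau> + of_int b) / \<tau>"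
      and den: "of_int d * (- 1 / \<tau>) + of_int (- c) = - (of_int c * \<tau> + of_int d) / \<tau>"
      using nz by (simp_all add: field_simps)
    moreover have "- p / \<tau> / (- q / \<tau>) = p / q" for p q using nz by simp
    ultimately have "f ((of_int a * \<tau> + of_int b) / (of_int c * \<tau> + of_int d)) =
        (- (of_int c * \<tau> + of_int d) / \<tau>) ^ k * (\<tau> ^ k * f \<tau>)"
      by (simp only: num den inversion_law[OF \<tau>])
    also have "\<dots> = (- (of_int c * \<tau> + of_int d)) ^ k * f \<tau>"
      using nz by (simp add: power_divide)
    also have "(- (of_int c * \<tau> + of_int d)) ^ k = (of_int c * \<tau> + of_int d) ^ k"
      using even_weight by (rule power_minus_even)
    finally show ?thesis .
  next
    case 4
    then have "even (c - d)" by (auto simp: abs_eq_iff)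
    then have "even (a * d - b * c)" using par by auto
    then show ?thesis using det by simp
  qed
qed

lemma transforms_quarter_turn: "transforms (int k) f (cayley (mat2 1 0 0 \<i>))"
  unfolding transforms_def using turn
  by (auto simp: cayley_quarter_turn power_int_of_nat)

theorem transforms_cayley_U11:
  assumes "g \<in> cayley_U11"
  shows "transforms (int k) f g"
proof -
  from assms have "transforms (int k) f g \<and> acts_on_uhp g"
  proof (induction rule: cayley_U11_induct)
    case (theta_group a b c d)
    then show ?case
      using theta_group_law[OF theta_group] acts_on_uhp_unimodular
      by (simp add: transforms_def frac_lin_def power_int_of_nat)
  next
    case (turn h)
    then show ?case
      by (blast intro: transforms_mult acts_on_uhp_mult transforms_quarter_turn acts_on_uhp_quarter_turn)
  qed
  then show ?thesis ..
qed

end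

section \<open>Automorphic forms and their weights\<close>

text \<open>Holomorphy on the half plane and the expansion at the cusp are both contained in the statement that
  \<open>f\<close> is a holomorphic function of the nome on the whole unit disc.\<close>

lemma automorphic_formI:
  assumes "\<And>\<tau>. \<tau> \<notin> upper_half_plane \<Longrightarrow> f \<tau> = 0"
    and g: "g holomorphic_on ball 0 1"
    and fg: "\<And>\<tau>. \<tau> \<in> upper_half_plane \<Longrightarrow> f \<tau> = g (nome \<tau>)"
    and "\<And>\<gamma>. \<gamma> \<in> \<Gamma> \<Longrightarrow> transforms k f \<gamma>"
  shows "automorphic_form \<Gamma> k f"
proof -
  have "f holomorphic_on upper_half_plane"
  proof (rule holomorphic_transform)
    show "(g \<circ> nome) holomorphic_on upper_half_plane"
      using norm_nome_less_1 by (intro holomorphic_on_compose_gen[OF holomorphic_nome g]) auto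
  qed (simp add: fg)
  moreover have "(\<lambda>n. (deriv ^^ n) g 0 / fact n * exp (\<i> * pi * \<tau>) ^ n) sums f \<tau>"
    if "\<tau> \<in> upper_half_plane" for \<tau>
    using holomorphic_power_series[OF g, of "nome \<tau>"] norm_nome_less_1[OF that] fg[OF that]
    by (simp add: nome_def)
  ultimately show ?thesis
    using assms(1,4) unfolding automorphic_form_def transforms_def
    by (intro conjI exI[of _ "\<lambda>n. (deriv ^^ n) g 0 / fact n"]) auto
qed

lemma automorphic_form_zero: "automorphic_form \<Gamma> k f \<Longrightarrow> \<tau> \<notin> upper_half_plane \<Longrightarrow> f \<tau> = 0"
  by (simp add: automorphic_form_def)

lemma automorphic_form_transforms: "automorphic_form \<Gamma> k f \<Longrightarrow> \<gamma> \<in> \<Gamma> \<Longrightarrow> transforms k f \<gamma>"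
  by (simp add: automorphic_form_def transforms_def)

lemma automorphic_form_series:
  assumes "automorphic_form \<Gamma> k f"
  obtains g where "g holomorphic_on ball 0 1" "\<And>\<tau>. \<tau> \<in> upper_half_plane \<Longrightarrow> f \<tau> = g (nome \<tau>)"
proof -
  obtain a where a: "\<And>\<tau>. \<tau> \<in> upper_half_plane \<Longrightarrow> (\<lambda>n. a n * nome \<tau> ^ n) sums f \<tau>"
    using assms unfolding automorphic_form_def nome_def by blast
  define g where "g = (\<lambda>x. \<Sum>n. a n * x ^ n)"
  have sums_g: "(\<lambda>n. a n * (x - 0) ^ n) sums g x" if "x \<in> ball 0 1" for x
  proof (cases "x = 0")
    case True
    have "(\<lambda>n. a n * 0 ^ n) sums a 0" by (rule powser_sums_zero)
    then show ?thesis using True by (simp add: g_def sums_iff)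
  next
    case False
    have "norm x < 1" using that by simp
    from nome_preimage[OF this False] obtain \<tau> where "\<tau> \<in> upper_half_plane" "nome \<tau> = x" .
    then show ?thesis using a[of \<tau>] by (simp add: g_def sums_iff)
  qed
  have "g holomorphic_on ball 0 1" using sums_g by (rule power_series_holomorphic)
  moreover have "f \<tau> = g (nome \<tau>)" if "\<tau> \<in> upper_half_plane" for \<tau>
    using a[OF that] by (simp add: g_def sums_iff)
  ultimately show ?thesis by (rule that)
qed

lemma automorphic_form_const: "automorphic_form cayley_U11 0 (on_uhp (\<lambda>_. c))"
proof (rule automorphic_formI[where g = "\<lambda>_. c"])
  show "transforms 0 (on_uhp (\<lambda>_. c)) \<gamma>" if "\<gamma> \<in> cayley_U11" for \<gamma>
    using acts_on_uhp_cayley_U11[OF that] by (simp add: transforms_def acts_on_uhp_def on_uhp_def)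
qed (auto simp: on_uhp_def)

lemma automorphic_form_add:
  assumes f: "automorphic_form \<Gamma> k f" and h: "automorphic_form \<Gamma> k h"
  shows "automorphic_form \<Gamma> k (f + h)"
proof -
  obtain F where F: "F holomorphic_on ball 0 1" "\<And>\<tau>. \<tau> \<in> upper_half_plane \<Longrightarrow> f \<tau> = F (nome \<tau>)"
    using automorphic_form_series[OF f] by blast
  obtain K where K: "K holomorphic_on ball 0 1" "\<And>\<tau>. \<tau> \<in> upper_half_plane \<Longrightarrow> h \<tau> = K (nome \<tau>)"
    using automorphic_form_series[OF h] by blast
  show ?thesis
  proof (rule automorphic_formI[where g = "\<lambda>x. F x + K x"])
    show "(\<lambda>x. F x + K x) holomorphic_on ball 0 1" by (intro holomorphic_intros F K)
    show "transforms k (f + h) \<gamma>" if "\<gamma> \<in> \<Gamma>" for \<gamma>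
      using automorphic_form_transforms[OF f that] automorphic_form_transforms[OF h that]
      by (simp add: transforms_def distrib_left)
  qed (simp_all add: F K automorphic_form_zero[OF f] automorphic_form_zero[OF h])
qed

lemma automorphic_form_mult:
  assumes f: "automorphic_form cayley_U11 k f" and h: "automorphic_form cayley_U11 l h"
  shows "automorphic_form cayley_U11 (k + l) (f * h)"
proof -
  obtain F where F: "F holomorphic_on ball 0 1" "\<And>\<tau>. \<tau> \<in> upper_half_plane \<Longrightarrow> f \<tau> = F (nome \<tau>)"
    using automorphic_form_series[OF f] by blast
  obtain K where K: "K holomorphic_on ball 0 1" "\<And>\<tau>. \<tau> \<in> upper_half_plane \<Longrightarrow> h \<tau> = K (nome \<tau>)"
    using automorphic_form_series[OF h] by blast
  show ?thesis
  proof (rule automorphic_formI[where g = "\<lambda>x. F x * K x"])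
    show "(\<lambda>x. F x * K x) holomorphic_on ball 0 1" by (intro holomorphic_intros F K)
    show "transforms (k + l) (f * h) \<gamma>" if "\<gamma> \<in> cayley_U11" for \<gamma>
      using automorphic_form_transforms[OF f that] automorphic_form_transforms[OF h that]
        acts_on_uhp_cayley_U11[OF that]
      by (simp add: transforms_def acts_on_uhp_def power_int_add)
  qed (simp_all add: F K automorphic_form_zero[OF f])
qed

lemma quarter_turn_in_cayley_U11: "cayley (mat2 1 0 0 \<i>) \<in> cayley_U11"
proof -
  have "conj_transpose (mat2 1 0 0 \<i>) = mat2 1 0 0 (- \<i>)"
    by (rule mat2_eqI) (simp_all add: conj_transpose_def)
  then have "conj_transpose (mat2 1 0 0 \<i>) ** H_form ** mat2 1 0 0 \<i> = H_form"
    unfolding H_form_def mat2_def[symmetric] by (simp add: mat2_mult)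
  then show ?thesis
    by (auto simp: cayley_U11_eq U11_def gaussian_ints_def forall_2)
qed

lemma scalar_i_in_cayley_U11: "mat2 \<i> 0 0 \<i> \<in> cayley_U11"
proof -
  have "conj_transpose (mat2 \<i> 0 0 \<i>) = mat2 (- \<i>) 0 0 (- \<i>)"
    by (rule mat2_eqI) (simp_all add: conj_transpose_def)
  then have "conj_transpose (mat2 \<i> 0 0 \<i>) ** H_form ** mat2 \<i> 0 0 \<i> = H_form"
    unfolding H_form_def mat2_def[symmetric] by (simp add: mat2_mult)
  then have "cayley (mat2 \<i> 0 0 \<i>) \<in> cayley_U11"
    by (auto simp: cayley_U11_eq U11_def gaussian_ints_def forall_2)
  then show ?thesis by (simp add: cayley_mat2)
qed

lemma automorphic_form_turn:
  assumes "automorphic_form cayley_U11 k f" "\<tau> \<in> upper_half_plane"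
  shows "f (quarter_turn \<tau>) = ((1 + \<i>) / 2 * (\<tau> + 1)) powi k * f \<tau>"
  using automorphic_form_transforms[OF assms(1) quarter_turn_in_cayley_U11] assms(2)
  by (simp add: transforms_def cayley_quarter_turn)

text \<open>The scalar matrix \<open>\<i>\<close> acts trivially on the half plane, so \<open>\<i>^k = 1\<close>.\<close>

lemma automorphic_form_weight:
  assumes f: "automorphic_form cayley_U11 k f" and "f \<noteq> 0"
  obtains m where "k = 4 * m"
proof -
  obtain \<tau> where \<tau>: "f \<tau> \<noteq> 0" using \<open>f \<noteq> 0\<close> by (auto simp: fun_eq_iff)
  then have "\<tau> \<in> upper_half_plane" using automorphic_form_zero[OF f] by blast
  then have ik: "\<i> powi k = 1"
    using automorphic_form_transforms[OF f scalar_i_in_cayley_U11] \<tau>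
    by (auto simp: transforms_def frac_lin_def)
  define r where "r = nat (k mod 4)"
  have k: "k = 4 * (k div 4) + int r" by (simp add: r_def)
  have "\<i> powi (4 * (k div 4)) = 1" by (simp only: power_int_mult) simp
  then have "\<i> ^ r = 1" using ik by (subst (asm) k) (simp add: power_int_add)
  moreover have "r < 4" by (simp add: r_def nat_less_iff)
  then have "r = 0 \<or> r = 1 \<or> r = 2 \<or> r = 3" by linarith
  ultimately have "r = 0" by (auto simp: power3_eq_cube complex_eq_iff)
  then show ?thesis using that[of "k div 4"] k by simp
qed

lemma quarter_turn_factor_4: "((1 + \<i>) / 2 * (\<tau> + 1)) ^ 4 = - ((\<tau> + 1) ^ 4) / 4"
proof -
  have "(1 + \<i>) ^ 4 = ((1 + \<i>)\<^sup>2)\<^sup>2" by simp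
  also have "(1 + \<i>)\<^sup>2 = 2 * \<i>" by (simp add: power2_eq_square algebra_simps)
  finally have "(1 + \<i>) ^ 4 = -4" by (simp add: power_mult_distrib)
  then show ?thesis by (simp add: power_mult_distrib power_divide)
qed

lemma quarter_turn_factor_8: "((1 + \<i>) / 2 * (\<tau> + 1)) ^ 8 = (\<tau> + 1) ^ 8 / 16"
proof -
  have "((1 + \<i>) / 2 * (\<tau> + 1)) ^ 8 = (((1 + \<i>) / 2 * (\<tau> + 1)) ^ 4)\<^sup>2"
    unfolding power_mult[symmetric] by simp
  then show ?thesis unfolding quarter_turn_factor_4 by (simp add: power_divide)
qed

theorem automorphic_form_alpha: "automorphic_form cayley_U11 4 alpha"
proof (rule automorphic_formI[OF _ holomorphic_alpha_series alpha_eq_series])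
  show "transforms 4 alpha \<gamma>" if "\<gamma> \<in> cayley_U11" for \<gamma>
  proof -
    have "transforms (int 4) alpha \<gamma>"
    proof (rule transforms_cayley_U11[OF _ _ _ that])
      show "alpha (\<tau> + 2) = alpha \<tau>" if "\<tau> \<in> upper_half_plane" for \<tau>
        using that uhp_add_of_real[of \<tau> 2] by (simp add: alpha_eq_series nome_add_2)
      show "alpha (quarter_turn \<tau>) = ((1 + \<i>) / 2 * (\<tau> + 1)) ^ 4 * alpha \<tau>" if "\<tau> \<in> upper_half_plane" for \<tau>
        by (simp only: alpha_quarter_turn[OF that] quarter_turn_factor_4)
    qed simp
    then show ?thesis by simp
  qed
qed (auto simp: alpha_def on_uhp_def)

theorem automorphic_form_beta: "automorphic_form cayley_U11 8 beta"
proof (rule automorphic_formI[OF _ holomorphic_beta_series beta_eq_series])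
  show "transforms 8 beta \<gamma>" if "\<gamma> \<in> cayley_U11" for \<gamma>
  proof -
    have "transforms (int 8) beta \<gamma>"
    proof (rule transforms_cayley_U11[OF _ _ _ that])
      show "beta (\<tau> + 2) = beta \<tau>" if "\<tau> \<in> upper_half_plane" for \<tau>
        using that uhp_add_of_real[of \<tau> 2] by (simp add: beta_eq_series nome_add_2)
      show "beta (quarter_turn \<tau>) = ((1 + \<i>) / 2 * (\<tau> + 1)) ^ 8 * beta \<tau>" if "\<tau> \<in> upper_half_plane" for \<tau>
        by (simp only: beta_quarter_turn[OF that] quarter_turn_factor_8)
    qed simp
    then show ?thesis by simp
  qed
qed (auto simp: beta_def on_uhp_def)

lemma alpha_series_0 [simp]: "alpha_series 0 = 1"
  by (simp add: alpha_series_def theta10_fourth_series_def theta01_fourth_series_def)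

lemma beta_series_0 [simp]: "beta_series 0 = 1"
  by (simp add: beta_series_def theta10_fourth_series_def theta01_fourth_series_def)

definition discriminant :: "complex \<Rightarrow> complex" where
  "discriminant = alpha * alpha - beta"

lemma discriminant_series:
  "\<tau> \<in> upper_half_plane \<Longrightarrow> discriminant \<tau> = nome \<tau> * disc_unit (nome \<tau>)"
  using discriminant_eq[of \<tau>] by (simp add: discriminant_def power2_eq_square)

lemma discriminant_nonzero: "\<tau> \<in> upper_half_plane \<Longrightarrow> discriminant \<tau> \<noteq> 0"
  using disc_unit_nonzero norm_nome_less_1 by (simp add: discriminant_series)

lemma automorphic_form_discriminant: "automorphic_form cayley_U11 8 discriminant"
proof -
  have "automorphic_form cayley_U11 (4 + 4) (alpha * alpha)"
    by (intro automorphic_form_mult automorphic_form_alpha)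
  moreover have "automorphic_form cayley_U11 (0 + 8) (on_uhp (\<lambda>_. -1) * beta)"
    by (intro automorphic_form_mult automorphic_form_const automorphic_form_beta)
  ultimately have "automorphic_form cayley_U11 8 (alpha * alpha + on_uhp (\<lambda>_. -1) * beta)"
    by (intro automorphic_form_add) simp_all
  moreover have "alpha * alpha + on_uhp (\<lambda>_. -1) * beta = discriminant"
    by (auto simp: discriminant_def fun_eq_iff on_uhp_def beta_def)
  ultimately show ?thesis by simp
qed

section \<open>Spaces of forms of given weight\<close>

text \<open>By reduction to \<open>Im \<tau> \<ge> 1/2\<close>, all values are taken on the disc of radius \<open>1/3\<close>. Hence the modulus has a
  maximum inside the unit disc, and the maximum principle applies.\<close>

lemma invariant_series_constant:
  assumes g: "g holomorphic_on ball 0 1"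
    and inv: "\<And>\<tau>. \<tau> \<in> upper_half_plane \<Longrightarrow> g (nome (quarter_turn \<tau>)) = g (nome \<tau>)"
  shows "g constant_on ball 0 1"
proof -
  define K where "K = cball (0::complex) (1/3)"
  have cont: "continuous_on K (\<lambda>x. norm (g x))"
    using g by (intro continuous_intros holomorphic_on_imp_continuous_on)
      (auto simp: K_def intro: holomorphic_on_subset)
  obtain \<xi> where \<xi>: "\<xi> \<in> K" "\<And>x. x \<in> K \<Longrightarrow> norm (g x) \<le> norm (g \<xi>)"
    using continuous_attains_sup[OF _ _ cont] by (auto simp: K_def)
  have orbit: "g (nome \<tau>) \<in> g ` K" if "\<tau> \<in> upper_half_plane" for \<tau>
  proof (rule upper_half_plane_reduction[OF that])
    show "g (nome \<tau>) \<in> g ` K" if "Im \<tau> \<ge> 1 / 2" for \<tau>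
      using norm_nome_less_third[OF that] by (auto simp: K_def)
  qed (simp_all add: nome_add_2 inv)
  have "norm (g x) \<le> norm (g \<xi>)" if "x \<in> ball 0 1" for x
  proof -
    have "g x \<in> g ` K"
    proof (cases "x = 0")
      case False
      have "norm x < 1" using that by simp
      from nome_preimage[OF this False] obtain \<tau> where "\<tau> \<in> upper_half_plane" "nome \<tau> = x" .
      then show ?thesis using orbit by blast
    qed (simp add: K_def)
    then show ?thesis using \<xi> by auto
  qed
  moreover have "\<xi> \<in> ball 0 1" using \<xi>(1) by (simp add: K_def)
  ultimately show ?thesis
    by (intro maximum_modulus_principle[OF g, where U = "ball 0 1" and \<xi> = \<xi>]) auto
qed

text \<open>For weight \<open>- 4 j\<close>, the function \<open>f^2 \<Delta>^j\<close> has weight 0 and vanishes at the cusp, so it is zero; but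
  \<open>\<Delta>\<close> has no zeros.\<close>

lemma automorphic_form_negative_weight:
  assumes f: "automorphic_form cayley_U11 k f" and "k < 0"
  shows "f = 0"
proof (rule ccontr)
  assume "f \<noteq> 0"
  then obtain m where "k = 4 * m" using automorphic_form_weight[OF f] by blast
  then obtain j where k: "k = - int (4 * j)" "j > 0"
    using \<open>k < 0\<close> that[of "nat (- m)"] by auto
  obtain g where g: "g holomorphic_on ball 0 1" "\<And>\<tau>. \<tau> \<in> upper_half_plane \<Longrightarrow> f \<tau> = g (nome \<tau>)"
    using automorphic_form_series[OF f] by blast
  define F where "F = (\<lambda>x. (g x)\<^sup>2 * (x * disc_unit x) ^ j)"
  have F_eq: "F (nome \<tau>) = (f \<tau>)\<^sup>2 * discriminant \<tau> ^ j" if "\<tau> \<in> upper_half_plane" for \<tau>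
    using that by (simp add: F_def g(2) discriminant_series)
  have "F constant_on ball 0 1"
  proof (rule invariant_series_constant)
    show "F holomorphic_on ball 0 1"
      unfolding F_def by (intro holomorphic_intros g holomorphic_disc_unit)
    fix \<tau> assume \<tau>: "\<tau> \<in> upper_half_plane"
    define s where "s = (1 + \<i>) / 2 * (\<tau> + 1)"
    have "1 + \<i> \<noteq> 0" by (simp add: complex_eq_iff)
    then have s: "s \<noteq> 0" using uhp_add_1_nonzero[OF \<tau>] by (simp add: s_def)
    have "f (quarter_turn \<tau>) = inverse (s ^ (4 * j)) * f \<tau>"
      using automorphic_form_turn[OF f \<tau>] unfolding k s_def[symmetric] power_int_minus power_int_of_nat .
    moreover have "discriminant (quarter_turn \<tau>) = s ^ 8 * discriminant \<tau>"
      using automorphic_form_turn[OF automorphic_form_discriminant \<tau>] by (simp add: s_def)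
    ultimately have "F (nome (quarter_turn \<tau>)) = (inverse (s ^ (4 * j)) * f \<tau>)\<^sup>2 * (s ^ 8 * discriminant \<tau>) ^ j"
      using F_eq[OF quarter_turn_uhp[OF \<tau>]] by simp
    also have "\<dots> = inverse ((s ^ (4 * j))\<^sup>2) * (s ^ 8) ^ j * ((f \<tau>)\<^sup>2 * discriminant \<tau> ^ j)"
      by (simp add: power_mult_distrib power_inverse mult_ac)
    also have "(s ^ 8) ^ j = (s ^ (4 * j))\<^sup>2"
      by (simp add: power_mult[symmetric] mult_ac)
    finally show "F (nome (quarter_turn \<tau>)) = F (nome \<tau>)"
      using s by (simp add: F_eq[OF \<tau>])
  qed
  moreover have "F 0 = 0" using \<open>j > 0\<close> by (simp add: F_def)
  ultimately have F0: "F x = 0" if "x \<in> ball 0 1" for x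
    using that unfolding constant_on_def by (metis centre_in_ball zero_less_one)
  have "f \<tau> = 0" for \<tau>
  proof (cases "\<tau> \<in> upper_half_plane")
    case True
    then show ?thesis using F_eq[OF True] F0 norm_nome_less_1 discriminant_nonzero by simp
  qed (simp add: automorphic_form_zero[OF f])
  with \<open>f \<noteq> 0\<close> show False by (simp add: fun_eq_iff)
qed

lemma automorphic_form_power:
  assumes "automorphic_form cayley_U11 k f"
  shows "automorphic_form cayley_U11 (int m * k) (on_uhp (\<lambda>_. c) * f ^ m)"
proof (induction m)
  case (Suc m)
  have "automorphic_form cayley_U11 (int m * k + k) (on_uhp (\<lambda>_. c) * f ^ m * f)"
    by (intro automorphic_form_mult Suc assms)
  moreover have "int m * k + k = int (Suc m) * k" by (simp add: algebra_simps)
  moreover have "on_uhp (\<lambda>_. c) * f ^ m * f = on_uhp (\<lambda>_. c) * f ^ Suc m"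
    by (simp only: power_Suc2 mult.assoc)
  ultimately show ?case by (simp only:)
qed (simp add: automorphic_form_const)

text \<open>The discriminant has no zero in the half plane and only a simple one at the cusp.\<close>

lemma cusp_form_divisible:
  assumes f: "automorphic_form cayley_U11 k f"
    and g: "g holomorphic_on ball 0 1" "\<And>\<tau>. \<tau> \<in> upper_half_plane \<Longrightarrow> f \<tau> = g (nome \<tau>)"
    and cusp: "g 0 = 0"
  obtains h where "automorphic_form cayley_U11 (k - 8) h" "f = h * discriminant"
proof -
  \<comment> \<open>The quotient \<open>g x / x\<close>, with its removable singularity filled in.\<close>
  define g1 where "g1 = (\<lambda>x. if x = 0 then deriv g 0 else (g x - g 0) / (x - 0))"
  have g1: "g1 holomorphic_on ball 0 1"
    unfolding g1_def by (rule pole_lemma_open[OF g(1)]) simp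
  define h where "h = (\<lambda>\<tau>. f \<tau> / discriminant \<tau>)"
  have "automorphic_form cayley_U11 (k - 8) h"
  proof (rule automorphic_formI)
    show "(\<lambda>x. g1 x / disc_unit x) holomorphic_on ball 0 1"
      using disc_unit_nonzero by (intro holomorphic_intros g1 holomorphic_disc_unit) auto
    show "h \<tau> = g1 (nome \<tau>) / disc_unit (nome \<tau>)" if "\<tau> \<in> upper_half_plane" for \<tau>
      using that by (simp add: h_def g1_def g(2) discriminant_series cusp)
    show "h \<tau> = 0" if "\<tau> \<notin> upper_half_plane" for \<tau>
      using automorphic_form_zero[OF f that] by (simp add: h_def)
    show "transforms (k - 8) h \<gamma>" if "\<gamma> \<in> cayley_U11" for \<gamma>
      using automorphic_form_transforms[OF f that] acts_on_uhp_cayley_U11[OF that]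
        automorphic_form_transforms[OF automorphic_form_discriminant that]
      by (simp add: h_def transforms_def acts_on_uhp_def power_int_diff)
  qed
  moreover have "f = h * discriminant"
  proof
    show "f \<tau> = (h * discriminant) \<tau>" for \<tau>
      using automorphic_form_zero[OF f, of \<tau>] discriminant_nonzero[of \<tau>]
      by (cases "\<tau> \<in> upper_half_plane") (simp_all add: h_def)
  qed
  ultimately show ?thesis by (rule that)
qed

text \<open>Since \<open>\<alpha>\<close> takes the value 1 at the cusp, subtracting the right multiple of \<open>\<alpha>^m\<close> yields a cusp form.\<close>

theorem automorphic_form_decomposition:
  assumes f: "automorphic_form cayley_U11 (4 * int m) f"
  obtains c h where "automorphic_form cayley_U11 (4 * int m - 8) h"
    "f = on_uhp (\<lambda>_. c) * alpha ^ m + h * discriminant"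
proof -
  obtain g where g: "g holomorphic_on ball 0 1" "\<And>\<tau>. \<tau> \<in> upper_half_plane \<Longrightarrow> f \<tau> = g (nome \<tau>)"
    using automorphic_form_series[OF f] by blast
  define c where "c = g 0"
  define f1 where "f1 = f + on_uhp (\<lambda>_. - c) * alpha ^ m"
  have "automorphic_form cayley_U11 (4 * int m) f1"
    unfolding f1_def using automorphic_form_power[OF automorphic_form_alpha, of m "- c"]
    by (intro automorphic_form_add f) (simp add: mult.commute)
  moreover have "(\<lambda>x. g x - c * alpha_series x ^ m) holomorphic_on ball 0 1"
    by (intro holomorphic_intros g holomorphic_alpha_series)
  moreover have pow: "(alpha ^ m) \<tau> = alpha \<tau> ^ m" for \<tau>
    by (induction m) simp_all
  then have "f1 \<tau> = g (nome \<tau>) - c * alpha_series (nome \<tau>) ^ m" if "\<tau> \<in> upper_half_plane" for \<tau>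
    using that by (simp add: f1_def on_uhp_def g(2) alpha_eq_series)
  moreover have "g 0 - c * alpha_series 0 ^ m = 0" by (simp add: c_def)
  ultimately obtain h where h: "automorphic_form cayley_U11 (4 * int m - 8) h" "f1 = h * discriminant"
    by (rule cusp_form_divisible)
  have "f = on_uhp (\<lambda>_. c) * alpha ^ m + f1"
    by (auto simp: f1_def fun_eq_iff on_uhp_def)
  then show ?thesis using h that by simp
qed

section \<open>Evaluating polynomials along a non-unital homomorphism\<close>

context
  fixes \<phi> :: "'a::comm_semiring_0 \<Rightarrow> 'b::comm_semiring_0" and b :: 'b
  assumes \<phi>_0: "\<phi> 0 = 0" and \<phi>_add: "\<And>x y. \<phi> (x + y) = \<phi> x + \<phi> y"
    and \<phi>_mult: "\<And>x y. \<phi> (x * y) = \<phi> x * \<phi> y"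
begin

lemma poly_map_poly_pCons: "poly (map_poly \<phi> (pCons a p)) b = \<phi> a + b * poly (map_poly \<phi> p) b"
  by (simp add: map_poly_pCons \<phi>_0)

lemma poly_map_poly_add:
  "poly (map_poly \<phi> (p + q)) b = poly (map_poly \<phi> p) b + poly (map_poly \<phi> q) b"
  by (induction p q rule: poly_induct2)
     (simp_all add: poly_map_poly_pCons \<phi>_add algebra_simps)

lemma poly_map_poly_smult:
  "poly (map_poly \<phi> (Polynomial.smult c p)) b = \<phi> c * poly (map_poly \<phi> p) b"
  by (induction p) (simp_all add: poly_map_poly_pCons \<phi>_mult algebra_simps)

lemma poly_map_poly_mult:
  "poly (map_poly \<phi> (p * q)) b = poly (map_poly \<phi> p) b * poly (map_poly \<phi> q) b"
proof (induction p)
  case (pCons a p)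
  then show ?case
    by (simp add: mult_pCons_left poly_map_poly_add poly_map_poly_smult poly_map_poly_pCons \<phi>_0 algebra_simps)
qed simp

end

section \<open>The isomorphism with the polynomial ring\<close>

abbreviation const_form :: "complex \<Rightarrow> (int \<Rightarrow>\<^sub>0 (complex \<Rightarrow> complex))" where
  "const_form c \<equiv> of_weight 0 (on_uhp (\<lambda>_. c))"

lemma of_weight_add: "of_weight k (f + g) = of_weight k f + of_weight k g"
  by (simp add: of_weight_def single_add)

lemma of_weight_mult: "of_weight k f * of_weight l g = of_weight (k + l) (f * g)"
  by (simp add: of_weight_def mult_single distrib_left)

lemma of_weight_power: "of_weight k f ^ m = of_weight (int m * k) (f ^ m)"
proof (induction m)
  case 0
  show ?case by (simp only: of_weight_def power_0 of_nat_0 mult_zero_left mult_zero_right single_one)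
next
  case (Suc m)
  have "of_weight k f ^ Suc m = of_weight (k + int m * k) (f * f ^ m)"
    by (simp only: power_Suc Suc of_weight_mult)
  then show ?case by (simp only: power_Suc of_nat_Suc distrib_right mult_1_left)
qed

lemma const_form_0: "const_form 0 = 0"
proof -
  have "on_uhp (\<lambda>_. 0) = 0" by (simp add: on_uhp_def fun_eq_iff)
  then show ?thesis by (simp add: of_weight_def)
qed

lemma const_form_add: "const_form (c + d) = const_form c + const_form d"
proof -
  have "on_uhp (\<lambda>_. c + d) = on_uhp (\<lambda>_. c) + on_uhp (\<lambda>_. d)" by (simp add: on_uhp_def fun_eq_iff)
  then show ?thesis by (simp only: of_weight_add)
qed

lemma const_form_mult: "const_form (c * d) = const_form c * const_form d"
proof -
  have "on_uhp (\<lambda>_. c * d) = on_uhp (\<lambda>_. c) * on_uhp (\<lambda>_. d)" by (simp add: on_uhp_def fun_eq_iff)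
  then show ?thesis by (simp only: of_weight_mult add_0_left)
qed

text \<open>Evaluation of one-variable polynomials at \<open>\<alpha>\<close>. Constants are sent to constant forms supported on the
  half plane, and this map does not preserve the unit of the ambient type; so evaluation
  is multiplicative without being unital.\<close>

definition alpha_eval :: "complex poly \<Rightarrow> (int \<Rightarrow>\<^sub>0 (complex \<Rightarrow> complex))" where
  "alpha_eval q = poly (map_poly const_form q) (of_weight 4 alpha)"

text \<open>The outer variable is \<open>\<beta>\<close>, the variable of the coefficients is \<open>\<alpha>\<close>.\<close>

definition form_eval :: "complex poly poly \<Rightarrow> (int \<Rightarrow>\<^sub>0 (complex \<Rightarrow> complex))" where
  "form_eval p = poly (map_poly alpha_eval p) (of_weight 8 beta)"

lemma alpha_eval_pCons: "alpha_eval (pCons a q) = const_form a + of_weight 4 alpha * alpha_eval q"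
  unfolding alpha_eval_def
  by (rule poly_map_poly_pCons) (simp_all only: const_form_0 const_form_add const_form_mult)

lemma alpha_eval_0 [simp]: "alpha_eval 0 = 0" by (simp add: alpha_eval_def)

lemma alpha_eval_add: "alpha_eval (p + q) = alpha_eval p + alpha_eval q"
  unfolding alpha_eval_def
  by (rule poly_map_poly_add) (simp_all only: const_form_0 const_form_add const_form_mult)

lemma alpha_eval_mult: "alpha_eval (p * q) = alpha_eval p * alpha_eval q"
  unfolding alpha_eval_def
  by (rule poly_map_poly_mult) (simp_all only: const_form_0 const_form_add const_form_mult)

lemma form_eval_pCons: "form_eval (pCons q p) = alpha_eval q + of_weight 8 beta * form_eval p"
  unfolding form_eval_def
  by (rule poly_map_poly_pCons) (simp_all only: alpha_eval_0 alpha_eval_add alpha_eval_mult)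

lemma form_eval_0 [simp]: "form_eval 0 = 0" by (simp add: form_eval_def)

lemma form_eval_add: "form_eval (p + q) = form_eval p + form_eval q"
  unfolding form_eval_def
  by (rule poly_map_poly_add) (simp_all only: alpha_eval_0 alpha_eval_add alpha_eval_mult)

lemma form_eval_mult: "form_eval (p * q) = form_eval p * form_eval q"
  unfolding form_eval_def
  by (rule poly_map_poly_mult) (simp_all only: alpha_eval_0 alpha_eval_add alpha_eval_mult)

lemma unit_form_mult:
  assumes "\<And>\<tau>. \<tau> \<notin> upper_half_plane \<Longrightarrow> f \<tau> = 0"
  shows "of_weight k f * const_form 1 = of_weight k f"
proof -
  have "f * on_uhp (\<lambda>_. 1) = f" using assms by (auto simp: on_uhp_def fun_eq_iff)
  then show ?thesis by (simp only: of_weight_mult add_0_right)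
qed

lemma form_eval_const: "form_eval [:[:c:]:] = const_form c"
  by (simp add: form_eval_pCons alpha_eval_pCons)

lemma form_eval_X: "form_eval [:[:0, 1:]:] = of_weight 4 alpha"
proof -
  have "of_weight 4 alpha * const_form 1 = of_weight 4 alpha"
    by (rule unit_form_mult) (rule automorphic_form_zero[OF automorphic_form_alpha])
  then show ?thesis
    by (simp only: form_eval_pCons alpha_eval_pCons const_form_0 form_eval_0 alpha_eval_0
        mult_zero_right add_0_left add_0_right)
qed

lemma form_eval_Y: "form_eval [:0, 1:] = of_weight 8 beta"
proof -
  have "of_weight 8 beta * const_form 1 = of_weight 8 beta"
    by (rule unit_form_mult) (rule automorphic_form_zero[OF automorphic_form_beta])
  then show ?thesis
    by (simp only: form_eval_pCons alpha_eval_pCons one_pCons form_eval_0 alpha_eval_0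
        mult_zero_right add_0_left add_0_right)
qed

lemma form_eval_one: "form_eval 1 = const_form 1"
  by (simp add: one_pCons form_eval_const)

lemma alpha_eval_monom: "alpha_eval (Polynomial.monom c m) = const_form c * of_weight 4 alpha ^ m"
  by (simp add: alpha_eval_def map_poly_monom const_form_0 poly_monom)

definition graded_forms :: "(int \<Rightarrow>\<^sub>0 (complex \<Rightarrow> complex)) set" where
  "graded_forms = {F. \<forall>d. Poly_Mapping.lookup F d \<in> forms_of_degree cayley_U11 d}"

lemma forms_of_degree_add:
  "f \<in> forms_of_degree \<Gamma> d \<Longrightarrow> g \<in> forms_of_degree \<Gamma> d \<Longrightarrow> f + g \<in> forms_of_degree \<Gamma> d"
  unfolding forms_of_degree_def using automorphic_form_add by fastforce

lemma forms_of_degree_mult: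
  "f \<in> forms_of_degree cayley_U11 d \<Longrightarrow> g \<in> forms_of_degree cayley_U11 e \<Longrightarrow>
     f * g \<in> forms_of_degree cayley_U11 (d + e)"
proof (cases "f = 0 \<or> g = 0")
  case True
  then show ?thesis by (auto simp: forms_of_degree_def)
next
  case False
  assume "f \<in> forms_of_degree cayley_U11 d" "g \<in> forms_of_degree cayley_U11 e"
  with False obtain k l where "d = 2 * k" "automorphic_form cayley_U11 k f"
      "e = 2 * l" "automorphic_form cayley_U11 l g"
    by (auto simp: forms_of_degree_def)
  then have "d + e = 2 * (k + l)" "automorphic_form cayley_U11 (k + l) (f * g)"
    by (auto intro: automorphic_form_mult)
  then show ?thesis unfolding forms_of_degree_def by blast
qed

lemma graded_forms_single:
  "f \<in> forms_of_degree cayley_U11 d \<Longrightarrow> Poly_Mapping.single d f \<in> graded_forms"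
  by (auto simp: graded_forms_def lookup_single when_def forms_of_degree_def)

lemma graded_forms_add: "F \<in> graded_forms \<Longrightarrow> G \<in> graded_forms \<Longrightarrow> F + G \<in> graded_forms"
  by (simp add: graded_forms_def lookup_add forms_of_degree_add)

lemma graded_forms_0: "0 \<in> graded_forms"
  by (simp add: graded_forms_def forms_of_degree_def)

lemma graded_forms_sum: "(\<And>i. i \<in> I \<Longrightarrow> F i \<in> graded_forms) \<Longrightarrow> sum F I \<in> graded_forms"
  by (induction I rule: infinite_finite_induct) (auto intro: graded_forms_add graded_forms_0)

lemma sum_single_lookup:
  fixes F :: "'a \<Rightarrow>\<^sub>0 'b::comm_monoid_add"
  shows "(\<Sum>d\<in>Poly_Mapping.keys F. Poly_Mapping.single d (Poly_Mapping.lookup F d)) = F"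
proof (rule poly_mapping_eqI)
  fix e
  have "Poly_Mapping.lookup (\<Sum>d\<in>Poly_Mapping.keys F. Poly_Mapping.single d (Poly_Mapping.lookup F d)) e
      = (\<Sum>d\<in>Poly_Mapping.keys F. if d = e then Poly_Mapping.lookup F d else 0)"
    by (simp add: lookup_sum lookup_single when_def)
  also have "\<dots> = Poly_Mapping.lookup F e"
    by (simp add: in_keys_iff)
  finally show "Poly_Mapping.lookup (\<Sum>d\<in>Poly_Mapping.keys F. Poly_Mapping.single d (Poly_Mapping.lookup F d)) e
      = Poly_Mapping.lookup F e" .
qed

lemma graded_forms_mult:
  assumes "F \<in> graded_forms" "G \<in> graded_forms"
  shows "F * G \<in> graded_forms"
proof -
  have "F * G = (\<Sum>d\<in>Poly_Mapping.keys F. Poly_Mapping.single d (Poly_Mapping.lookup F d)) *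
      (\<Sum>e\<in>Poly_Mapping.keys G. Poly_Mapping.single e (Poly_Mapping.lookup G e))"
    by (simp only: sum_single_lookup)
  also have "\<dots> = (\<Sum>d\<in>Poly_Mapping.keys F. \<Sum>e\<in>Poly_Mapping.keys G.
      Poly_Mapping.single (d + e) (Poly_Mapping.lookup F d * Poly_Mapping.lookup G e))"
    by (simp only: sum_product mult_single)
  also have "\<dots> \<in> graded_forms"
    using assms by (intro graded_forms_sum graded_forms_single forms_of_degree_mult)
      (auto simp: graded_forms_def)
  finally show ?thesis .
qed

lemma of_weight_in_graded_forms: "automorphic_form cayley_U11 k f \<Longrightarrow> of_weight k f \<in> graded_forms"
  unfolding of_weight_def by (intro graded_forms_single) (auto simp: forms_of_degree_def)

lemma alpha_eval_in_graded_forms: "alpha_eval q \<in> graded_forms"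
  by (induction q)
     (auto simp: alpha_eval_pCons graded_forms_0
       intro!: graded_forms_add graded_forms_mult of_weight_in_graded_forms automorphic_form_const automorphic_form_alpha)

lemma form_eval_in_graded_forms: "form_eval p \<in> graded_forms"
  by (induction p)
     (auto simp: form_eval_pCons graded_forms_0
       intro!: graded_forms_add graded_forms_mult of_weight_in_graded_forms alpha_eval_in_graded_forms automorphic_form_beta)

text \<open>Induction on the weight along the decomposition: the power of \<open>\<alpha>\<close> is a monomial, and \<open>\<Delta>\<close> is the value of
  \<open>X^2 - Y\<close>.\<close>

lemma of_weight_in_range:
  assumes "automorphic_form cayley_U11 k f"
  shows "of_weight k f \<in> range form_eval"
proof -
  have multiple_4: "of_weight (4 * int m) f \<in> range form_eval"
    if "automorphic_form cayley_U11 (4 * int m) f" for m f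
    using that
  proof (induction m arbitrary: f rule: less_induct)
    case (less m)
    from automorphic_form_decomposition[OF less.prems] obtain c h where
      h: "automorphic_form cayley_U11 (4 * int m - 8) h" "f = on_uhp (\<lambda>_. c) * alpha ^ m + h * discriminant" .
    obtain p where p: "of_weight (4 * int m - 8) h = form_eval p"
    proof (cases "m \<ge> 2")
      case True
      then have "4 * int m - 8 = 4 * int (m - 2)" by simp
      then show ?thesis using less.IH[of "m - 2" h] h(1) True that by auto
    next
      case False
      then have "h = 0" using automorphic_form_negative_weight[OF h(1)] by simp
      then have "of_weight (4 * int m - 8) h = form_eval 0" by (simp add: of_weight_def)
      then show ?thesis by (rule that)
    qed
    define D where "D = [:[:0, 1:]:] * [:[:0, 1:]:] + [:[:-1:]:] * [:0, 1 :: complex poly:]"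
    have "form_eval D = of_weight 4 alpha * of_weight 4 alpha + const_form (-1) * of_weight 8 beta"
      unfolding D_def form_eval_add form_eval_mult form_eval_X form_eval_Y form_eval_const ..
    also have "\<dots> = of_weight 8 (alpha * alpha + on_uhp (\<lambda>_. -1) * beta)"
      by (simp only: of_weight_mult of_weight_add) simp
    also have "alpha * alpha + on_uhp (\<lambda>_. -1) * beta = discriminant"
      by (auto simp: discriminant_def fun_eq_iff on_uhp_def beta_def)
    finally have D: "form_eval D = of_weight 8 discriminant" .
    have "form_eval [:Polynomial.monom c m:] = of_weight (4 * int m) (on_uhp (\<lambda>_. c) * alpha ^ m)"
      by (simp add: form_eval_pCons alpha_eval_monom of_weight_power of_weight_mult mult.commute)
    moreover have "form_eval (p * D) = of_weight (4 * int m) (h * discriminant)"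
      unfolding form_eval_mult D p[symmetric] of_weight_mult by simp
    ultimately have "of_weight (4 * int m) f = form_eval ([:Polynomial.monom c m:] + p * D)"
      by (simp only: form_eval_add h(2) of_weight_add)
    then show ?case by blast
  qed
  show ?thesis
  proof (cases "f = 0")
    case True
    then have "of_weight k f = form_eval 0" by (simp add: of_weight_def)
    then show ?thesis by blast
  next
    case False
    then obtain m where m: "k = 4 * m" using automorphic_form_weight[OF assms] by blast
    moreover have "m \<ge> 0" using automorphic_form_negative_weight[OF assms] False m by force
    ultimately have "k = 4 * int (nat m)" by simp
    then show ?thesis using multiple_4 assms by metis
  qed
qed

lemma graded_forms_in_range:
  assumes "F \<in> graded_forms"
  shows "F \<in> range form_eval"
proof -
  have sum_range: "sum G I \<in> range form_eval" if "\<And>i. i \<in> I \<Longrightarrow> G i \<in> range form_eval" for G and I :: "int set"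
    using that
  proof (induction I rule: infinite_finite_induct)
    case (insert i I)
    then obtain p q where "G i = form_eval p" "sum G I = form_eval q" by blast
    then have "sum G (insert i I) = form_eval (p + q)"
      using insert by (simp add: form_eval_add)
    then show ?case by blast
  qed (auto intro: range_eqI[of _ _ 0])
  have "Poly_Mapping.single d (Poly_Mapping.lookup F d) \<in> range form_eval" for d
  proof (cases "Poly_Mapping.lookup F d = 0")
    case False
    moreover have "Poly_Mapping.lookup F d \<in> forms_of_degree cayley_U11 d"
      using assms by (simp add: graded_forms_def)
    ultimately obtain k where "d = 2 * k" "automorphic_form cayley_U11 k (Poly_Mapping.lookup F d)"
      by (auto simp: forms_of_degree_def)
    then show ?thesis using of_weight_in_range by (simp add: of_weight_def)
  qed (auto intro: range_eqI[of _ _ 0])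
  then have "(\<Sum>d\<in>Poly_Mapping.keys F. Poly_Mapping.single d (Poly_Mapping.lookup F d)) \<in> range form_eval"
    by (intro sum_range)
  then show ?thesis by (simp only: sum_single_lookup)
qed

section \<open>Algebraic independence\<close>

text \<open>Evaluation at a point of the half plane, with degree \<open>d\<close> weighted by \<open>s^d\<close>. The extra parameter keeps
  the homogeneous components apart, which evaluation at \<open>\<tau>\<close> alone would add up.\<close>

definition specialise :: "complex \<Rightarrow> complex \<Rightarrow> (int \<Rightarrow>\<^sub>0 (complex \<Rightarrow> complex)) \<Rightarrow> complex" where
  "specialise \<tau> s F = (\<Sum>d\<in>Poly_Mapping.keys F. Poly_Mapping.lookup F d \<tau> * s powi d)"

lemma specialise_superset:
  assumes "finite D" "Poly_Mapping.keys F \<subseteq> D"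
  shows "specialise \<tau> s F = (\<Sum>d\<in>D. Poly_Mapping.lookup F d \<tau> * s powi d)"
  unfolding specialise_def using assms
  by (intro sum.mono_neutral_left) (auto simp: in_keys_iff)

lemma specialise_add: "specialise \<tau> s (F + G) = specialise \<tau> s F + specialise \<tau> s G"
proof -
  define D where "D = Poly_Mapping.keys F \<union> Poly_Mapping.keys G"
  have D: "finite D" by (simp add: D_def)
  have "Poly_Mapping.keys (F + G) \<subseteq> D" unfolding D_def by (rule keys_add)
  then show ?thesis
    by (simp add: specialise_superset[OF D] D_def lookup_add distrib_right sum.distrib)
qed

lemma specialise_0 [simp]: "specialise \<tau> s 0 = 0"
  by (simp add: specialise_def)

lemma specialise_sum: "specialise \<tau> s (sum F I) = (\<Sum>i\<in>I. specialise \<tau> s (F i))"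
  by (induction I rule: infinite_finite_induct) (simp_all add: specialise_add)

lemma specialise_single: "specialise \<tau> s (Poly_Mapping.single d f) = f \<tau> * s powi d"
  by (cases "f = 0") (simp_all add: specialise_def)

lemma specialise_single_mult:
  assumes "s \<noteq> 0"
  shows "specialise \<tau> s (Poly_Mapping.single d f * F) = f \<tau> * s powi d * specialise \<tau> s F"
proof -
  have "Poly_Mapping.single d f * F = Poly_Mapping.single d f *
      (\<Sum>e\<in>Poly_Mapping.keys F. Poly_Mapping.single e (Poly_Mapping.lookup F e))"
    by (simp only: sum_single_lookup)
  also have "\<dots> = (\<Sum>e\<in>Poly_Mapping.keys F. Poly_Mapping.single (d + e) (f * Poly_Mapping.lookup F e))"
    by (simp only: sum_distrib_left mult_single)
  finally show ?thesis
    using assms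
    by (simp add: specialise_sum specialise_single power_int_add specialise_def[of \<tau> s F] sum_distrib_left mult_ac)
qed

lemma specialise_form_eval:
  assumes "\<tau> \<in> upper_half_plane" "s \<noteq> 0"
  shows "specialise \<tau> s (form_eval p) =
     poly (map_poly (\<lambda>q. poly q (alpha \<tau> * s ^ 8)) p) (beta \<tau> * s ^ 16)"
proof -
  have inner: "specialise \<tau> s (alpha_eval q) = poly q (alpha \<tau> * s ^ 8)" for q
    using assms
    by (induction q) (simp_all add: alpha_eval_pCons specialise_add of_weight_def
        specialise_single specialise_single_mult on_uhp_def)
  show ?thesis
    using assms
    by (induction p) (simp_all add: form_eval_pCons specialise_add of_weight_def
        specialise_single_mult inner map_poly_pCons)
qed

text \<open>The quotient tends to 1 at the cusp and never equals 1, because \<open>\<alpha>^2 - \<beta>\<close> has no zeros.\<close>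

lemma beta_over_alpha_square_infinite:
  "infinite {beta \<tau> / (alpha \<tau>)\<^sup>2 |\<tau>. \<tau> \<in> upper_half_plane \<and> alpha \<tau> \<noteq> 0}"
proof
  define T where "T = {beta \<tau> / (alpha \<tau>)\<^sup>2 |\<tau>. \<tau> \<in> upper_half_plane \<and> alpha \<tau> \<noteq> 0}"
  assume "finite {beta \<tau> / (alpha \<tau>)\<^sup>2 |\<tau>. \<tau> \<in> upper_half_plane \<and> alpha \<tau> \<noteq> 0}"
  then have "finite T" by (simp add: T_def)
  then obtain d where d: "d > 0" "\<And>t. t \<in> T \<Longrightarrow> t \<noteq> 1 \<Longrightarrow> d \<le> dist 1 t"
    using finite_set_avoid[of T 1] by blast
  have a: "isCont alpha_series 0" and b: "isCont beta_series 0"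
    using holomorphic_alpha_series holomorphic_beta_series
    by (auto intro!: continuous_on_interior[of "ball 0 1"] holomorphic_on_imp_continuous_on)
  then have "isCont (\<lambda>x. beta_series x / (alpha_series x)\<^sup>2) 0"
    by (intro continuous_intros) simp_all
  then have "(\<lambda>x. beta_series x / (alpha_series x)\<^sup>2) \<midarrow>0\<rightarrow> 1"
    by (simp add: isCont_def)
  then have "\<forall>\<^sub>F x in at 0. dist (beta_series x / (alpha_series x)\<^sup>2) 1 < d"
    using d(1) by (rule tendstoD)
  moreover have "\<forall>\<^sub>F x in at 0. alpha_series x \<noteq> 0"
    using a by (intro tendsto_imp_eventually_ne[where c = 1]) (simp_all add: isCont_def)
  moreover have "\<forall>\<^sub>F x in at 0. x \<in> ball 0 1 - {0::complex}"
    by (intro eventually_at_in_open) auto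
  ultimately have "\<forall>\<^sub>F x in at 0. dist (beta_series x / (alpha_series x)\<^sup>2) 1 < d \<and>
      alpha_series x \<noteq> 0 \<and> x \<in> ball 0 1 - {0}"
    by eventually_elim blast
  then obtain x where x: "dist (beta_series x / (alpha_series x)\<^sup>2) 1 < d" "alpha_series x \<noteq> 0" "x \<in> ball 0 1 - {0}"
    using eventually_happens'[OF at_neq_bot] by blast
  have "norm x < 1" "x \<noteq> 0" using x(3) by auto
  from nome_preimage[OF this] obtain \<tau> where \<tau>: "\<tau> \<in> upper_half_plane" "nome \<tau> = x" .
  define t where "t = beta \<tau> / (alpha \<tau>)\<^sup>2"
  have alpha: "alpha \<tau> \<noteq> 0" using x \<tau> by (simp add: alpha_eq_series)
  have "t \<in> T" using \<tau> alpha by (auto simp: T_def t_def)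
  moreover have "t \<noteq> 1"
  proof
    assume "t = 1"
    then have "discriminant \<tau> = 0" using alpha by (simp add: t_def discriminant_def power2_eq_square)
    then show False using discriminant_nonzero[OF \<tau>(1)] by simp
  qed
  ultimately have "d \<le> dist 1 t" by (rule d(2))
  moreover have "dist t 1 < d" using x(1) \<tau> by (simp add: t_def alpha_eq_series beta_eq_series)
  ultimately show False by (simp add: dist_commute)
qed

text \<open>As \<open>s\<close> varies, \<open>\<alpha>\<close> can be scaled to any \<open>x \<noteq> 0\<close>, and \<open>\<beta>\<close> becomes \<open>x^2\<close> times \<open>\<beta> / \<alpha>^2\<close>. So for each
  \<open>x \<noteq> 0\<close> the polynomial \<open>p (x, y)\<close> has infinitely many zeros \<open>y\<close>, and each of its coefficients vanishes
  for all \<open>x \<noteq> 0\<close>.\<close>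

lemma form_eval_kernel:
  assumes "form_eval p = 0"
  shows "p = 0"
proof (rule poly_eqI)
  fix j
  have coeff_0: "poly (Polynomial.coeff p j) x = 0" if "x \<noteq> 0" for x
  proof -
    define P where "P = map_poly (\<lambda>q. poly q x) p"
    have "infinite ((\<lambda>t. x\<^sup>2 * t) ` {beta \<tau> / (alpha \<tau>)\<^sup>2 |\<tau>. \<tau> \<in> upper_half_plane \<and> alpha \<tau> \<noteq> 0})"
      using beta_over_alpha_square_infinite that by (subst finite_image_iff) (auto simp: inj_on_def)
    moreover have "(\<lambda>t. x\<^sup>2 * t) ` {beta \<tau> / (alpha \<tau>)\<^sup>2 |\<tau>. \<tau> \<in> upper_half_plane \<and> alpha \<tau> \<noteq> 0}
        \<subseteq> {y. poly P y = 0}"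
    proof
      fix y assume "y \<in> (\<lambda>t. x\<^sup>2 * t) ` {beta \<tau> / (alpha \<tau>)\<^sup>2 |\<tau>. \<tau> \<in> upper_half_plane \<and> alpha \<tau> \<noteq> 0}"
      then obtain \<tau> where \<tau>: "\<tau> \<in> upper_half_plane" "alpha \<tau> \<noteq> 0" and y: "y = x\<^sup>2 * (beta \<tau> / (alpha \<tau>)\<^sup>2)"
        by blast
      \<comment> \<open>The form \<open>\<alpha>\<close> has degree 8.\<close>
      have "(8::nat) \<noteq> 0" by simp
      from exists_complex_root[OF this, of "x / alpha \<tau>"] obtain s where "x / alpha \<tau> = s ^ 8" .
      then have s: "s ^ 8 = x / alpha \<tau>" by (rule sym)
      have s0: "s \<noteq> 0" using s that \<tau> by auto
      have "s ^ 16 = (s ^ 8)\<^sup>2" by simp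
      then have "beta \<tau> * s ^ 16 = y" by (simp add: s y power_divide)
      moreover have "alpha \<tau> * s ^ 8 = x" using \<tau> by (simp add: s)
      ultimately show "y \<in> {y. poly P y = 0}"
        using specialise_form_eval[OF \<tau>(1) s0, of p] assms by (simp add: P_def)
    qed
    ultimately have "P = 0" using poly_roots_finite finite_subset by blast
    then have "Polynomial.coeff P j = 0" by simp
    then show ?thesis by (simp add: P_def coeff_map_poly)
  qed
  show "Polynomial.coeff p j = Polynomial.coeff 0 j"
  proof (rule ccontr)
    assume "Polynomial.coeff p j \<noteq> Polynomial.coeff 0 j"
    then have "finite {x. poly (Polynomial.coeff p j) x = 0}" by (intro poly_roots_finite) simp
    moreover have "- {0} \<subseteq> {x. poly (Polynomial.coeff p j) x = 0}" using coeff_0 by auto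
    ultimately have "finite (- {0::complex})" by (rule finite_subset[rotated])
    then show False by (simp add: infinite_UNIV_char_0)
  qed
qed

lemma form_eval_inj: "inj form_eval"
proof (rule injI)
  fix p q assume "form_eval p = form_eval q"
  moreover have "form_eval p = form_eval (p - q) + form_eval q" by (simp add: form_eval_add[symmetric])
  ultimately have "form_eval (p - q) = 0" by simp
  then show "p = q" using form_eval_kernel[of "p - q"] by simp
qed

theorem proposition3:
  shows "automorphic_form cayley_U11 4 alpha \<and>
    automorphic_form cayley_U11 8 beta \<and>
    (\<exists>\<Phi> \<in> ring_iso (ring_of_type_algebra :: complex poly poly ring) (automorphic_ring cayley_U11).
      (\<forall>c. \<Phi> [:[:c:]:] = of_weight 0 (on_uhp (\<lambda>_. c))) \<and>
      \<Phi> [:[:0, 1:]:] = of_weight 4 alpha \<and>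
      \<Phi> [:0, 1:] = of_weight 8 beta)"
proof (intro conjI bexI[of _ form_eval] allI)
  have "range form_eval = graded_forms"
    using form_eval_in_graded_forms graded_forms_in_range by blast
  then have "bij_betw form_eval UNIV graded_forms"
    using form_eval_inj by (simp add: bij_betw_def)
  moreover have "carrier (automorphic_ring cayley_U11) = graded_forms"
    by (simp add: automorphic_ring_def graded_forms_def)
  ultimately show "form_eval \<in> ring_iso ring_of_type_algebra (automorphic_ring cayley_U11)"
    unfolding ring_iso_def ring_hom_def
    using form_eval_in_graded_forms form_eval_one
    by (simp add: ring_of_type_algebra_def automorphic_ring_def form_eval_add form_eval_mult of_weight_def)
qed (rule automorphic_form_alpha automorphic_form_beta form_eval_const form_eval_X form_eval_Y)+

end
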